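(* Let $n\geq 4$. Every open book decomposition of the sphere $\mathbb{S}^{n-2}$ spun embeds in the open book decomposition $\mathbb{S}^n=\mathrm{OB}(\mathbb{D}^{n-1},\mathrm{id})$.
   Context: All manifolds and maps are smooth. Open books. Let $V$ be a compact manifold with non-empty boundary and let $\phi$ be a diffeomorphism of $V$ that is the identity near $\partial V$. Let $\mathcal{MT}(V,\phi)$ be the mapping torus of $\phi$. Then $\mathrm{OB}(V,\phi)$ denotes the closed manifold $\mathcal{MT}(V,\phi)\cup_{\mathrm{id}}(\partial V\times \mathbb{D}^2)$ together with this decomposition. An open book decomposition of a closed manifold $M$ is such a pair $(V,\phi)$ with $M$ diffeomorphic to $\mathrm{OB}(V,\phi)$. Here $V$ is the page, $\partial V$ the binding and $\phi$ the monodromy. Spun embedding. $\mathrm{OB}(\Sigma_1,\phi_1)$ spun embeds in $\mathrm{OB}(\Sigma_2,\phi_2)$ if there is a proper embedding $g:(\Sigma_1,\partial\Sigma_1)\to(\Sigma_2,\partial\Sigma_2)$ such that $g\circ\phi_1$ is isotopic to $\phi_2\circ g$ relative to the boundary. *)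

theory Defs
  imports "HOL-Analysis.Analysis"
begin

section \<open>Smooth maps between subsets of Euclidean spaces\<close>

text \<open>\<open>Ck_on k W f\<close> is meant for open \<open>W\<close> only: all iterated directional
  derivatives of \<open>f\<close> up to order \<open>k\<close> exist on \<open>W\<close> and are continuous.\<close>

primrec Ck_on :: "nat \<Rightarrow> 'a::euclidean_space set \<Rightarrow> ('a \<Rightarrow> 'b::euclidean_space) \<Rightarrow> bool" where
  "Ck_on 0 W f \<longleftrightarrow> continuous_on W f"
| "Ck_on (Suc k) W f \<longleftrightarrow>
     (\<forall>x\<in>W. f differentiable (at x)) \<and> (\<forall>v. Ck_on k W (\<lambda>x. frechet_derivative f (at x) v))"

text \<open>On an arbitrary set, smooth means: locally the restriction of a smooth map defined on an
  open subset of the ambient space. On relatively open subsets of a half-space this is the usual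
  notion of smoothness up to the boundary.\<close>

definition smooth_on :: "'a::euclidean_space set \<Rightarrow> ('a \<Rightarrow> 'b::euclidean_space) \<Rightarrow> bool" where
  "smooth_on A f \<longleftrightarrow>
     (\<forall>x\<in>A. \<exists>W F. open W \<and> x \<in> W \<and> (\<forall>k. Ck_on k W F) \<and> (\<forall>y\<in>A \<inter> W. F y = f y))"


section \<open>Charted spaces and manifolds\<close>

text \<open>A chart is a pair of a domain and a map into a Euclidean space; the values of the map outside
  the domain are irrelevant. Images of charts are restricted only in the definition of a manifold,
  so that products (with corners) and subsets of manifolds are charted spaces as well.\<close>

record ('a, 'e) charted =
  topo :: "'a topology"
  charts :: "('a set \<times> ('a \<Rightarrow> 'e)) set"

abbreviation points :: "('a, 'e) charted \<Rightarrow> 'a set" where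
  "points X \<equiv> topspace (topo X)"

definition smooth_map ::
  "('a, 'e::euclidean_space) charted \<Rightarrow> ('b, 'f::euclidean_space) charted \<Rightarrow> ('a \<Rightarrow> 'b) \<Rightarrow> bool" where
  "smooth_map X Y f \<longleftrightarrow>
     continuous_map (topo X) (topo Y) f \<and>
     (\<forall>(U, c)\<in>charts X. \<forall>(W, d)\<in>charts Y.
        smooth_on (c ` {x \<in> U. f x \<in> W}) (d \<circ> f \<circ> inv_into U c))"

definition diffeomorphism ::
  "('a, 'e::euclidean_space) charted \<Rightarrow> ('b, 'f::euclidean_space) charted \<Rightarrow> ('a \<Rightarrow> 'b) \<Rightarrow> bool" where
  "diffeomorphism X Y f \<longleftrightarrow>
     bij_betw f (points X) (points Y) \<and>
     smooth_map X Y f \<and> smooth_map Y X (inv_into (points X) f)"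

definition restrict_to :: "('a, 'e) charted \<Rightarrow> 'a set \<Rightarrow> ('a, 'e) charted" where
  "restrict_to X A =
     \<lparr>topo = subtopology (topo X) A, charts = (\<lambda>(U, c). (U \<inter> A, c)) ` charts X\<rparr>"

definition product :: "('a, 'e) charted \<Rightarrow> ('b, 'f) charted \<Rightarrow> ('a \<times> 'b, 'e \<times> 'f) charted" where
  "product X Y =
     \<lparr>topo = prod_topology (topo X) (topo Y),
      charts = {(U \<times> W, map_prod c d) | U c W d. (U, c) \<in> charts X \<and> (W, d) \<in> charts Y}\<rparr>"

definition half_space :: "'e::euclidean_space \<Rightarrow> 'e set" where
  "half_space b = {y. 0 \<le> y \<bullet> b}"

text \<open>Each chart may use its own half-space; any two differ by a rotation. The dimension of a
  manifold is the dimension of the Euclidean type in which its charts take values.\<close>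

definition model_open :: "'e::euclidean_space set \<Rightarrow> bool" where
  "model_open S \<longleftrightarrow> open S \<or> (\<exists>b. b \<noteq> 0 \<and> openin (top_of_set (half_space b)) S)"

definition manifold_with_boundary :: "('a, 'e::euclidean_space) charted \<Rightarrow> bool" where
  "manifold_with_boundary X \<longleftrightarrow>
     Hausdorff_space (topo X) \<and> second_countable (topo X) \<and>
     points X = \<Union> (fst ` charts X) \<and>
     (\<forall>(U, c)\<in>charts X.
        openin (topo X) U \<and> model_open (c ` U) \<and>
        homeomorphic_map (subtopology (topo X) U) (top_of_set (c ` U)) c) \<and>
     (\<forall>(U, c)\<in>charts X. \<forall>(W, d)\<in>charts X. smooth_on (c ` (U \<inter> W)) (d \<circ> inv_into U c))"

definition boundary_chart ::
  "('a, 'e::euclidean_space) charted \<Rightarrow> 'a \<Rightarrow> 'a set \<Rightarrow> ('a \<Rightarrow> 'e) \<Rightarrow> 'e \<Rightarrow> bool" where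
  "boundary_chart X p U c b \<longleftrightarrow>
     (U, c) \<in> charts X \<and> p \<in> U \<and> b \<noteq> 0 \<and>
     openin (top_of_set (half_space b)) (c ` U) \<and> c p \<bullet> b = 0"

definition boundary :: "('a, 'e::euclidean_space) charted \<Rightarrow> 'a set" where
  "boundary X = {p. \<exists>U c b. boundary_chart X p U c b}"

definition closed_manifold :: "('a, 'e::euclidean_space) charted \<Rightarrow> bool" where
  "closed_manifold X \<longleftrightarrow>
     manifold_with_boundary X \<and> compact_space (topo X) \<and> boundary X = {}"

text \<open>The smooth structure that a subset \<open>A\<close> of a Euclidean space inherits: all diffeomorphisms
  from relatively open subsets of \<open>A\<close> onto open subsets of \<open>'e\<close> or of a half-space of \<open>'e\<close>.\<close>

definition submanifold :: "'f::euclidean_space set \<Rightarrow> ('f, 'e::euclidean_space) charted" where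
  "submanifold A =
     \<lparr>topo = top_of_set A,
      charts = {(U, c). openin (top_of_set A) U \<and> inj_on c U \<and> model_open (c ` U) \<and>
                        smooth_on U c \<and> smooth_on (c ` U) (inv_into U c)}\<rparr>"


section \<open>Proper embeddings and isotopies\<close>

text \<open>The derivative at a point of a set that is open in a half-space is unique.\<close>

definition immersion ::
  "('a, 'e::euclidean_space) charted \<Rightarrow> ('b, 'f::euclidean_space) charted \<Rightarrow> ('a \<Rightarrow> 'b) \<Rightarrow> bool" where
  "immersion X Y g \<longleftrightarrow>
     smooth_map X Y g \<and>
     (\<forall>(U, c)\<in>charts X. \<forall>(W, d)\<in>charts Y. \<forall>p\<in>U. g p \<in> W \<longrightarrow>
        (\<exists>L. ((d \<circ> g \<circ> inv_into U c) has_derivative L) (at (c p) within c ` {x \<in> U. g x \<in> W}) \<and>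
             inj L))"

definition smooth_embedding ::
  "('a, 'e::euclidean_space) charted \<Rightarrow> ('b, 'f::euclidean_space) charted \<Rightarrow> ('a \<Rightarrow> 'b) \<Rightarrow> bool" where
  "smooth_embedding X Y g \<longleftrightarrow> immersion X Y g \<and> embedding_map (topo X) (topo Y) g"

text \<open>In a boundary chart of the target, the tangent space of the boundary is the orthogonal
  complement of the normal vector \<open>b\<close>, a hyperplane.\<close>

definition transverse_to_boundary ::
  "('a, 'e::euclidean_space) charted \<Rightarrow> ('b, 'f::euclidean_space) charted \<Rightarrow> ('a \<Rightarrow> 'b) \<Rightarrow> bool" where
  "transverse_to_boundary X Y g \<longleftrightarrow>
     (\<forall>(U, c)\<in>charts X. \<forall>p\<in>U \<inter> boundary X. \<forall>W d b. boundary_chart Y (g p) W d b \<longrightarrow>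
        (\<exists>L v. ((d \<circ> g \<circ> inv_into U c) has_derivative L) (at (c p) within c ` {x \<in> U. g x \<in> W}) \<and>
               L v \<bullet> b \<noteq> 0))"

definition proper_embedding ::
  "('a, 'e::euclidean_space) charted \<Rightarrow> ('b, 'f::euclidean_space) charted \<Rightarrow> ('a \<Rightarrow> 'b) \<Rightarrow> bool" where
  "proper_embedding X Y g \<longleftrightarrow>
     smooth_embedding X Y g \<and> {x \<in> points X. g x \<in> boundary Y} = boundary X \<and>
     transverse_to_boundary X Y g"

definition isotopic_rel_boundary ::
  "('a, 'e::euclidean_space) charted \<Rightarrow> ('b, 'f::euclidean_space) charted \<Rightarrow>
   ('a \<Rightarrow> 'b) \<Rightarrow> ('a \<Rightarrow> 'b) \<Rightarrow> bool" where
  "isotopic_rel_boundary X Y f g \<longleftrightarrow>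
     (\<exists>H. smooth_map (product X (submanifold {0..1} :: (real, real) charted)) Y H \<and>
          (\<forall>t\<in>{0..1}. proper_embedding X Y (\<lambda>x. H (x, t))) \<and>
          (\<forall>x\<in>points X. H (x, 0) = f x \<and> H (x, 1) = g x) \<and>
          (\<forall>x\<in>boundary X. \<forall>t\<in>{0..1}. H (x, t) = f x))"


section \<open>Mapping tori\<close>

definition quotient_topology :: "'a topology \<Rightarrow> ('a \<Rightarrow> 'b) \<Rightarrow> 'b topology" where
  "quotient_topology X q =
     topology (\<lambda>S. S \<subseteq> q ` topspace X \<and> openin X {x \<in> topspace X. q x \<in> S})"

lemma openin_quotient_topology:
  "openin (quotient_topology X q) S \<longleftrightarrow>
     S \<subseteq> q ` topspace X \<and> openin X {x \<in> topspace X. q x \<in> S}"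
proof -
  have 1: "{x \<in> topspace X. q x \<in> S \<inter> T} =
      {x \<in> topspace X. q x \<in> S} \<inter> {x \<in> topspace X. q x \<in> T}" for S T
    by auto
  have 2: "{x \<in> topspace X. q x \<in> \<Union> K} = (\<Union>S\<in>K. {x \<in> topspace X. q x \<in> S})" for K
    by auto
  have "istopology (\<lambda>S. S \<subseteq> q ` topspace X \<and> openin X {x \<in> topspace X. q x \<in> S})"
    unfolding istopology_def 1 2 by blast
  then show ?thesis
    by (simp add: quotient_topology_def topology_inverse')
qed

text \<open>The quotient of \<open>V \<times> \<real>\<close> by the free action of the integers generated by
  \<open>(x, t + 1) \<sim> (\<phi> x, t)\<close>, that is, \<open>V \<times> [0,1]\<close> with \<open>(x, 1)\<close> glued to \<open>(\<phi> x, 0)\<close>.\<close>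

definition torus_rel ::
  "('a, 'e) charted \<Rightarrow> ('a \<Rightarrow> 'a) \<Rightarrow> (('a \<times> real) \<times> ('a \<times> real)) set" where
  "torus_rel V \<phi> =
     {((x, t), (y, s)). x \<in> points V \<and> y \<in> points V \<and>
        (\<exists>k::nat. (t = s + real k \<and> y = (\<phi> ^^ k) x) \<or> (s = t + real k \<and> x = (\<phi> ^^ k) y))}"

definition torus_class :: "('a, 'e) charted \<Rightarrow> ('a \<Rightarrow> 'a) \<Rightarrow> 'a \<times> real \<Rightarrow> ('a \<times> real) set" where
  "torus_class V \<phi> p = torus_rel V \<phi> `` {p}"

text \<open>The quotient map is injective on \<open>V \<times> {s<..<s+1}\<close>, and the charts are the product charts of
  \<open>V \<times> \<real>\<close> read off there.\<close>

definition mapping_torus ::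
  "('a, 'e) charted \<Rightarrow> ('a \<Rightarrow> 'a) \<Rightarrow> (('a \<times> real) set, 'e \<times> real) charted" where
  "mapping_torus V \<phi> =
     \<lparr>topo = quotient_topology (prod_topology (topo V) euclideanreal) (torus_class V \<phi>),
      charts = {(torus_class V \<phi> ` (U \<times> {s<..<s+1}),
                 map_prod c id \<circ> inv_into (U \<times> {s<..<s+1}) (torus_class V \<phi>)) | U c s.
                (U, c) \<in> charts V}\<rparr>"


section \<open>Open books\<close>

text \<open>The adjunction space of \<open>X\<close> and \<open>Y\<close> along \<open>h : A \<rightarrow> Y\<close> with \<open>A \<subseteq> X\<close>. Its underlying set is
  \<open>(X - A) \<squnion> Y\<close>, and it has the finest topology for which the two canonical maps
  (\<open>glue_left A h\<close> from \<open>X\<close> and \<open>Inr\<close> from \<open>Y\<close>) are continuous.\<close>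

definition glue_left :: "'a set \<Rightarrow> ('a \<Rightarrow> 'b) \<Rightarrow> 'a \<Rightarrow> 'a + 'b" where
  "glue_left A h x = (if x \<in> A then Inr (h x) else Inl x)"

definition adjunction_topology ::
  "'a topology \<Rightarrow> 'b topology \<Rightarrow> 'a set \<Rightarrow> ('a \<Rightarrow> 'b) \<Rightarrow> ('a + 'b) topology" where
  "adjunction_topology X Y A h =
     topology (\<lambda>S. S \<subseteq> Inl ` (topspace X - A) \<union> Inr ` topspace Y \<and>
                   openin X {x \<in> topspace X. glue_left A h x \<in> S} \<and>
                   openin Y {y \<in> topspace Y. Inr y \<in> S})"

lemma openin_adjunction_topology:
  "openin (adjunction_topology X Y A h) S \<longleftrightarrow>
     S \<subseteq> Inl ` (topspace X - A) \<union> Inr ` topspace Y \<and>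
     openin X {x \<in> topspace X. glue_left A h x \<in> S} \<and>
     openin Y {y \<in> topspace Y. Inr y \<in> S}"
proof -
  have 1: "{x \<in> B. q x \<in> S \<inter> T} = {x \<in> B. q x \<in> S} \<inter> {x \<in> B. q x \<in> T}"
    for B S T and q :: "'c \<Rightarrow> 'a + 'b"
    by auto
  have 2: "{x \<in> B. q x \<in> \<Union> K} = (\<Union>S\<in>K. {x \<in> B. q x \<in> S})"
    for B K and q :: "'c \<Rightarrow> 'a + 'b"
    by auto
  have "istopology (\<lambda>S. S \<subseteq> Inl ` (topspace X - A) \<union> Inr ` topspace Y \<and>
                   openin X {x \<in> topspace X. glue_left A h x \<in> S} \<and>
                   openin Y {y \<in> topspace Y. Inr y \<in> S})"
    unfolding istopology_def 1 2 by blast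
  then show ?thesis
    by (simp add: adjunction_topology_def topology_inverse')
qed

definition binding_nbhd :: "('a, 'e::euclidean_space) charted \<Rightarrow> ('a \<times> complex, 'e \<times> complex) charted" where
  "binding_nbhd V =
     product (restrict_to V (boundary V)) (submanifold (cball 0 1) :: (complex, complex) charted)"

definition torus_boundary ::
  "('a, 'e::euclidean_space) charted \<Rightarrow> ('a \<Rightarrow> 'a) \<Rightarrow> ('a \<times> real) set set" where
  "torus_boundary V \<phi> = torus_class V \<phi> ` (boundary V \<times> UNIV)"

text \<open>The identification of the boundary of the mapping torus with \<open>\<partial>V \<times> S\<^sup>1\<close>. It does not depend on
  the representative, because \<open>\<phi>\<close> is the identity on \<open>\<partial>V\<close>.\<close>

definition boundary_identification :: "('a \<times> real) set \<Rightarrow> 'a \<times> complex" where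
  "boundary_identification P = (case (SOME p. p \<in> P) of (x, t) \<Rightarrow> (x, cis (2 * pi * t)))"

definition torus_inclusion ::
  "('a, 'e::euclidean_space) charted \<Rightarrow> ('a \<Rightarrow> 'a) \<Rightarrow> ('a \<times> real) set \<Rightarrow> ('a \<times> real) set + 'a \<times> complex" where
  "torus_inclusion V \<phi> = glue_left (torus_boundary V \<phi>) boundary_identification"

definition open_book_space ::
  "('a, 'e::euclidean_space) charted \<Rightarrow> ('a \<Rightarrow> 'a) \<Rightarrow> (('a \<times> real) set + 'a \<times> complex) topology" where
  "open_book_space V \<phi> =
     adjunction_topology (topo (mapping_torus V \<phi>)) (topo (binding_nbhd V))
       (torus_boundary V \<phi>) boundary_identification"

text \<open>As always when manifolds are glued along their boundaries, the smooth structure on the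
  resulting space is one that restricts to the given structures on the two pieces. Such a structure
  exists and is unique up to diffeomorphism, but not unique on the nose; hence a predicate.\<close>

definition is_open_book ::
  "('a, 'e::euclidean_space) charted \<Rightarrow> ('a \<Rightarrow> 'a) \<Rightarrow>
   (('a \<times> real) set + 'a \<times> complex, 'e \<times> real) charted \<Rightarrow> bool" where
  "is_open_book V \<phi> N \<longleftrightarrow>
     topo N = open_book_space V \<phi> \<and> closed_manifold N \<and>
     diffeomorphism (mapping_torus V \<phi>)
       (restrict_to N (torus_inclusion V \<phi> ` points (mapping_torus V \<phi>))) (torus_inclusion V \<phi>) \<and>
     diffeomorphism (binding_nbhd V) (restrict_to N (Inr ` points (binding_nbhd V))) Inr"

definition page_with_monodromy ::
  "('a, 'e::euclidean_space) charted \<Rightarrow> ('a \<Rightarrow> 'a) \<Rightarrow> bool" where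
  "page_with_monodromy V \<phi> \<longleftrightarrow>
     manifold_with_boundary V \<and> compact_space (topo V) \<and> boundary V \<noteq> {} \<and>
     diffeomorphism V V \<phi> \<and>
     (\<exists>W. openin (topo V) W \<and> boundary V \<subseteq> W \<and> (\<forall>x\<in>W. \<phi> x = x))"

definition open_book_decomposition ::
  "('m, 'e::euclidean_space \<times> real) charted \<Rightarrow> ('a, 'e) charted \<Rightarrow> ('a \<Rightarrow> 'a) \<Rightarrow> bool" where
  "open_book_decomposition M V \<phi> \<longleftrightarrow>
     closed_manifold M \<and> page_with_monodromy V \<phi> \<and>
     (\<exists>N f. is_open_book V \<phi> N \<and> diffeomorphism M N f)"

definition spun_embeds ::
  "('a, 'e::euclidean_space) charted \<Rightarrow> ('a \<Rightarrow> 'a) \<Rightarrow>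
   ('b, 'f::euclidean_space) charted \<Rightarrow> ('b \<Rightarrow> 'b) \<Rightarrow> bool" where
  "spun_embeds V1 \<phi>1 V2 \<phi>2 \<longleftrightarrow>
     (\<exists>g. proper_embedding V1 V2 g \<and> isotopic_rel_boundary V1 V2 (g \<circ> \<phi>1) (\<phi>2 \<circ> g))"

end

theory Submission
  imports Defs
begin

text \<open>Let \<open>e (x, t)\<close> be the point of the sphere \<open>S\<close> with coordinates \<open>(x, t)\<close> in the mapping torus
  and \<open>E (b, z)\<close> the point with coordinates \<open>(b, z)\<close> in the neighbourhood of the binding. Flowing
  around the open book moves the page \<open>e (x, 0)\<close> to \<open>e (x, 1) = e (\<phi> x, 0)\<close>, but it also rotates the
  boundary of the page around the binding. To keep the boundary fixed, the page at angle \<open>t\<close> is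
  changed in a collar of its boundary: there it is bent on to \<open>E (b, s cis (2 \<pi> t))\<close>, with \<open>s\<close>
  decreasing to \<open>0\<close> at the boundary, where \<open>t\<close> no longer matters. Pushing the page into the ball,
  to the radius \<open>1 - \<rho>\<close> for a defining function \<open>\<rho>\<close> of the boundary, makes all this an isotopy of
  proper embeddings: the radius determines the parameters of the deformation, and for constant
  parameters the deformed map, together with \<open>\<rho>\<close>, is an embedding of a neighbourhood of the
  boundary, because it embeds the boundary. In particular no smoothness across the seam between the
  two pieces of the open book is needed.\<close>

section \<open>Calculus of smooth maps\<close>

text \<open>The ball is the one bounded by the sphere that carries the given open book, so a page
  already lies in its boundary. Two demands compete. At angle \<open>1\<close> the family must
  coincide with the monodromy followed by the family at angle \<open>0\<close>, and the boundary
  must stay fixed throughout, although the flow carries each of its points once around a circle. The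
  bend in the collar serves the second demand, and does not disturb the first because the monodromy
  is the identity there. The two cut-offs that control the bend have staggered ranges, so only one
  parameter changes at a time, and both depend on \<open>R\<close> alone: where the derivative of
  \<open>R\<close> vanishes, theirs vanish too. Away from the collar the radius interpolates between
  \<open>R\<close> and \<open>R\<close> after the monodromy, so that the first and the last stage
  also match there. All data are moved to compact subsets of Euclidean space. Smooth maps on these
  extend to the whole space, so that the deformation can be written with sums and quotients of
  everywhere defined maps, and all tangent spaces are subspaces of one vector space.\<close>

lemma Ck_on_mono: "Ck_on k W f \<Longrightarrow> W' \<subseteq> W \<Longrightarrow> Ck_on k W' f"
  by (induction k arbitrary: f) (auto intro: continuous_on_subset)

lemma Ck_on_cong:
  assumes "open W" "\<And>x. x \<in> W \<Longrightarrow> f x = g x" "Ck_on k W f"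
  shows "Ck_on k W g"
  using assms(2,3)
proof (induction k arbitrary: f g)
  case 0
  then show ?case using continuous_on_cong by (metis Ck_on.simps(1))
next
  case (Suc k)
  have d: "(g has_derivative frechet_derivative f (at x)) (at x)" if "x \<in> W" for x
    by (rule has_derivative_transform_within_open[of f _ x UNIV W])
       (use Suc.prems that assms(1) frechet_derivative_works[THEN iffD1] in auto)
  have eq: "frechet_derivative g (at x) = frechet_derivative f (at x)" if "x \<in> W" for x
    using frechet_derivative_at[OF d[OF that]] by simp
  show ?case
    using d Suc.IH[of "\<lambda>x. frechet_derivative f (at x) v" "\<lambda>x. frechet_derivative g (at x) v" for v]
      Suc.prems eq by (auto simp: differentiable_def)
qed

lemma Ck_on_local:
  assumes "\<And>x. x \<in> W \<Longrightarrow> \<exists>W'. open W' \<and> x \<in> W' \<and> Ck_on k W' f"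
  shows "Ck_on k W f"
  using assms
proof (induction k arbitrary: f)
  case 0
  then show ?case
    by (metis Ck_on.simps(1) continuous_at_imp_continuous_on continuous_on_eq_continuous_at)
next
  case (Suc k)
  then show ?case by (simp, metis)
qed

lemma Ck_on_continuous_on: "Ck_on k W f \<Longrightarrow> open W \<Longrightarrow> continuous_on W f"
  by (cases k) (auto intro!: continuous_at_imp_continuous_on differentiable_imp_continuous_within)

lemma Ck_on_SucD: "Ck_on (Suc k) W f \<Longrightarrow> open W \<Longrightarrow> Ck_on k W f"
proof (induction k arbitrary: f)
  case 0
  then show ?case using Ck_on_continuous_on[of "Suc 0" W f] by simp
qed simp

lemma Ck_on_SucI:
  assumes "open W" "\<And>x. x \<in> W \<Longrightarrow> (f has_derivative D x) (at x)"
    "\<And>v. Ck_on k W (\<lambda>x. D x v)"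
  shows "Ck_on (Suc k) W f"
  unfolding Ck_on.simps
proof (intro conjI ballI allI)
  show "f differentiable at x" if "x \<in> W" for x
    using assms(2)[OF that] by (auto simp: differentiable_def)
  show "Ck_on k W (\<lambda>x. frechet_derivative f (at x) v)" for v
    by (rule Ck_on_cong[OF assms(1) _ assms(3)[of v]]) (use assms(2) frechet_derivative_at in metis)
qed

lemma Ck_on_SucE:
  assumes "Ck_on (Suc k) W f"
  obtains D where "\<And>x. x \<in> W \<Longrightarrow> (f has_derivative D x) (at x)" "\<And>v. Ck_on k W (\<lambda>x. D x v)"
  using assms that[of "\<lambda>x. frechet_derivative f (at x)"] by (auto simp: frechet_derivative_works)

lemma Ck_on_const: "open W \<Longrightarrow> Ck_on k W (\<lambda>x. c)"
proof (induction k arbitrary: c)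
  case (Suc k)
  show ?case by (rule Ck_on_SucI[where D="\<lambda>_ _. 0"]) (use Suc in auto)
qed simp

lemma Ck_on_bounded_linear: "open W \<Longrightarrow> bounded_linear f \<Longrightarrow> Ck_on k W f"
proof (cases k)
  case (Suc j)
  assume "open W" "bounded_linear f"
  then show ?thesis unfolding Suc
    by (intro Ck_on_SucI[where D="\<lambda>_. f"] Ck_on_const bounded_linear_imp_has_derivative)
qed (auto intro: linear_continuous_on)

lemma Ck_on_add:
  assumes "open W" shows "Ck_on k W f \<Longrightarrow> Ck_on k W g \<Longrightarrow> Ck_on k W (\<lambda>x. f x + g x)"
proof (induction k arbitrary: f g)
  case (Suc k)
  obtain D where D: "\<And>x. x \<in> W \<Longrightarrow> (f has_derivative D x) (at x)" "\<And>v. Ck_on k W (\<lambda>x. D x v)"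
    using Ck_on_SucE[OF Suc.prems(1)] by blast
  obtain D' where D': "\<And>x. x \<in> W \<Longrightarrow> (g has_derivative D' x) (at x)" "\<And>v. Ck_on k W (\<lambda>x. D' x v)"
    using Ck_on_SucE[OF Suc.prems(2)] by blast
  show ?case
    by (rule Ck_on_SucI[where D="\<lambda>x v. D x v + D' x v"])
      (use assms D D' Suc.IH in \<open>auto intro!: derivative_intros\<close>)
qed (auto intro: continuous_on_add)

lemma Ck_on_bilinear:
  assumes "open W" and "bounded_bilinear p"
  shows "Ck_on k W f \<Longrightarrow> Ck_on k W g \<Longrightarrow> Ck_on k W (\<lambda>x. p (f x) (g x))"
proof (induction k arbitrary: f g)
  case 0
  then show ?case using bounded_bilinear.continuous_on[OF assms(2)] by auto
next
  case (Suc k)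
  obtain D where D: "\<And>x. x \<in> W \<Longrightarrow> (f has_derivative D x) (at x)" "\<And>v. Ck_on k W (\<lambda>x. D x v)"
    using Ck_on_SucE[OF Suc.prems(1)] by blast
  obtain D' where D': "\<And>x. x \<in> W \<Longrightarrow> (g has_derivative D' x) (at x)" "\<And>v. Ck_on k W (\<lambda>x. D' x v)"
    using Ck_on_SucE[OF Suc.prems(2)] by blast
  show ?case
  proof (rule Ck_on_SucI[where D="\<lambda>x v. p (f x) (D' x v) + p (D x v) (g x)"])
    show "((\<lambda>x. p (f x) (g x)) has_derivative (\<lambda>v. p (f x) (D' x v) + p (D x v) (g x))) (at x)"
      if "x \<in> W" for x
      using bounded_bilinear.FDERIV[OF assms(2) D(1)[OF that] D'(1)[OF that]] .
    show "Ck_on k W (\<lambda>x. p (f x) (D' x v) + p (D x v) (g x))" for v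
      using Suc.prems by (intro Ck_on_add assms(1) Suc.IH D D') (auto intro: Ck_on_SucD[OF _ assms(1)])
  qed (fact assms(1))
qed

lemma Ck_on_sum:
  assumes "open W" "\<And>i. i \<in> I \<Longrightarrow> Ck_on k W (f i)"
  shows "Ck_on k W (\<lambda>x. \<Sum>i\<in>I. f i x)"
  using assms(2)
  by (induction I rule: infinite_finite_induct) (auto intro: Ck_on_const Ck_on_add assms(1))

lemma Ck_on_compose:
  assumes "open W" "open Z" "f ` W \<subseteq> Z"
  shows "Ck_on k W f \<Longrightarrow> Ck_on k Z g \<Longrightarrow> Ck_on k W (\<lambda>x. g (f x))"
proof (induction k arbitrary: g)
  case 0
  then show ?case using assms(3) by (auto intro: continuous_on_compose2)
next
  case (Suc k)
  obtain D where D: "\<And>x. x \<in> W \<Longrightarrow> (f has_derivative D x) (at x)" "\<And>v. Ck_on k W (\<lambda>x. D x v)"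
    using Ck_on_SucE[OF Suc.prems(1)] by blast
  obtain D' where D': "\<And>x. x \<in> Z \<Longrightarrow> (g has_derivative D' x) (at x)" "\<And>v. Ck_on k Z (\<lambda>x. D' x v)"
    using Ck_on_SucE[OF Suc.prems(2)] by blast
  show ?case
  \<comment> \<open>The chain rule gives \<open>D' (f x) (D x v)\<close>, whose direction moves with
    \<open>x\<close>. Expanding this direction in the basis leaves \<open>D' (f x) i\<close> with
    fixed \<open>i\<close>, to which the induction hypothesis applies.\<close>
  proof (rule Ck_on_SucI[where D="\<lambda>x v. \<Sum>i\<in>Basis. (D x v \<bullet> i) *\<^sub>R D' (f x) i"])
    show "((\<lambda>x. g (f x)) has_derivative (\<lambda>v. \<Sum>i\<in>Basis. (D x v \<bullet> i) *\<^sub>R D' (f x) i)) (at x)"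
      if "x \<in> W" for x
    proof -
      have fx: "f x \<in> Z" using that assms(3) by auto
      have lin: "linear (D' (f x))" using D'(1)[OF fx] has_derivative_linear by blast
      have "D' (f x) (D x v) = (\<Sum>i\<in>Basis. (D x v \<bullet> i) *\<^sub>R D' (f x) i)" for v
        by (subst euclidean_representation[of "D x v", symmetric])
          (simp add: linear_sum[OF lin] linear_scale[OF lin])
      then show ?thesis
        using has_derivative_compose[OF D(1)[OF that] D'(1)[OF fx]] by simp
    qed
    have fk: "Ck_on k W f" using Suc.prems(1) assms(1) by (rule Ck_on_SucD)
    show "Ck_on k W (\<lambda>x. \<Sum>i\<in>Basis. (D x v \<bullet> i) *\<^sub>R D' (f x) i)" for v
      by (intro Ck_on_sum assms(1) Ck_on_bilinear[OF _ bounded_bilinear_scaleR]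
          Ck_on_bilinear[OF _ bounded_bilinear_inner] D Ck_on_const Suc.IH fk D')
  qed (fact assms(1))
qed

lemma Ck_on_Pair:
  assumes "open W" "Ck_on k W f" "Ck_on k W g" shows "Ck_on k W (\<lambda>x. (f x, g x))"
proof -
  have 1: "bounded_linear (\<lambda>x::'b. (x, 0::'c))" and 2: "bounded_linear (\<lambda>x::'c. (0::'b, x))"
    by (auto intro!: bounded_linear_intros)
  have "Ck_on k W (\<lambda>x. (f x, 0) + (0, g x))"
    by (intro Ck_on_add assms(1) Ck_on_compose[OF assms(1) open_UNIV _ assms(2) Ck_on_bounded_linear[OF _ 1]]
        Ck_on_compose[OF assms(1) open_UNIV _ assms(3) Ck_on_bounded_linear[OF _ 2]]) auto
  then show ?thesis by simp
qed

lemma Ck_on_real_SucI: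
  fixes f :: "real \<Rightarrow> real"
  assumes "open W" "\<And>x. x \<in> W \<Longrightarrow> (f has_real_derivative f' x) (at x)" "Ck_on k W f'"
  shows "Ck_on (Suc k) W f"
  by (rule Ck_on_SucI[where D="\<lambda>x v. f' x * v"])
    (use assms in \<open>auto simp: has_field_derivative_def intro!: Ck_on_bilinear[OF _ bounded_bilinear_mult] Ck_on_const\<close>)

text \<open>Openness of the domain is built in, since iterated derivatives are meaningful on open
  sets only; the rules for sums, products and compositions then need few side conditions.\<close>

definition Cinf :: "'a::euclidean_space set \<Rightarrow> ('a \<Rightarrow> 'b::euclidean_space) \<Rightarrow> bool" where
  "Cinf W f \<longleftrightarrow> open W \<and> (\<forall>k. Ck_on k W f)"

lemma Cinf_open: "Cinf W f \<Longrightarrow> open W" by (simp add: Cinf_def)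

lemma Cinf_subset: "Cinf W f \<Longrightarrow> open W' \<Longrightarrow> W' \<subseteq> W \<Longrightarrow> Cinf W' f"
  by (auto simp: Cinf_def intro: Ck_on_mono)

lemma Cinf_cong: "Cinf W f \<Longrightarrow> (\<And>x. x \<in> W \<Longrightarrow> f x = g x) \<Longrightarrow> Cinf W g"
  by (auto simp: Cinf_def intro: Ck_on_cong)

lemma Cinf_local:
  assumes "\<And>x. x \<in> W \<Longrightarrow> \<exists>W'. x \<in> W' \<and> Cinf W' f" "open W"
  shows "Cinf W f"
  using assms unfolding Cinf_def by (metis Ck_on_local)

lemma Cinf_continuous_on: "Cinf W f \<Longrightarrow> continuous_on W f"
  unfolding Cinf_def using Ck_on_continuous_on by blast

lemma Cinf_isCont: "Cinf W f \<Longrightarrow> x \<in> W \<Longrightarrow> isCont f x"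
  using Cinf_continuous_on Cinf_open continuous_on_eq_continuous_at by blast

lemma Cinf_has_derivative:
  "Cinf W f \<Longrightarrow> x \<in> W \<Longrightarrow> (f has_derivative frechet_derivative f (at x)) (at x)"
  unfolding Cinf_def using frechet_derivative_works by (metis Ck_on.simps(2))

lemma Cinf_frechet: "Cinf W f \<Longrightarrow> Cinf W (\<lambda>x. frechet_derivative f (at x) v)"
  unfolding Cinf_def by (metis Ck_on.simps(2))

lemma Cinf_compose:
  assumes "Cinf W f" "Cinf Z g" "f ` W \<subseteq> Z" shows "Cinf W (\<lambda>x. g (f x))"
  using assms Ck_on_compose[of W Z f _ g] by (simp add: Cinf_def)

lemma Cinf_compose_UNIV: "Cinf UNIV g \<Longrightarrow> Cinf W f \<Longrightarrow> Cinf W (\<lambda>x. g (f x))"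
  using Cinf_compose[of W f UNIV g] by simp

lemma Cinf_const: "open W \<Longrightarrow> Cinf W (\<lambda>x. c)"
  by (auto simp: Cinf_def Ck_on_const)

lemma Cinf_bounded_linear: "bounded_linear l \<Longrightarrow> Cinf W f \<Longrightarrow> Cinf W (\<lambda>x. l (f x))"
  by (rule Cinf_compose_UNIV) (simp_all add: Cinf_def Ck_on_bounded_linear)

lemma Cinf_linear: "linear l \<Longrightarrow> Cinf W f \<Longrightarrow> Cinf W (\<lambda>x. l (f x))"
  by (simp add: Cinf_bounded_linear linear_conv_bounded_linear)

lemma Cinf_ident: "open W \<Longrightarrow> Cinf W (\<lambda>x. x)"
  by (simp add: Cinf_def Ck_on_bounded_linear bounded_linear_ident)

lemma Cinf_add: "Cinf W f \<Longrightarrow> Cinf W g \<Longrightarrow> Cinf W (\<lambda>x. f x + g x)"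
  by (simp add: Cinf_def Ck_on_add)

lemma Cinf_bilinear: "bounded_bilinear p \<Longrightarrow> Cinf W f \<Longrightarrow> Cinf W g \<Longrightarrow> Cinf W (\<lambda>x. p (f x) (g x))"
  by (simp add: Cinf_def Ck_on_bilinear)

lemma Cinf_sum: "(\<And>i. i \<in> I \<Longrightarrow> Cinf W (f i)) \<Longrightarrow> open W \<Longrightarrow> Cinf W (\<lambda>x. \<Sum>i\<in>I. f i x)"
  by (simp add: Cinf_def Ck_on_sum)

lemma Cinf_Pair: "Cinf W f \<Longrightarrow> Cinf W g \<Longrightarrow> Cinf W (\<lambda>x. (f x, g x))"
  by (simp add: Cinf_def Ck_on_Pair)

lemmas Cinf_fst = Cinf_bounded_linear[OF bounded_linear_fst]
lemmas Cinf_snd = Cinf_bounded_linear[OF bounded_linear_snd]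
lemmas Cinf_minus = Cinf_bounded_linear[OF bounded_linear_minus[OF bounded_linear_ident]]
lemmas Cinf_scaleR = Cinf_bilinear[OF bounded_bilinear_scaleR]
lemmas Cinf_mult = Cinf_bilinear[OF bounded_bilinear_mult]
lemmas Cinf_inner = Cinf_bilinear[OF bounded_bilinear_inner]

lemma Cinf_diff: "Cinf W f \<Longrightarrow> Cinf W g \<Longrightarrow> Cinf W (\<lambda>x. f x - g x)"
  using Cinf_add[of W f "\<lambda>x. - g x"] Cinf_minus[of W g] by simp

text \<open>The derivative is a polynomial in \<open>inverse\<close> itself, so smoothness of order
  \<open>k\<close> yields order \<open>k + 1\<close>. The square root below follows the same
  pattern, its derivative being half the inverse of the root.\<close>

lemma Cinf_inverse:
  assumes "Cinf W f" "\<And>x. x \<in> W \<Longrightarrow> f x \<noteq> 0" shows "Cinf W (\<lambda>x. inverse (f x :: real))"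
proof (rule Cinf_compose[OF assms(1)])
  have "Ck_on k (-{0}) (inverse :: real \<Rightarrow> real)" for k
  proof (induction k)
    case (Suc k)
    have o: "open (-{0::real})" by (simp add: open_Compl)
    show ?case
    proof (rule Ck_on_real_SucI[where f'="\<lambda>x. (inverse x * inverse x) * (- 1)"])
      show "Ck_on k (-{0}) (\<lambda>x. inverse x * inverse x * - (1::real))"
        by (intro Ck_on_bilinear[OF o bounded_bilinear_mult] Ck_on_const o Suc.IH)
    qed (auto intro!: derivative_eq_intros o)
  qed (auto intro: continuous_intros)
  then show "Cinf (-{0}) (inverse :: real \<Rightarrow> real)" by (auto simp: Cinf_def)
  show "f ` W \<subseteq> - {0}" using assms(2) by auto
qed

lemma Cinf_divide:
  assumes "Cinf W f" "Cinf W g" "\<And>x. x \<in> W \<Longrightarrow> g x \<noteq> 0" shows "Cinf W (\<lambda>x. f x / g x :: real)"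
  using Cinf_mult[OF assms(1) Cinf_inverse[OF assms(2,3)]] by (simp add: divide_inverse)

lemma Cinf_sqrt:
  assumes "Cinf W f" "\<And>x. x \<in> W \<Longrightarrow> f x > 0" shows "Cinf W (\<lambda>x. sqrt (f x))"
proof (rule Cinf_compose[OF assms(1)])
  have o: "open ({0::real<..})" by simp
  have "Ck_on k {0<..} sqrt" for k
  proof (induction k)
    case (Suc k)
    show ?case
    proof (rule Ck_on_real_SucI[where f'="\<lambda>x. inverse (sqrt x) * (1/2)"])
      have "Ck_on k {0<..} (\<lambda>x. inverse (sqrt x))"
        by (rule Ck_on_compose[of "{0<..}" "-{0}" sqrt k inverse])
          (use Cinf_inverse[OF Cinf_ident, of "-{0}"] Suc.IH in \<open>auto simp: open_Compl Cinf_def\<close>)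
      then show "Ck_on k {0<..} (\<lambda>x. inverse (sqrt x) * (1/2))"
        by (intro Ck_on_bilinear[OF o bounded_bilinear_mult] Ck_on_const o)
    qed (auto intro!: derivative_eq_intros o)
  qed (auto intro: continuous_intros)
  then show "Cinf {0<..} sqrt" by (auto simp: Cinf_def)
  show "f ` W \<subseteq> {0<..}" using assms(2) by auto
qed

lemma Cinf_sin_cos_UNIV: "Cinf UNIV (sin :: real \<Rightarrow> real)" "Cinf UNIV (cos :: real \<Rightarrow> real)"
proof -
  have "Ck_on k UNIV (sin :: real \<Rightarrow> real) \<and> Ck_on k UNIV (cos :: real \<Rightarrow> real)" for k
  proof (induction k)
    case (Suc k)
    have "Ck_on (Suc k) UNIV (sin :: real \<Rightarrow> real)"
      by (rule Ck_on_real_SucI[where f'=cos]) (use Suc in \<open>auto intro!: derivative_eq_intros\<close>)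
    moreover have "Ck_on k UNIV (\<lambda>x::real. sin x * (-1))"
      by (intro Ck_on_bilinear[OF _ bounded_bilinear_mult] Ck_on_const) (use Suc in auto)
    then have "Ck_on (Suc k) UNIV (cos :: real \<Rightarrow> real)"
      by (intro Ck_on_real_SucI[where f'="\<lambda>x. sin x * (-1)"]) (auto intro!: derivative_eq_intros)
    ultimately show ?case ..
  qed (auto intro: continuous_intros)
  then show "Cinf UNIV (sin :: real \<Rightarrow> real)" "Cinf UNIV (cos :: real \<Rightarrow> real)"
    by (auto simp: Cinf_def)
qed

lemma Cinf_cis:
  assumes "Cinf W f" shows "Cinf W (\<lambda>x. cis (f x))"
proof -
  have "cis = (\<lambda>x. cos x *\<^sub>R 1 + sin x *\<^sub>R \<i>)"
    by (auto simp: complex_eq_iff)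
  moreover have "Cinf UNIV (\<lambda>x. cos x *\<^sub>R 1 + sin x *\<^sub>R \<i>)"
    by (intro Cinf_add Cinf_scaleR Cinf_sin_cos_UNIV Cinf_const open_UNIV)
  ultimately show ?thesis using Cinf_compose_UNIV[OF _ assms, of cis] by simp
qed

lemma Cinf_arctan:
  assumes "Cinf W f" shows "Cinf W (\<lambda>x. arctan (f x))"
proof (rule Cinf_compose_UNIV[OF _ assms])
  have "Cinf UNIV (\<lambda>x::real. inverse (1 + x * x))"
    by (intro Cinf_inverse Cinf_add Cinf_mult Cinf_const Cinf_ident)
      (auto simp: add_nonneg_eq_0_iff)
  then have "Ck_on (Suc k) UNIV arctan" for k
    by (intro Ck_on_real_SucI[where f'="\<lambda>x. inverse (1 + x * x)"])
      (auto simp: Cinf_def power2_eq_square intro!: derivative_eq_intros)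
  then show "Cinf UNIV arctan" by (auto simp: Cinf_def intro: Ck_on_SucD)
qed

lemma Cinf_norm:
  assumes "Cinf W f" "\<And>x. x \<in> W \<Longrightarrow> f x \<noteq> 0" shows "Cinf W (\<lambda>x. norm (f x))"
  unfolding norm_eq_sqrt_inner using assms(2) by (intro Cinf_sqrt Cinf_inner assms(1)) simp

lemma Cinf_sgn:
  assumes "Cinf W f" "\<And>x. x \<in> W \<Longrightarrow> f x \<noteq> 0" shows "Cinf W (\<lambda>x. sgn (f x))"
  unfolding sgn_div_norm using assms(2)
  by (intro Cinf_scaleR Cinf_inverse Cinf_norm assms(1)) simp_all

section \<open>Flat functions, smooth steps and bumps\<close>

text \<open>For \<open>m = 0\<close> this is the classical function \<open>exp (- 1 / x)\<close>,
  extended by zero. The powers of \<open>inverse x\<close> make the family closed under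
  differentiation up to linear combinations, so that smoothness can be proved for all
  \<open>m\<close> in one induction.\<close>

definition flat :: "nat \<Rightarrow> real \<Rightarrow> real" where
  "flat m x = (if x \<le> 0 then 0 else inverse x ^ m * exp (- inverse x))"

lemma flat_tendsto_0: "(flat m \<longlongrightarrow> 0) (at 0)"
proof -
  have "((\<lambda>x. inverse x ^ m / exp (inverse x)) \<longlongrightarrow> (0::real)) (at_right 0)"
    by (rule filterlim_compose[OF tendsto_power_div_exp_0 filterlim_inverse_at_top_right])
  then have "(flat m \<longlongrightarrow> 0) (at_right 0)"
    by (rule Lim_transform_within[where d=1]) (auto simp: flat_def exp_minus divide_inverse)
  moreover have "((\<lambda>_. 0) \<longlongrightarrow> (0::real)) (at_left 0)" by simp
  then have "(flat m \<longlongrightarrow> 0) (at_left 0)"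
    by (rule Lim_transform_within[where d=1]) (auto simp: flat_def)
  ultimately show ?thesis by (simp add: filterlim_split_at)
qed

lemma flat_deriv: "(flat m has_real_derivative flat (m + 2) x - real m * flat (m + 1) x) (at x)"
proof (cases x "0::real" rule: linorder_cases)
  case less
  have "((\<lambda>_. 0) has_real_derivative 0) (at x)" by simp
  then have "(flat m has_real_derivative 0) (at x)"
    by (rule DERIV_cong_ev[THEN iffD1, rotated 3])
      (use less eventually_nhds_in_open[of "{..<0}" x] in \<open>auto elim!: eventually_mono simp: flat_def\<close>)
  then show ?thesis using less by (simp add: flat_def)
next
  case equal
  have "((\<lambda>h. flat (m + 1) h) \<longlongrightarrow> 0) (at 0)" by (rule flat_tendsto_0)
  \<comment> \<open>For positive \<open>h\<close> the difference quotient at \<open>0\<close> is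
    exactly \<open>flat (m + 1) h\<close>, and for negative \<open>h\<close> both are zero.\<close>
  then have "((\<lambda>h. (flat m (0 + h) - flat m 0) / h) \<longlongrightarrow> 0) (at 0)"
    by (rule Lim_transform_within[where d=1]) (auto simp: flat_def divide_inverse)
  then show ?thesis using equal by (simp add: DERIV_def flat_def)
next
  case greater
  have D: "(inverse has_real_derivative - (inverse x * inverse x)) (at x)"
    using DERIV_inverse[of x UNIV] greater by simp
  have "((\<lambda>x. inverse x ^ m) has_real_derivative - (real m * inverse x ^ (m + 1))) (at x)"
    using DERIV_power[OF D, of m] by (cases m) (simp_all add: algebra_simps)
  moreover have "((\<lambda>x. exp (- inverse x)) has_real_derivative exp (- inverse x) * (inverse x * inverse x)) (at x)"
    using DERIV_fun_exp[OF DERIV_minus[OF D]] by simp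
  ultimately have "((\<lambda>x. inverse x ^ m * exp (- inverse x)) has_real_derivative
      - (real m * inverse x ^ (m + 1)) * exp (- inverse x)
      + exp (- inverse x) * (inverse x * inverse x) * inverse x ^ m) (at x)"
    by (rule DERIV_mult)
  then have "((\<lambda>x. inverse x ^ m * exp (- inverse x)) has_real_derivative
      flat (m + 2) x - real m * flat (m + 1) x) (at x)"
    using greater by (simp add: flat_def algebra_simps)
  then show ?thesis
    by (rule DERIV_cong_ev[THEN iffD1, rotated 3])
      (use greater eventually_nhds_in_open[of "{0<..}" x] in \<open>auto elim!: eventually_mono simp: flat_def\<close>)
qed

lemma Cinf_flat: "Cinf UNIV (flat m)"
proof -
  have "Ck_on k UNIV (flat m)" for k
  proof (induction k arbitrary: m)
    case 0
    show ?case using DERIV_isCont[OF flat_deriv] by (auto intro: continuous_at_imp_continuous_on)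
  next
    case (Suc k)
    have "Ck_on k UNIV (\<lambda>x. flat (m + 2) x + (- real m) * flat (m + 1) x)"
      by (intro Ck_on_add Ck_on_bilinear[OF _ bounded_bilinear_mult] Ck_on_const Suc.IH open_UNIV)
    then have "Ck_on k UNIV (\<lambda>x. flat (m + 2) x - real m * flat (m + 1) x)" by simp
    then show ?case by (intro Ck_on_real_SucI[OF open_UNIV flat_deriv])
  qed
  then show ?thesis by (simp add: Cinf_def)
qed

definition smooth_step :: "real \<Rightarrow> real" where
  "smooth_step x = flat 0 x / (flat 0 x + flat 0 (1 - x))"

lemma flat_0_sum_pos: "flat 0 x + flat 0 (1 - x) > 0"
  by (auto simp: flat_def add_pos_pos)

lemma Cinf_smooth_step: "Cinf W f \<Longrightarrow> Cinf W (\<lambda>x. smooth_step (f x))"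
proof (rule Cinf_compose_UNIV[of smooth_step])
  have "Cinf UNIV (\<lambda>x. flat 0 (1 - x))"
    by (intro Cinf_compose_UNIV[OF Cinf_flat] Cinf_diff Cinf_const Cinf_ident open_UNIV)
  then show "Cinf UNIV smooth_step"
    unfolding smooth_step_def[abs_def]
    by (intro Cinf_divide Cinf_add Cinf_flat) (simp_all add: flat_0_sum_pos[THEN less_imp_neq, symmetric])
qed

lemma smooth_step_eq_0: "x \<le> 0 \<Longrightarrow> smooth_step x = 0"
  and smooth_step_eq_1: "1 \<le> x \<Longrightarrow> smooth_step x = 1"
  and smooth_step_nonneg: "0 \<le> smooth_step x"
  and smooth_step_le_1: "smooth_step x \<le> 1"
  using flat_0_sum_pos[of x]
  by (auto simp: smooth_step_def divide_simps) (auto simp: flat_def)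

text \<open>The squared distance keeps the function smooth at \<open>p\<close>. The value is
  \<open>1\<close> up to distance \<open>r\<close> and \<open>0\<close> from
  \<open>sqrt 2 * r\<close> on; the support is rounded up to \<open>2 * r\<close> in what
  follows.\<close>

definition bump :: "'a::euclidean_space \<Rightarrow> real \<Rightarrow> 'a \<Rightarrow> real" where
  "bump p r x = smooth_step (2 - (x - p) \<bullet> (x - p) / r\<^sup>2)"

lemma Cinf_bump: "Cinf UNIV (bump p r)"
  unfolding bump_def[abs_def] divide_inverse
  by (intro Cinf_smooth_step Cinf_diff Cinf_mult Cinf_inner Cinf_const Cinf_ident open_UNIV)

lemma bump_nonneg: "0 \<le> bump p r x" by (simp add: bump_def smooth_step_nonneg)

lemma bump_eq_1: "0 < r \<Longrightarrow> dist p x \<le> r \<Longrightarrow> bump p r x = 1"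
  unfolding bump_def dot_square_norm
  by (rule smooth_step_eq_1) (auto simp: dist_norm norm_minus_commute power_mono)

lemma bump_eq_0:
  assumes "0 < r" "2 * r \<le> dist p x" shows "bump p r x = 0"
  unfolding bump_def dot_square_norm
proof (rule smooth_step_eq_0)
  have "(2 * r)\<^sup>2 \<le> (norm (x - p))\<^sup>2"
    using assms by (intro power_mono) (auto simp: dist_norm norm_minus_commute)
  then have "2 * r\<^sup>2 \<le> (norm (x - p))\<^sup>2" using zero_le_power2[of r]
    by (simp only: power2_eq_square)
  then show "2 - (norm (x - p))\<^sup>2 / r\<^sup>2 \<le> 0" using assms(1) by (simp add: field_simps)
qed

text \<open>The values of \<open>f\<close> outside \<open>W\<close> are arbitrary, hence the
  \<open>if\<close>. Two open sets cover the space: \<open>W\<close>, and the complement of the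
  closed ball, on which the product is zero.\<close>

lemma Cinf_cutoff:
  assumes "Cinf W f" "0 < r" "cball p (2 * r) \<subseteq> W"
  shows "Cinf UNIV (\<lambda>x. if x \<in> W then bump p r x *\<^sub>R f x else 0)" (is "Cinf UNIV ?g")
proof (rule Cinf_local)
  fix x :: 'a
  show "\<exists>W'. x \<in> W' \<and> Cinf W' ?g"
  proof (cases "x \<in> W")
    case True
    have "Cinf W (\<lambda>x. bump p r x *\<^sub>R f x)"
      using Cinf_scaleR[OF Cinf_subset[OF Cinf_bump Cinf_open[OF assms(1)]] assms(1)] by auto
    then have "Cinf W ?g" by (rule Cinf_cong) auto
    then show ?thesis using True by blast
  next
    case False
    have "Cinf (- cball p (2 * r)) ?g"
      by (rule Cinf_cong[OF Cinf_const[of _ 0]]) (use assms(2) in \<open>auto simp: bump_eq_0 open_Compl\<close>)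
    then show ?thesis using False assms(3) by blast
  qed
qed simp

section \<open>Smooth maps on arbitrary subsets\<close>

lemma smooth_on_iff:
  "smooth_on A f \<longleftrightarrow> (\<forall>x\<in>A. \<exists>W F. x \<in> W \<and> Cinf W F \<and> (\<forall>y\<in>A \<inter> W. F y = f y))"
  unfolding smooth_on_def Cinf_def by blast

lemma smooth_on_Cinf: "Cinf W f \<Longrightarrow> A \<subseteq> W \<Longrightarrow> smooth_on A f"
  unfolding smooth_on_iff by blast

lemma smooth_on_subset: "smooth_on A f \<Longrightarrow> B \<subseteq> A \<Longrightarrow> smooth_on B f"
  unfolding smooth_on_iff by (meson IntD1 IntD2 IntI subsetD)

lemma smooth_on_cong: "smooth_on A f \<Longrightarrow> (\<And>x. x \<in> A \<Longrightarrow> f x = g x) \<Longrightarrow> smooth_on A g"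
  unfolding smooth_on_iff by (metis IntD1)

lemma smooth_on_local:
  assumes "\<And>x. x \<in> A \<Longrightarrow> \<exists>U. open U \<and> x \<in> U \<and> smooth_on (A \<inter> U) f"
  shows "smooth_on A f"
  unfolding smooth_on_iff
proof
  fix x assume x: "x \<in> A"
  obtain U where U: "open U" "x \<in> U" "smooth_on (A \<inter> U) f" using assms x by blast
  then obtain W F where W: "x \<in> W" "Cinf W F" "\<forall>y\<in>A \<inter> U \<inter> W. F y = f y"
    using x unfolding smooth_on_iff by (metis IntI)
  have "Cinf (W \<inter> U) F" using W(2) U(1) by (auto intro: Cinf_subset Cinf_open)
  then show "\<exists>W F. x \<in> W \<and> Cinf W F \<and> (\<forall>y\<in>A \<inter> W. F y = f y)"
    using U W by (intro exI[of _ "W \<inter> U"] exI[of _ F]) auto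
qed

lemma smooth_on_continuous_on: "smooth_on A f \<Longrightarrow> continuous_on A f"
proof -
  assume A: "smooth_on A f"
  have "continuous (at x within A) f" if "x \<in> A" for x
  proof -
    obtain W F where W: "x \<in> W" "Cinf W F" "\<forall>y\<in>A \<inter> W. F y = f y"
      using A \<open>x \<in> A\<close> unfolding smooth_on_iff by metis
    have "continuous (at x within A) F"
      using Cinf_isCont[OF W(2,1)] by (rule continuous_at_imp_continuous_at_within)
    moreover obtain d where "d > 0" "ball x d \<subseteq> W"
      using W Cinf_open openE by metis
    ultimately show ?thesis
      using W(3) that by (intro continuous_transform_within[of x A F d f]) (auto simp: dist_commute subset_iff)
  qed
  then show ?thesis by (simp add: continuous_on_eq_continuous_within)
qed

lemma smooth_on_compose:
  assumes "smooth_on A f" "smooth_on B g" "f ` A \<subseteq> B"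
  shows "smooth_on A (\<lambda>x. g (f x))"
  unfolding smooth_on_iff
proof
  fix x assume x: "x \<in> A"
  obtain W F where W: "x \<in> W" "Cinf W F" "\<forall>y\<in>A \<inter> W. F y = f y"
    using assms(1) x unfolding smooth_on_iff by metis
  have fx: "f x \<in> B" "F x = f x" using assms(3) x W by auto
  obtain Z G where Z: "f x \<in> Z" "Cinf Z G" "\<forall>y\<in>B \<inter> Z. G y = g y"
    using assms(2) fx unfolding smooth_on_iff by metis
  define W' where "W' = W \<inter> F -` Z"
  have "open W'" unfolding W'_def
    using continuous_open_preimage[OF Cinf_continuous_on[OF W(2)] Cinf_open[OF W(2)] Cinf_open[OF Z(2)]] .
  then have "Cinf W' F" using W(2) by (auto simp: W'_def intro: Cinf_subset)
  then have "Cinf W' (\<lambda>x. G (F x))" by (rule Cinf_compose[OF _ Z(2)]) (auto simp: W'_def)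
  moreover have "\<forall>y\<in>A \<inter> W'. G (F y) = g (f y)" using W Z assms(3) by (auto simp: W'_def)
  moreover have "x \<in> W'" using W Z fx by (auto simp: W'_def)
  ultimately show "\<exists>W F. x \<in> W \<and> Cinf W F \<and> (\<forall>y\<in>A \<inter> W. F y = g (f y))" by blast
qed

lemma smooth_on_Pair:
  assumes "smooth_on A f" "smooth_on A g" shows "smooth_on A (\<lambda>x. (f x, g x))"
  unfolding smooth_on_iff
proof
  fix x assume x: "x \<in> A"
  obtain W F where W: "x \<in> W" "Cinf W F" "\<forall>y\<in>A \<inter> W. F y = f y"
    using assms(1) x unfolding smooth_on_iff by metis
  obtain Z G where Z: "x \<in> Z" "Cinf Z G" "\<forall>y\<in>A \<inter> Z. G y = g y"
    using assms(2) x unfolding smooth_on_iff by metis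
  have "Cinf (W \<inter> Z) (\<lambda>x. (F x, G x))"
    by (intro Cinf_Pair Cinf_subset[OF W(2)] Cinf_subset[OF Z(2)] open_Int Cinf_open[OF W(2)] Cinf_open[OF Z(2)]) auto
  then show "\<exists>W F. x \<in> W \<and> Cinf W F \<and> (\<forall>y\<in>A \<inter> W. F y = (f y, g y))"
    using W Z by (intro exI[of _ "W \<inter> Z"] exI[of _ "\<lambda>x. (F x, G x)"]) auto
qed

lemma smooth_on_Cinf_compose: "Cinf UNIV g \<Longrightarrow> smooth_on A f \<Longrightarrow> smooth_on A (\<lambda>x. g (f x))"
  using smooth_on_compose[of A f UNIV g] smooth_on_Cinf[of UNIV g UNIV] by simp

lemma smooth_on_fst: "smooth_on A f \<Longrightarrow> smooth_on A (\<lambda>x. fst (f x))"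
  and smooth_on_snd: "smooth_on A f \<Longrightarrow> smooth_on A (\<lambda>x. snd (f x))"
  by (auto intro!: smooth_on_Cinf_compose[of fst] smooth_on_Cinf_compose[of snd] Cinf_fst Cinf_snd Cinf_ident)

lemma smooth_on_id: "smooth_on A (\<lambda>x. x)"
  by (rule smooth_on_Cinf[OF Cinf_ident[OF open_UNIV]]) simp

lemma smooth_on_const: "smooth_on A (\<lambda>x. c)"
  by (rule smooth_on_Cinf[OF Cinf_const[OF open_UNIV]]) simp

text \<open>A partition of unity for a finite cover of \<open>A\<close> by balls. On
  \<open>A\<close> the local extensions agree with \<open>f\<close>, so their weighted sum is the
  total weight \<open>S\<close> times \<open>f\<close>, and \<open>S\<close> is at least
  \<open>1\<close> there.\<close>

lemma smooth_on_extend: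
  fixes f :: "'a::euclidean_space \<Rightarrow> 'b::euclidean_space"
  assumes "compact A" "smooth_on A f"
  obtains F where "Cinf UNIV F" "\<And>x. x \<in> A \<Longrightarrow> F x = f x"
proof -
  have "\<forall>x\<in>A. \<exists>W F r. Cinf W F \<and> (\<forall>y\<in>A \<inter> W. F y = f y) \<and> r > 0 \<and> cball x (2 * r) \<subseteq> W"
  proof
    fix x assume "x \<in> A"
    then obtain W F where W: "x \<in> W" "Cinf W F" "\<forall>y\<in>A \<inter> W. F y = f y"
      using assms(2) unfolding smooth_on_iff by metis
    obtain e where "e > 0" "cball x e \<subseteq> W" using W open_contains_cball Cinf_open by metis
    then have "e / 2 > 0 \<and> cball x (2 * (e / 2)) \<subseteq> W" by simp
    then show "\<exists>W F r. Cinf W F \<and> (\<forall>y\<in>A \<inter> W. F y = f y) \<and> r > 0 \<and> cball x (2 * r) \<subseteq> W"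
      using W by blast
  qed
  then obtain W F r where WF: "\<And>x. x \<in> A \<Longrightarrow> Cinf (W x) (F x)"
      "\<And>x y. x \<in> A \<Longrightarrow> y \<in> A \<Longrightarrow> y \<in> W x \<Longrightarrow> F x y = f y"
      "\<And>x. x \<in> A \<Longrightarrow> r x > 0" "\<And>x. x \<in> A \<Longrightarrow> cball x (2 * r x) \<subseteq> W x"
    by (metis IntI)
  obtain C where C: "C \<subseteq> A" "finite C" "A \<subseteq> (\<Union>x\<in>C. ball x (r x))"
    using compactE_image[OF assms(1), of A "\<lambda>x. ball x (r x)"] WF(3) by (metis (mono_tags, lifting) UN_I centre_in_ball open_ball subsetI)
  define G where "G x y = (if y \<in> W x then bump x (r x) y *\<^sub>R F x y else 0)" for x y
  define S where "S y = (\<Sum>x\<in>C. bump x (r x) y)" for y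
  \<comment> \<open>A smooth substitute for \<open>1 / s\<close>: it equals \<open>1 / s\<close> for
    \<open>s \<ge> 1\<close> and is zero for \<open>s \<le> 1 / 2\<close>, so division by the total
    weight makes sense also where no bump lives.\<close>
  define T where "T s = smooth_step (2 * s - 1) * inverse s" for s :: real
  have "Cinf UNIV T"
  proof (rule Cinf_local)
    fix s :: real
    show "\<exists>W'. s \<in> W' \<and> Cinf W' T"
    proof (cases "s > 0")
      case True
      have "Cinf {0<..} T" unfolding T_def
        by (intro Cinf_mult Cinf_smooth_step Cinf_diff Cinf_inverse Cinf_ident Cinf_const) auto
      then show ?thesis using True by blast
    next
      case False
      have "Cinf {..<1/2} T"
        by (rule Cinf_cong[OF Cinf_const[of _ 0]]) (auto simp: T_def smooth_step_eq_0)
      then show ?thesis using False by (intro exI[of _ "{..<1/2}"]) auto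
    qed
  qed simp
  moreover have "Cinf UNIV S" unfolding S_def[abs_def] by (intro Cinf_sum Cinf_bump open_UNIV)
  ultimately have TS: "Cinf UNIV (\<lambda>y. T (S y))" by (rule Cinf_compose_UNIV)
  have "Cinf UNIV (G x)" if "x \<in> C" for x
    unfolding G_def[abs_def] by (intro Cinf_cutoff WF) (use that C in auto)
  then have "Cinf UNIV (\<lambda>y. T (S y) *\<^sub>R (\<Sum>x\<in>C. G x y))"
    by (intro Cinf_scaleR TS Cinf_sum open_UNIV)
  moreover have "T (S y) *\<^sub>R (\<Sum>x\<in>C. G x y) = f y" if y: "y \<in> A" for y
  proof -
    have "G x y = bump x (r x) y *\<^sub>R f y" if "x \<in> C" for x
    proof (cases "y \<in> W x")
      case True
      then show ?thesis using WF(2)[of x y] y that C(1) by (auto simp: G_def)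
    next
      case False
      have "x \<in> A" using that C(1) by blast
      then have "y \<notin> cball x (2 * r x)" using False WF(4) by blast
      then have "bump x (r x) y = 0"
        using WF(3)[OF \<open>x \<in> A\<close>] by (intro bump_eq_0) auto
      then show ?thesis by (simp add: G_def)
    qed
    then have eq: "(\<Sum>x\<in>C. G x y) = S y *\<^sub>R f y" by (simp add: S_def scaleR_sum_left)
    obtain x where x: "x \<in> C" "y \<in> ball x (r x)" using C(3) y by blast
    then have "bump x (r x) y = 1" using WF(3) C(1) by (intro bump_eq_1) auto
    moreover have "bump x (r x) y \<le> S y"
      unfolding S_def by (rule member_le_sum) (use x C bump_nonneg in auto)
    ultimately have "T (S y) * S y = 1" by (simp add: T_def smooth_step_eq_1)
    then show ?thesis by (simp add: eq)
  qed
  ultimately show thesis by (rule that)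
qed

section \<open>Tangent spaces\<close>

text \<open>The space of vectors along which derivatives within \<open>A\<close> are unique. For a manifold \<open>A\<close> it is
  the tangent space, also at boundary points.\<close>

definition tang :: "'a::euclidean_space set \<Rightarrow> 'a \<Rightarrow> 'a set" where
  "tang A p = {v. \<forall>D. ((\<lambda>_. 0::real) has_derivative D) (at p within A) \<longrightarrow> D v = 0}"

lemma at_within_Int_open:
  "open U \<Longrightarrow> p \<in> U \<Longrightarrow> at p within (A \<inter> U) = at p within A"
  by (rule at_within_nhd[of p U]) auto

lemma tang_Int_open: "open U \<Longrightarrow> p \<in> U \<Longrightarrow> tang (A \<inter> U) p = tang A p"
  by (simp add: tang_def at_within_Int_open)

lemma subspace_tang: "subspace (tang A p)"
proof -
  have "D 0 = 0" "D x = 0 \<Longrightarrow> D y = 0 \<Longrightarrow> D (x + y) = 0" "D x = 0 \<Longrightarrow> D (c *\<^sub>R x) = 0"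
    if "((\<lambda>_. 0::real) has_derivative D) (at p within A)" for D x y c
    using has_derivative_linear[OF that] by (simp_all add: linear_0 linear_add linear_scale)
  then show ?thesis unfolding subspace_def tang_def by blast
qed

text \<open>Each component of \<open>f - g\<close> is zero on \<open>A\<close> near
  \<open>p\<close>, so the definition of \<open>tang\<close> applies to the difference of the
  derivatives. Equations between derivatives along a manifold are obtained in this way
  throughout.\<close>

lemma tang_unique:
  fixes f g :: "'a::euclidean_space \<Rightarrow> 'b::euclidean_space"
  assumes f: "(f has_derivative f') (at p within A)" and g: "(g has_derivative g') (at p within A)"
    and eq: "open U" "p \<in> U" "p \<in> A" "\<And>x. x \<in> A \<Longrightarrow> x \<in> U \<Longrightarrow> f x = g x"
    and v: "v \<in> tang A p"
  shows "f' v = g' v"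
proof (rule euclidean_eqI)
  fix i :: 'b
  have "((\<lambda>x. f x \<bullet> i - g x \<bullet> i) has_derivative (\<lambda>v. f' v \<bullet> i - g' v \<bullet> i)) (at p within (A \<inter> U))"
    unfolding at_within_Int_open[OF eq(1,2)] by (intro derivative_intros f g)
  then have "((\<lambda>x. 0) has_derivative (\<lambda>v. f' v \<bullet> i - g' v \<bullet> i)) (at p within (A \<inter> U))"
    by (rule has_derivative_transform[rotated 2]) (use eq in auto)
  then show "f' v \<bullet> i = g' v \<bullet> i"
    using v unfolding tang_def at_within_Int_open[OF eq(1,2)] by auto
qed

text \<open>A derivative \<open>D\<close> of the zero function within \<open>B\<close> pulls back
  along \<open>f\<close> to the derivative \<open>D o f'\<close> of the zero function within
  \<open>A\<close>, which kills \<open>v\<close>.\<close>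

lemma tang_image:
  assumes f: "(f has_derivative f') (at p within A)"
    and U: "open U" "p \<in> U" "p \<in> A" "\<And>x. x \<in> A \<Longrightarrow> x \<in> U \<Longrightarrow> f x \<in> B"
    and v: "v \<in> tang A p"
  shows "f' v \<in> tang B (f p)"
  unfolding tang_def
proof (clarify)
  fix D assume D: "((\<lambda>_. 0::real) has_derivative D) (at (f p) within B)"
  have "((\<lambda>_. 0::real) has_derivative D) (at (f p) within f ` (A \<inter> U))"
    by (rule has_derivative_subset[OF D]) (use U in auto)
  then have "((\<lambda>_. 0::real) \<circ> f has_derivative D \<circ> f') (at p within (A \<inter> U))"
    using diff_chain_within f U by (metis at_within_Int_open)
  then have "((\<lambda>_. 0::real) has_derivative D \<circ> f') (at p within A)"
    using U by (simp add: at_within_Int_open o_def)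
  then show "D (f' v) = 0" using v by (auto simp: tang_def)
qed

text \<open>Derivatives on \<open>{0..1}\<close> are unique at the end point \<open>0\<close> as
  well. A one-sided segment therefore suffices, which is what makes boundary points
  accessible.\<close>

lemma tang_segment:
  assumes "\<And>t. 0 \<le> t \<Longrightarrow> t \<le> 1 \<Longrightarrow> p + t *\<^sub>R v \<in> A"
  shows "v \<in> tang A p"
  unfolding tang_def
proof (clarify)
  fix D assume D: "((\<lambda>_. 0::real) has_derivative D) (at p within A)"
  have "((\<lambda>t::real. p + t *\<^sub>R v) has_derivative (\<lambda>t. t *\<^sub>R v)) (at 0 within {0..1})"
    by (auto intro!: derivative_eq_intros)
  moreover have "((\<lambda>_. 0::real) has_derivative D) (at (p + 0 *\<^sub>R v) within (\<lambda>t. p + t *\<^sub>R v) ` {0..1})"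
    by (rule has_derivative_subset) (use D assms in auto)
  ultimately have "((\<lambda>_. 0::real) \<circ> (\<lambda>t. p + t *\<^sub>R v) has_derivative D \<circ> (\<lambda>t. t *\<^sub>R v)) (at 0 within {0..1})"
    by (rule diff_chain_within)
  then have "((\<lambda>_. 0::real) has_vector_derivative D v) (at 0 within {0..1})"
    using has_derivative_linear[OF D] by (simp add: has_vector_derivative_def o_def linear_scale)
  moreover have "((\<lambda>_. 0::real) has_vector_derivative 0) (at 0 within {0..1::real})"
    by simp
  ultimately show "D v = 0"
    by (intro vector_derivative_unique_within_closed_interval[of 0 1 "0::real"]) auto
qed

lemma small_multiple:
  fixes v :: "'a::real_normed_vector"
  assumes "e > 0"
  obtains c where "c > 0" "\<And>t. 0 \<le> t \<Longrightarrow> t \<le> 1 \<Longrightarrow> y + t *\<^sub>R c *\<^sub>R v \<in> ball y e"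
proof (rule that)
  show "e / (norm v + 1) > 0" using assms by (intro divide_pos_pos add_nonneg_pos) auto
  fix t :: real assume t: "0 \<le> t" "t \<le> 1"
  have n: "norm v + 1 > 0" by (intro add_nonneg_pos) auto
  have "norm (t *\<^sub>R (e / (norm v + 1)) *\<^sub>R v) = t * (e * norm v / (norm v + 1))"
    using t(1) assms n by simp
  also have "\<dots> \<le> 1 * (e * norm v / (norm v + 1))"
    using t assms n by (intro mult_right_mono divide_nonneg_pos) auto
  also have "\<dots> < e" using assms n by (simp add: divide_less_eq algebra_simps)
  finally show "y + t *\<^sub>R (e / (norm v + 1)) *\<^sub>R v \<in> ball y e" by (simp add: dist_norm)
qed

text \<open>Vectors that do not point out of the half-space are reached by segments; the others are
  negatives of such, and \<open>tang\<close> is a subspace.\<close>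

lemma tang_halfspace:
  fixes S :: "'a::euclidean_space set"
  assumes S: "openin (top_of_set (half_space b)) S" and y: "y \<in> S"
  shows "tang S y = UNIV"
proof -
  obtain e where e: "e > 0" "ball y e \<inter> half_space b \<subseteq> S" "y \<in> half_space b"
    using S y unfolding openin_contains_ball by blast
  have in1: "v \<in> tang S y" if v: "v \<bullet> b \<ge> 0" for v
  proof -
    obtain c where c: "c > 0" "\<And>t. 0 \<le> t \<Longrightarrow> t \<le> 1 \<Longrightarrow> y + t *\<^sub>R c *\<^sub>R v \<in> ball y e"
      using small_multiple[OF e(1)] by metis
    have "c *\<^sub>R v \<in> tang S y"
    proof (rule tang_segment)
      fix t :: real assume t: "0 \<le> t" "t \<le> 1"
      have "y + t *\<^sub>R c *\<^sub>R v \<in> ball y e" using c(2) t .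
      moreover have "y + t *\<^sub>R c *\<^sub>R v \<in> half_space b"
        using e(3) t c(1) v by (simp add: half_space_def inner_add_left)
      ultimately show "y + t *\<^sub>R c *\<^sub>R v \<in> S" using e(2) by auto
    qed
    then have "inverse c *\<^sub>R c *\<^sub>R v \<in> tang S y" by (rule subspace_scale[OF subspace_tang])
    then show ?thesis using c(1) by simp
  qed
  have "v \<in> tang S y" for v
    using in1[of v] subspace_scale[OF subspace_tang in1[of "-v"], of "-1"] by (cases "v \<bullet> b \<ge> 0") auto
  then show ?thesis by auto
qed

lemma model_open_cases:
  assumes "model_open S"
  obtains b where "openin (top_of_set (half_space b)) S" "b = 0 \<and> open S \<or> b \<noteq> 0"
proof (cases "open S")
  case True
  have "half_space (0::'a) = UNIV" by (auto simp: half_space_def)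
  then show thesis using True that[of 0] by (simp add: openin_open_eq)
next
  case False
  then show thesis using assms that unfolding model_open_def by blast
qed

lemma tang_model_open: "model_open S \<Longrightarrow> y \<in> S \<Longrightarrow> tang S y = UNIV"
  by (rule model_open_cases) (auto simp: tang_halfspace)

lemma tang_halfspace_boundary:
  fixes S :: "'a::euclidean_space set"
  assumes S: "openin (top_of_set (half_space b)) S" and y: "y \<in> S" "y \<bullet> b = 0" and v: "v \<bullet> b = 0"
  shows "v \<in> tang {z \<in> S. z \<bullet> b = 0} y"
proof -
  obtain e where e: "e > 0" "ball y e \<inter> half_space b \<subseteq> S"
    using S y unfolding openin_contains_ball by blast
  obtain c where c: "c > 0" "\<And>t. 0 \<le> t \<Longrightarrow> t \<le> 1 \<Longrightarrow> y + t *\<^sub>R c *\<^sub>R v \<in> ball y e"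
    using small_multiple[OF e(1)] by metis
  have "c *\<^sub>R v \<in> tang {z \<in> S. z \<bullet> b = 0} y"
  proof (rule tang_segment)
    fix t :: real assume t: "0 \<le> t" "t \<le> 1"
    have "y + t *\<^sub>R c *\<^sub>R v \<in> ball y e" using c(2) t .
    then show "y + t *\<^sub>R c *\<^sub>R v \<in> {z \<in> S. z \<bullet> b = 0}"
      using e(2) y v by (auto simp: half_space_def inner_add_left)
  qed
  then have "inverse c *\<^sub>R c *\<^sub>R v \<in> tang {z \<in> S. z \<bullet> b = 0} y" by (rule subspace_scale[OF subspace_tang])
  then show ?thesis using c(1) by simp
qed

text \<open>By convexity \<open>x - q\<close> is tangent for every \<open>x\<close> in the ball.
  Differences of two such vectors contain all unit vectors, also when \<open>q\<close> lies on the
  sphere.\<close>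

lemma tang_cball:
  fixes q :: "'a::euclidean_space"
  assumes q: "q \<in> cball 0 1" shows "tang (cball 0 1) q = UNIV"
proof -
  have 1: "x - q \<in> tang (cball 0 1) q" if x: "x \<in> cball 0 1" for x
  proof (rule tang_segment)
    fix t :: real assume "0 \<le> t" "t \<le> 1"
    then have "(1 - t) *\<^sub>R q + t *\<^sub>R x \<in> cball 0 1"
      using q x by (intro convexD[OF convex_cball]) auto
    then show "q + t *\<^sub>R (x - q) \<in> cball 0 1" by (simp add: algebra_simps)
  qed
  have "w \<in> tang (cball 0 1) q" for w
  proof -
    have "(sgn w - q) - (0 - q) \<in> tang (cball 0 1) q"
      by (intro subspace_diff[OF subspace_tang] 1) (auto simp: norm_sgn)
    then have "norm w *\<^sub>R sgn w \<in> tang (cball 0 1) q" by (auto intro: subspace_scale[OF subspace_tang])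
    then show ?thesis using sgn_div_norm[of w] by (cases "w = 0") (auto simp: subspace_0[OF subspace_tang])
  qed
  then show ?thesis by auto
qed

section \<open>Charted spaces\<close>

text \<open>Openness of chart domains is not asked for. The property thus passes to restrictions and
  products and is easily verified for mapping tori.\<close>

definition chart_inverses_continuous :: "('a, 'e::euclidean_space) charted \<Rightarrow> bool" where
  "chart_inverses_continuous X \<longleftrightarrow>
     (\<forall>(U, c)\<in>charts X. U \<subseteq> points X \<and> inj_on c U \<and>
        continuous_map (top_of_set (c ` U)) (topo X) (inv_into U c))"

text \<open>The requirement on the middle space of a composition: around every point an open chart
  can be inserted, so that smoothness is tested locally.\<close>

definition open_atlas :: "('a, 'e::euclidean_space) charted \<Rightarrow> bool" where
  "open_atlas X \<longleftrightarrow> points X = \<Union> (fst ` charts X) \<and> (\<forall>(U, c)\<in>charts X. openin (topo X) U \<and> inj_on c U)"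

lemma open_atlasE:
  assumes "open_atlas X" "x \<in> points X"
  obtains U c where "(U, c) \<in> charts X" "x \<in> U" "openin (topo X) U" "inj_on c U"
  using assms unfolding open_atlas_def by fastforce

lemma open_atlasD: "open_atlas X \<Longrightarrow> (U, c) \<in> charts X \<Longrightarrow> openin (topo X) U \<and> inj_on c U"
  unfolding open_atlas_def by blast

lemma homeomorphic_map_inv_into:
  assumes "homeomorphic_map (subtopology T U) (top_of_set (c ` U)) c" "openin T U"
  shows "continuous_map (top_of_set (c ` U)) T (inv_into U c)" "inj_on c U"
proof -
  have U: "topspace (subtopology T U) = U" using assms(2) openin_subset by auto
  obtain g where g: "homeomorphic_maps (subtopology T U) (top_of_set (c ` U)) c g"
    using assms(1) homeomorphic_map_maps by blast
  show inj: "inj_on c U"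
    using homeomorphic_imp_injective_map[OF assms(1)] U by simp
  have "continuous_map (top_of_set (c ` U)) (subtopology T U) g"
    using g by (simp add: homeomorphic_maps_def)
  then have "continuous_map (top_of_set (c ` U)) T g"
    by (rule continuous_map_into_fulltopology)
  moreover have "g y = inv_into U c y" if "y \<in> c ` U" for y
    using g inj that U by (auto simp: homeomorphic_maps_def)
  ultimately show "continuous_map (top_of_set (c ` U)) T (inv_into U c)"
    by (rule continuous_map_eq) simp
qed

lemma manifold_chart:
  assumes "manifold_with_boundary X" "(U, c) \<in> charts X"
  shows "openin (topo X) U" "model_open (c ` U)" "inj_on c U"
    "continuous_map (top_of_set (c ` U)) (topo X) (inv_into U c)"
    "continuous_map (subtopology (topo X) U) euclidean c" "U \<subseteq> points X"
proof -
  have 1: "openin (topo X) U" "model_open (c ` U)" "homeomorphic_map (subtopology (topo X) U) (top_of_set (c ` U)) c"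
    using assms unfolding manifold_with_boundary_def by auto
  then show "openin (topo X) U" "model_open (c ` U)" by auto
  show "inj_on c U" "continuous_map (top_of_set (c ` U)) (topo X) (inv_into U c)"
    using homeomorphic_map_inv_into[OF 1(3,1)] by auto
  show "continuous_map (subtopology (topo X) U) euclidean c"
    using homeomorphic_imp_continuous_map[OF 1(3)] continuous_map_into_fulltopology by blast
  show "U \<subseteq> points X" using 1(1) openin_subset by blast
qed

lemma manifold_chart_transition:
  "manifold_with_boundary X \<Longrightarrow> (U, c) \<in> charts X \<Longrightarrow> (W, d) \<in> charts X \<Longrightarrow>
    smooth_on (c ` (U \<inter> W)) (d \<circ> inv_into U c)"
  unfolding manifold_with_boundary_def by blast

lemma manifold_chart_inverses_continuous: "manifold_with_boundary X \<Longrightarrow> chart_inverses_continuous X"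
  unfolding chart_inverses_continuous_def using manifold_chart by blast

lemma manifold_open_atlas: "manifold_with_boundary X \<Longrightarrow> open_atlas X"
  unfolding open_atlas_def using manifold_chart(1,3)[of X] by (simp add: manifold_with_boundary_def) blast

lemma smooth_mapD:
  "smooth_map X Y f \<Longrightarrow> (U, c) \<in> charts X \<Longrightarrow> (W, d) \<in> charts Y \<Longrightarrow>
    smooth_on (c ` {x \<in> U. f x \<in> W}) (d \<circ> f \<circ> inv_into U c)"
  unfolding smooth_map_def by blast

lemma image_preimage_iff:
  assumes "{z \<in> c ` U. Q (inv_into U c z)} = c ` U \<inter> S" "inj_on c U" "x \<in> U"
  shows "c x \<in> S \<longleftrightarrow> Q x"
proof -
  have "c x \<in> S \<longleftrightarrow> c x \<in> {z \<in> c ` U. Q (inv_into U c z)}" using assms(1,3) by simp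
  then show ?thesis using assms(2,3) by simp
qed

lemma inv_into_Int:
  assumes "inj_on c U" "x \<in> U" "x \<in> B" shows "inv_into (U \<inter> B) c (c x) = x"
  by (rule inv_into_f_f[OF inj_on_subset[OF assms(1)]]) (use assms in auto)

lemma chart_inverses_continuous_restrict:
  assumes "chart_inverses_continuous X" shows "chart_inverses_continuous (restrict_to X B)"
proof -
  have "U \<inter> B \<subseteq> points (restrict_to X B) \<and> inj_on c (U \<inter> B) \<and>
     continuous_map (top_of_set (c ` (U \<inter> B))) (topo (restrict_to X B)) (inv_into (U \<inter> B) c)"
    if "(U, c) \<in> charts X" for U c
  proof -
    have U: "U \<subseteq> points X" "inj_on c U" "continuous_map (top_of_set (c ` U)) (topo X) (inv_into U c)"
      using assms that by (auto simp: chart_inverses_continuous_def)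
    have "continuous_map (top_of_set (c ` (U \<inter> B))) (topo X) (inv_into U c)"
      using continuous_map_from_subtopology_mono[OF U(3)] by (metis image_mono inf_le1)
    then have "continuous_map (top_of_set (c ` (U \<inter> B))) (topo X) (inv_into (U \<inter> B) c)"
      by (rule continuous_map_eq) (use U(2) inv_into_Int[OF U(2)] in auto)
    moreover have "inv_into (U \<inter> B) c ` c ` (U \<inter> B) \<subseteq> B"
      using inv_into_Int[OF U(2)] by auto
    ultimately show ?thesis
      using U by (auto simp: restrict_to_def continuous_map_in_subtopology intro: inj_on_subset)
  qed
  then show ?thesis by (auto simp: chart_inverses_continuous_def restrict_to_def)
qed

lemma open_atlas_restrict:
  assumes "open_atlas X" shows "open_atlas (restrict_to X B)"
proof -
  have "points (restrict_to X B) = \<Union> (fst ` charts X) \<inter> B"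
    using assms by (simp add: open_atlas_def restrict_to_def)
  also have "\<dots> = \<Union> (fst ` charts (restrict_to X B))"
    by (force simp: restrict_to_def)
  finally show ?thesis
    unfolding open_atlas_def using open_atlasD[OF assms]
    by (auto simp: restrict_to_def intro!: openin_subtopology_Int inj_on_subset[OF _ Int_lower1])
qed

lemma smooth_map_restrict:
  assumes "smooth_map X Y f" "chart_inverses_continuous X" "f ` (points X \<inter> B) \<subseteq> C"
  shows "smooth_map (restrict_to X B) (restrict_to Y C) f"
  unfolding smooth_map_def
proof (intro conjI ballI, safe)
  have "continuous_map (subtopology (topo X) B) (topo Y) f"
    using assms(1) by (auto simp: smooth_map_def continuous_map_from_subtopology)
  then show "continuous_map (topo (restrict_to X B)) (topo (restrict_to Y C)) f"
    using assms(3) by (auto simp: restrict_to_def continuous_map_in_subtopology)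
next
  fix U c W d assume "(U, c) \<in> charts (restrict_to X B)" "(W, d) \<in> charts (restrict_to Y C)"
  then obtain U' W' where U: "U = U' \<inter> B" "(U', c) \<in> charts X" and W: "W = W' \<inter> C" "(W', d) \<in> charts Y"
    by (auto simp: restrict_to_def)
  have inj: "inj_on c U'" using assms(2) U by (auto simp: chart_inverses_continuous_def)
  have "smooth_on (c ` {x \<in> U'. f x \<in> W'}) (d \<circ> f \<circ> inv_into U' c)"
    using assms(1) U W by (auto simp: smooth_map_def)
  then have "smooth_on (c ` {x \<in> U. f x \<in> W}) (d \<circ> f \<circ> inv_into U' c)"
    by (rule smooth_on_subset) (use U W in auto)
  then show "smooth_on (c ` {x \<in> U. f x \<in> W}) (d \<circ> f \<circ> inv_into U c)"
    by (rule smooth_on_cong) (use U inj inv_into_Int[OF inj] in auto)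
qed

text \<open>Charts that are only known to have continuous inverses suffice for the source of a
  composition, so that the charts of mapping tori need no further analysis.\<close>

lemma smooth_map_compose:
  assumes f: "smooth_map X Y f" and g: "smooth_map Y Z g"
    and X: "chart_inverses_continuous X" and Y: "open_atlas Y"
  shows "smooth_map X Z (g \<circ> f)"
  unfolding smooth_map_def
proof (intro conjI ballI, safe)
  show "continuous_map (topo X) (topo Z) (g \<circ> f)"
    using f g by (auto simp: smooth_map_def intro: continuous_map_compose)
next
  fix U c W d assume U: "(U, c) \<in> charts X" and W: "(W, d) \<in> charts Z"
  have Uc: "U \<subseteq> points X" "inj_on c U" "continuous_map (top_of_set (c ` U)) (topo X) (inv_into U c)"
    using X U by (auto simp: chart_inverses_continuous_def)
  have cf: "continuous_map (topo X) (topo Y) f" using f by (simp add: smooth_map_def)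
  let ?A = "c ` {x \<in> U. (g \<circ> f) x \<in> W}"
  show "smooth_on ?A (d \<circ> (g \<circ> f) \<circ> inv_into U c)"
  proof (rule smooth_on_local)
    fix y assume "y \<in> ?A"
    then obtain x where x: "x \<in> U" "g (f x) \<in> W" "y = c x" by auto
    then have "f x \<in> points Y" using cf Uc(1) by (auto simp: continuous_map_def)
    then obtain V e where V: "(V, e) \<in> charts Y" "f x \<in> V" "openin (topo Y) V" "inj_on e V"
      using Y open_atlasE by metis
    have "openin (top_of_set (c ` U)) {z \<in> c ` U. (f \<circ> inv_into U c) z \<in> V}"
      using openin_continuous_map_preimage[OF continuous_map_compose[OF Uc(3) cf] V(3)] by simp
    then obtain S where S: "open S" "{z \<in> c ` U. f (inv_into U c z) \<in> V} = c ` U \<inter> S"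
      by (auto simp: openin_open)
    have yS: "y \<in> S" using x V(2) S(2) Uc(2) by auto
    note 1 = smooth_mapD[OF f U V(1)] and 2 = smooth_mapD[OF g V(1) W]
    have sub: "c x' \<in> c ` {x \<in> U. f x \<in> V}" "f x' \<in> V" if "x' \<in> U" "c x' \<in> S" for x'
      using image_preimage_iff[where Q="\<lambda>x. f x \<in> V", OF S(2) Uc(2) that(1)] that by auto
    have 3: "smooth_on (?A \<inter> S) (e \<circ> f \<circ> inv_into U c)"
      by (rule smooth_on_subset[OF 1]) (use sub in auto)
    have "smooth_on (?A \<inter> S) (\<lambda>z. (d \<circ> g \<circ> inv_into V e) ((e \<circ> f \<circ> inv_into U c) z))"
      by (rule smooth_on_compose[OF 3 2]) (use sub Uc(2) in auto)
    then have "smooth_on (?A \<inter> S) (d \<circ> (g \<circ> f) \<circ> inv_into U c)"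
      by (rule smooth_on_cong) (use sub Uc(2) V(4) in auto)
    then show "\<exists>S. open S \<and> y \<in> S \<and> smooth_on (?A \<inter> S) (d \<circ> (g \<circ> f) \<circ> inv_into U c)"
      using S(1) yS by blast
  qed
qed

lemma smooth_map_cong:
  assumes "smooth_map X Y f" "chart_inverses_continuous X" "\<And>x. x \<in> points X \<Longrightarrow> f x = g x"
  shows "smooth_map X Y g"
  unfolding smooth_map_def
proof (intro conjI ballI, safe)
  show "continuous_map (topo X) (topo Y) g"
    by (rule continuous_map_eq[of _ _ f]) (use assms in \<open>auto simp: smooth_map_def\<close>)
next
  fix U c W d assume U: "(U, c) \<in> charts X" and W: "(W, d) \<in> charts Y"
  have Uc: "U \<subseteq> points X" "inj_on c U"
    using assms(2) U by (auto simp: chart_inverses_continuous_def)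
  have "{x \<in> U. f x \<in> W} = {x \<in> U. g x \<in> W}" using Uc assms(3) by auto
  moreover have "smooth_on (c ` {x \<in> U. f x \<in> W}) (d \<circ> f \<circ> inv_into U c)"
    using assms(1) U W by (auto simp: smooth_map_def)
  ultimately show "smooth_on (c ` {x \<in> U. g x \<in> W}) (d \<circ> g \<circ> inv_into U c)"
    using Uc assms(3) by (auto elim!: smooth_on_cong)
qed

section \<open>The boundary of a manifold\<close>

text \<open>A single chart witnesses membership in the boundary, so it must be excluded that another
  chart sees the point as interior. By invariance of domain the change of charts takes an open
  neighbourhood of \<open>c p\<close> to an open set around \<open>d p\<close>, and such a set
  cannot stay in a half-space whose edge contains \<open>d p\<close>.\<close>

lemma interior_not_boundary:
  fixes X :: "('a, 'e::euclidean_space) charted"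
  assumes X: "manifold_with_boundary X" and U: "(U, c) \<in> charts X" "p \<in> U"
    and S: "open S" "c p \<in> S" "S \<subseteq> c ` U"
  shows "p \<notin> boundary X"
proof
  assume "p \<in> boundary X"
  then obtain W d b where W: "(W, d) \<in> charts X" "p \<in> W" "b \<noteq> 0"
      "openin (top_of_set (half_space b)) (d ` W)" "d p \<bullet> b = 0"
    by (auto simp: boundary_def boundary_chart_def)
  note Uc = manifold_chart[OF X U(1)] and Wd = manifold_chart[OF X W(1)]
  have "openin (top_of_set (c ` U)) {z \<in> c ` U. inv_into U c z \<in> W}"
    using openin_continuous_map_preimage[OF Uc(4) Wd(1)] by simp
  then obtain T where T: "open T" "{z \<in> c ` U. inv_into U c z \<in> W} = c ` U \<inter> T"
    by (auto simp: openin_open)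
  define O' where "O' = S \<inter> T"
  have O': "open O'" "O' \<subseteq> c ` (U \<inter> W)"
    using S T(1) image_preimage_iff[where Q="\<lambda>x. x \<in> W", OF T(2) Uc(3)] unfolding O'_def by auto
  have "c p \<in> O'" using S(2) U(2) W(2) image_preimage_iff[where Q="\<lambda>x. x \<in> W", OF T(2) Uc(3), of p]
    by (simp add: O'_def)
  have sm: "smooth_on (c ` (U \<inter> W)) (d \<circ> inv_into U c)"
    using manifold_chart_transition[OF X U(1) W(1)] .
  have con: "continuous_on O' (d \<circ> inv_into U c)"
    using smooth_on_continuous_on[OF smooth_on_subset[OF sm O'(2)]] .
  have inj: "inj_on (d \<circ> inv_into U c) O'"
  proof (rule inj_onI)
    fix y z assume yz: "y \<in> O'" "z \<in> O'" "(d \<circ> inv_into U c) y = (d \<circ> inv_into U c) z"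
    obtain u v where uv: "y = c u" "u \<in> U \<inter> W" "z = c v" "v \<in> U \<inter> W"
      using yz(1,2) O'(2) by blast
    then have "d u = d v" using yz(3) Uc(3) by simp
    then show "y = z" using uv inj_onD[OF Wd(3)] by blast
  qed
  have op: "open ((d \<circ> inv_into U c) ` O')" by (rule invariance_of_domain[OF con O'(1) inj])
  have dp: "d p \<in> (d \<circ> inv_into U c) ` O'"
    using \<open>c p \<in> O'\<close> U(2) Uc(3) by (auto intro!: image_eqI[of _ _ "c p"])
  obtain e where e: "e > 0" "ball (d p) e \<subseteq> (d \<circ> inv_into U c) ` O'"
    using op dp openE by blast
  \<comment> \<open>A small step against the normal \<open>b\<close> stays in the open image but
    leaves the half-space.\<close>
  obtain t where t: "t > 0" "\<And>s. 0 \<le> s \<Longrightarrow> s \<le> 1 \<Longrightarrow> d p + s *\<^sub>R t *\<^sub>R (- b) \<in> ball (d p) e"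
    using small_multiple[OF e(1)] by metis
  have "d p + 1 *\<^sub>R t *\<^sub>R (- b) \<in> (d \<circ> inv_into U c) ` O'"
    using e(2) t(2)[of 1] by auto
  also have "\<dots> \<subseteq> d ` W" using O'(2) Uc(3) by (auto simp: subset_iff)
  also have "\<dots> \<subseteq> half_space b" using W(4) openin_subset by fastforce
  finally have "0 \<le> - (t * (b \<bullet> b))" using W(5) by (simp add: half_space_def inner_add_left inner_diff_left)
  moreover have "t * (b \<bullet> b) > 0" using t(1) W(3) by simp
  ultimately show False by linarith
qed

lemma boundary_open_chart:
  assumes "manifold_with_boundary X" "(U, c) \<in> charts X" "open (c ` U)"
  shows "U \<inter> boundary X = {}"
  using interior_not_boundary[OF assms(1,2) _ assms(3)] by auto

text \<open>Around a point of positive height the chart image contains an open set, so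
  \<open>interior_not_boundary\<close> applies; points of height zero are boundary points by
  definition.\<close>

lemma boundary_half_space_chart:
  assumes X: "manifold_with_boundary X" and U: "(U, c) \<in> charts X"
    and b: "b \<noteq> 0" "openin (top_of_set (half_space b)) (c ` U)"
  shows "U \<inter> boundary X = {x \<in> U. c x \<bullet> b = 0}"
proof (intro equalityI subsetI)
  fix x assume "x \<in> {x \<in> U. c x \<bullet> b = 0}"
  then show "x \<in> U \<inter> boundary X"
    using U b unfolding boundary_def boundary_chart_def by blast
next
  fix x assume x: "x \<in> U \<inter> boundary X"
  obtain T where T: "open T" "c ` U = half_space b \<inter> T" using b(2) by (auto simp: openin_open)
  have "c x \<in> T" using x T(2) by auto
  have "\<not> c x \<bullet> b > 0"
  proof
    assume "c x \<bullet> b > 0"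
    moreover have "open ({y. y \<bullet> b > 0} \<inter> T)"
      by (intro open_Int T(1) open_Collect_less continuous_intros)
    moreover have "{y. y \<bullet> b > 0} \<inter> T \<subseteq> c ` U" unfolding T(2) by (auto simp: half_space_def)
    ultimately show False
      using interior_not_boundary[OF X U, of x "{y. y \<bullet> b > 0} \<inter> T"] x \<open>c x \<in> T\<close> by simp
  qed
  then show "x \<in> {x \<in> U. c x \<bullet> b = 0}" using x T(2) by (force simp: half_space_def)
qed

lemma boundary_subset_points: "manifold_with_boundary X \<Longrightarrow> boundary X \<subseteq> points X"
  unfolding boundary_def boundary_chart_def using manifold_chart(6) by blast

text \<open>In a half-space chart the complement of the boundary is where the continuous height
  function is non-zero. Compactness of the binding rests on this.\<close>

lemma closedin_boundary:
  assumes X: "manifold_with_boundary X" shows "closedin (topo X) (boundary X)"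
proof -
  have "\<exists>T. openin (topo X) T \<and> x \<in> T \<and> T \<subseteq> points X - boundary X" if x: "x \<in> points X - boundary X" for x
  proof -
    obtain U c where U: "(U, c) \<in> charts X" "x \<in> U"
      using x X unfolding manifold_with_boundary_def by fastforce
    note Uc = manifold_chart[OF X U(1)]
    consider "open (c ` U)" | b where "b \<noteq> 0" "openin (top_of_set (half_space b)) (c ` U)"
      using Uc(2) by (auto simp: model_open_def)
    then show ?thesis
    proof cases
      case 1
      then show ?thesis using boundary_open_chart[OF X U(1)] Uc U by blast
    next
      case 2
      have "open {y. y \<bullet> b \<noteq> 0}" by (intro open_Collect_neq continuous_intros)
      then have "openin (subtopology (topo X) U) {z \<in> topspace (subtopology (topo X) U). c z \<in> {y. y \<bullet> b \<noteq> 0}}"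
        by (intro openin_continuous_map_preimage[OF Uc(5)]) auto
      then have "openin (topo X) {z \<in> topspace (subtopology (topo X) U). c z \<in> {y. y \<bullet> b \<noteq> 0}}"
        using Uc(1) openin_trans_full by blast
      moreover have "{z \<in> topspace (subtopology (topo X) U). c z \<in> {y. y \<bullet> b \<noteq> 0}} = U - boundary X"
        using boundary_half_space_chart[OF X U(1) 2] Uc(6) by auto
      ultimately show ?thesis using U x Uc(6) by (intro exI[of _ "U - boundary X"]) auto
    qed
  qed
  then have "openin (topo X) (points X - boundary X)" by (subst openin_subopen) blast
  then show ?thesis using boundary_subset_points[OF X] by (simp add: closedin_def)
qed

section \<open>Submanifolds of Euclidean spaces\<close>

lemma topo_submanifold [simp]: "topo (submanifold A) = top_of_set A"
  by (simp add: submanifold_def)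

lemma charts_submanifold:
  "(U, c) \<in> charts (submanifold A) \<longleftrightarrow> openin (top_of_set A) U \<and> inj_on c U \<and> model_open (c ` U) \<and>
     smooth_on U c \<and> smooth_on (c ` U) (inv_into U c)"
  by (simp add: submanifold_def)

lemma chart_submanifoldI:
  assumes "openin (top_of_set A) U" "model_open (c ` U)" "smooth_on U c" "smooth_on (c ` U) g"
    "\<And>x. x \<in> U \<Longrightarrow> g (c x) = x"
  shows "(U, c) \<in> charts (submanifold A)"
proof -
  have inj: "inj_on c U" using assms(5) by (rule inj_on_inverseI)
  have "smooth_on (c ` U) (inv_into U c)"
    by (rule smooth_on_cong[OF assms(4)]) (use assms(5) inj in auto)
  then show ?thesis using inj assms by (simp add: charts_submanifold)
qed

lemma manifold_submanifold:
  fixes X :: "('f::euclidean_space, 'e::euclidean_space) charted"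
  assumes "X = submanifold A" "\<And>x. x \<in> A \<Longrightarrow> \<exists>U c. (U, c) \<in> charts X \<and> x \<in> U"
  shows "manifold_with_boundary X"
  unfolding manifold_with_boundary_def
proof (intro conjI ballI, safe)
  show "Hausdorff_space (topo X)" using assms(1) by (simp add: Hausdorff_space_subtopology)
  have "second_countable (euclidean :: 'f topology)"
    using ex_countable_basis[where 'a='f] unfolding second_countable_def topological_basis_def
    by (metis open_openin topological_basisE topological_basis_def)
  then show "second_countable (topo X)" using assms(1) by (simp add: second_countable_subtopology)
next
  fix x assume "x \<in> points X"
  then show "x \<in> \<Union> (fst ` charts X)" using assms by force
next
  fix x U c assume "(U, c) \<in> charts X" "x \<in> fst (U, c)"
  then show "x \<in> points X" using assms(1) openin_subset by (fastforce simp: charts_submanifold)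
next
  fix U c assume U: "(U, c) \<in> charts X"
  then have Uc: "openin (top_of_set A) U" "inj_on c U" "model_open (c ` U)" "smooth_on U c"
     "smooth_on (c ` U) (inv_into U c)" by (auto simp: assms(1) charts_submanifold)
  then show "openin (topo X) U" "model_open (c ` U)" using assms(1) by auto
  have "U \<subseteq> A" using Uc(1) openin_subset by fastforce
  then have "subtopology (topo X) U = top_of_set U" 
    by (simp add: assms(1) subtopology_subtopology inf_absorb2)
  moreover have "homeomorphic_maps (top_of_set U) (top_of_set (c ` U)) c (inv_into U c)"
    using smooth_on_continuous_on[OF Uc(4)] smooth_on_continuous_on[OF Uc(5)] Uc(2)
    by (auto simp: homeomorphic_maps_def inv_into_into)
  ultimately show "homeomorphic_map (subtopology (topo X) U) (top_of_set (c ` U)) c"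
    using homeomorphic_maps_map by metis
next
  fix U c W d assume "(U, c) \<in> charts X" "(W, d) \<in> charts X"
  then have 1: "inj_on c U" "smooth_on W d" "smooth_on (c ` U) (inv_into U c)"
    by (auto simp: assms(1) charts_submanifold)
  have "smooth_on (c ` (U \<inter> W)) (inv_into U c)" using 1(3) by (rule smooth_on_subset) auto
  then show "smooth_on (c ` (U \<inter> W)) (d \<circ> inv_into U c)"
    unfolding o_def by (rule smooth_on_compose[OF _ 1(2)]) (use 1(1) in auto)
qed

text \<open>Charts of a submanifold are restrictions of ambient smooth maps, so a map into it may be
  tested as a map into the Euclidean space.\<close>

lemma smooth_map_submanifoldI:
  assumes "continuous_map (topo X) (top_of_set A) h" "chart_inverses_continuous X"
    "\<And>U c. (U, c) \<in> charts X \<Longrightarrow> smooth_on (c ` U) (h \<circ> inv_into U c)"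
  shows "smooth_map X (submanifold A) h"
  unfolding smooth_map_def
proof (intro conjI ballI, safe)
  show "continuous_map (topo X) (topo (submanifold A)) h" using assms(1) by simp
  fix U c W d assume U: "(U, c) \<in> charts X" and W: "(W, d) \<in> charts (submanifold A)"
  have inj: "inj_on c U" using assms(2) U by (auto simp: chart_inverses_continuous_def)
  have d: "smooth_on W d" using W by (simp add: charts_submanifold)
  have "smooth_on (c ` {x \<in> U. h x \<in> W}) (h \<circ> inv_into U c)"
    by (rule smooth_on_subset[OF assms(3)[OF U]]) auto
  then have "smooth_on (c ` {x \<in> U. h x \<in> W}) (\<lambda>y. d ((h \<circ> inv_into U c) y))"
    by (rule smooth_on_compose[OF _ d]) (use inj in auto)
  then show "smooth_on (c ` {x \<in> U. h x \<in> W}) (d \<circ> h \<circ> inv_into U c)" by (simp add: o_def)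
qed

text \<open>Conversely, the ambient map is recovered locally by composing with the inverse of an
  open chart around the value, which is smooth as an ambient map.\<close>

lemma smooth_map_submanifoldD:
  assumes h: "smooth_map X (submanifold A :: ('f::euclidean_space, 'e::euclidean_space) charted) h"
    and X: "chart_inverses_continuous X" and A: "open_atlas (submanifold A :: ('f, 'e) charted)"
    and U: "(U, c) \<in> charts X"
  shows "smooth_on (c ` U) (h \<circ> inv_into U c)"
proof (rule smooth_on_local)
  fix y assume "y \<in> c ` U"
  then obtain x where x: "x \<in> U" "y = c x" by auto
  have Uc: "U \<subseteq> points X" "inj_on c U" "continuous_map (top_of_set (c ` U)) (topo X) (inv_into U c)"
    using X U by (auto simp: chart_inverses_continuous_def)
  have cf: "continuous_map (topo X) (top_of_set A) h" using h by (simp add: smooth_map_def)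
  have "h x \<in> A" using cf Uc(1) x by (auto simp: continuous_map_def)
  then obtain V e where V: "(V, e) \<in> charts (submanifold A :: ('f, 'e) charted)" "h x \<in> V"
    "openin (top_of_set A) V" "inj_on e V"
    using open_atlasE[OF A, of "h x"] by auto
  have "openin (top_of_set (c ` U)) {z \<in> c ` U. (h \<circ> inv_into U c) z \<in> V}"
    using openin_continuous_map_preimage[OF continuous_map_compose[OF Uc(3) cf] V(3)] by simp
  then obtain S where S: "open S" "{z \<in> c ` U. h (inv_into U c z) \<in> V} = c ` U \<inter> S"
    by (auto simp: openin_open)
  note 1 = smooth_mapD[OF h U V(1)]
  have sub: "c x' \<in> c ` {x \<in> U. h x \<in> V}" "h x' \<in> V" if "x' \<in> U" "c x' \<in> S" for x'
      using image_preimage_iff[where Q="\<lambda>x. h x \<in> V", OF S(2) Uc(2) that(1)] that by auto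
  have 3: "smooth_on (c ` U \<inter> S) (e \<circ> h \<circ> inv_into U c)"
    by (rule smooth_on_subset[OF 1]) (use sub in auto)
  have "smooth_on (e ` V) (inv_into V e)" using V(1) by (simp add: charts_submanifold)
  then have "smooth_on (c ` U \<inter> S) (\<lambda>z. inv_into V e ((e \<circ> h \<circ> inv_into U c) z))"
    by (rule smooth_on_compose[OF 3]) (use sub Uc(2) in auto)
  then have "smooth_on (c ` U \<inter> S) (h \<circ> inv_into U c)"
    by (rule smooth_on_cong) (use sub Uc(2) V(4) in auto)
  moreover have "y \<in> S" using x V(2) S(2) Uc(2) by auto
  ultimately show "\<exists>S. open S \<and> y \<in> S \<and> smooth_on (c ` U \<inter> S) (h \<circ> inv_into U c)"
    using S(1) by blast
qed

lemma smooth_map_from_submanifoldI: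
  assumes "continuous_map (top_of_set A) (topo Y) q"
    "\<And>W d. (W, d) \<in> charts Y \<Longrightarrow> smooth_on {x \<in> A. q x \<in> W} (d \<circ> q)"
  shows "smooth_map (submanifold A) Y q"
  unfolding smooth_map_def
proof (intro conjI ballI, safe)
  show "continuous_map (topo (submanifold A)) (topo Y) q" using assms(1) by simp
  fix U c W d assume U: "(U, c) \<in> charts (submanifold A)" and W: "(W, d) \<in> charts Y"
  have U': "inj_on c U" "smooth_on (c ` U) (inv_into U c)" "U \<subseteq> A"
    using U openin_subset by (fastforce simp: charts_submanifold)+
  have "smooth_on (c ` {x \<in> U. q x \<in> W}) (inv_into U c)"
    by (rule smooth_on_subset[OF U'(2)]) auto
  then show "smooth_on (c ` {x \<in> U. q x \<in> W}) (d \<circ> q \<circ> inv_into U c)"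
    unfolding comp_assoc[symmetric] comp_def[of "d \<circ> q"]
    by (rule smooth_on_compose[OF _ assms(2)[OF W]]) (use U' in auto)
qed

lemma smooth_map_from_restrict_submanifoldD:
  assumes q: "smooth_map (restrict_to (submanifold A :: ('f::euclidean_space, 'e::euclidean_space) charted) B) Y q"
    and A: "open_atlas (submanifold A :: ('f, 'e) charted)" and B: "B \<subseteq> A"
    and W: "(W, d) \<in> charts Y"
  shows "smooth_on {x \<in> B. q x \<in> W} (d \<circ> q)"
proof (rule smooth_on_local)
  fix x assume x: "x \<in> {x \<in> B. q x \<in> W}"
  then obtain V e where V: "(V, e) \<in> charts (submanifold A :: ('f, 'e) charted)" "x \<in> V"
    "openin (top_of_set A) V" "inj_on e V"
    using open_atlasE[OF A, of x] B by auto
  obtain S where S: "open S" "V = A \<inter> S" using V(3) by (auto simp: openin_open)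
  have "(V \<inter> B, e) \<in> charts (restrict_to (submanifold A) B)" using V(1) by (force simp: restrict_to_def)
  note 1 = smooth_mapD[OF q this W]
  have "smooth_on V e" using V(1) by (simp add: charts_submanifold)
  then have "smooth_on ({x \<in> B. q x \<in> W} \<inter> S) e"
    by (rule smooth_on_subset) (use S B in auto)
  then have "smooth_on ({x \<in> B. q x \<in> W} \<inter> S) (\<lambda>x. (d \<circ> q \<circ> inv_into (V \<inter> B) e) (e x))"
    by (rule smooth_on_compose[OF _ 1]) (use S B in auto)
  then have "smooth_on ({x \<in> B. q x \<in> W} \<inter> S) (d \<circ> q)"
    by (rule smooth_on_cong) (use S B inv_into_Int[OF V(4)] in auto)
  then show "\<exists>S. open S \<and> x \<in> S \<and> smooth_on ({x \<in> B. q x \<in> W} \<inter> S) (d \<circ> q)"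
    using S V(2) by blast
qed

section \<open>Charts of spheres and balls\<close>

text \<open>Orthogonal projection of the open hemisphere around \<open>p\<close> to the hyperplane
  orthogonal to \<open>p\<close>, followed by a linear isometry to \<open>'e\<close>. The inverse
  restores the component along \<open>p\<close> as a square root.\<close>

lemma sphere_chart:
  fixes p :: "'f::euclidean_space"
  assumes dim: "DIM('f) = DIM('e::euclidean_space) + 1" and p: "norm p = 1"
  shows "\<exists>U c. (U, c) \<in> charts (submanifold (sphere 0 1) :: ('f, 'e) charted) \<and> p \<in> U \<and> open (c ` U)"
proof -
  have "p \<noteq> 0" using p by auto
  have "dim {x. p \<bullet> x = 0} = dim (UNIV :: 'e set)"
    using dim_hyperplane[OF \<open>p \<noteq> 0\<close>] dim by simp
  then obtain f g where fg: "linear f" "linear g" "f ` {x. p \<bullet> x = 0} = (UNIV :: 'e set)" "g ` (UNIV :: 'e set) = {x. p \<bullet> x = 0}"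
     "\<And>x. x \<in> {x. p \<bullet> x = 0} \<Longrightarrow> norm (f x) = norm x" "\<And>y. norm (g y) = norm y"
     "\<And>x. x \<in> {x. p \<bullet> x = 0} \<Longrightarrow> g (f x) = x" "\<And>y. f (g y) = y"
    by (rule isometries_subspaces[OF subspace_hyperplane subspace_UNIV]) auto
  have gp: "p \<bullet> g y = 0" "g y \<bullet> p = 0" for y using fg(4) by (auto simp: inner_commute)
  have pp: "p \<bullet> p = 1" using p by (simp add: dot_square_norm)
  define U where "U = sphere 0 1 \<inter> {x. x \<bullet> p > 0}"
  define c where "c x = f (x - (x \<bullet> p) *\<^sub>R p)" for x
  define h where "h y = g y + sqrt (1 - y \<bullet> y) *\<^sub>R p" for y
  have orth: "x - (x \<bullet> p) *\<^sub>R p \<in> {x. p \<bullet> x = 0}" for x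
    by (simp add: inner_diff_right pp inner_commute)
  have nc: "c x \<bullet> c x = x \<bullet> x - (x \<bullet> p)\<^sup>2" for x
  proof -
    have "c x \<bullet> c x = (x - (x \<bullet> p) *\<^sub>R p) \<bullet> (x - (x \<bullet> p) *\<^sub>R p)"
      unfolding dot_square_norm c_def fg(5)[OF orth] ..
    also have "\<dots> = x \<bullet> x - (x \<bullet> p)\<^sup>2"
      by (simp add: inner_diff_left inner_diff_right pp inner_commute power2_eq_square)
    finally show ?thesis .
  qed
  have xx: "x \<bullet> x = 1" if "x \<in> U" for x using that by (simp add: U_def dot_square_norm)
  have hc: "h (c x) = x" if "x \<in> U" for x
  proof -
    have "g (c x) = x - (x \<bullet> p) *\<^sub>R p" unfolding c_def by (rule fg(7)[OF orth])
    moreover have "sqrt (1 - c x \<bullet> c x) = x \<bullet> p" using that nc[of x] xx[OF that] by (simp add: U_def)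
    ultimately show ?thesis by (simp add: h_def)
  qed
  have im: "c ` U = ball 0 1"
  proof (intro equalityI subsetI)
    fix y assume "y \<in> c ` U"
    then obtain x where x: "x \<in> U" "y = c x" by auto
    have "y \<bullet> y < 1" using nc[of x] xx[OF x(1)] x by (simp add: U_def)
    then show "y \<in> ball 0 1" by (simp add: dot_square_norm power_less_one_iff)
  next
    fix y :: 'e assume "y \<in> ball 0 1"
    then have y: "y \<bullet> y < 1" by (simp add: dot_square_norm power_less_one_iff)
    have hp: "h y \<bullet> p = sqrt (1 - y \<bullet> y)" by (simp add: h_def inner_add_left gp pp)
    have "h y \<bullet> h y = g y \<bullet> g y + (1 - y \<bullet> y)"
      using y by (simp add: h_def inner_add_left inner_add_right gp pp flip: power2_eq_square)
    also have "g y \<bullet> g y = y \<bullet> y" by (simp add: dot_square_norm fg(6))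
    finally have "h y \<in> U" using hp y by (simp add: U_def norm_eq_sqrt_inner)
    moreover have "c (h y) = y" unfolding c_def hp by (simp add: h_def fg(8))
    ultimately show "y \<in> c ` U" by (metis imageI)
  qed
  have "(U, c) \<in> charts (submanifold (sphere 0 1) :: ('f, 'e) charted)"
  proof (rule chart_submanifoldI[where g=h])
    have "open {x. x \<bullet> p > 0}" by (intro open_Collect_less continuous_intros)
    then show "openin (top_of_set (sphere 0 1)) U" unfolding U_def by (rule openin_open_Int)
    show "model_open (c ` U)" unfolding im by (simp add: model_open_def)
    have "Cinf UNIV c" unfolding c_def[abs_def]
      by (intro Cinf_linear[OF fg(1)] Cinf_diff Cinf_scaleR Cinf_inner Cinf_ident Cinf_const open_UNIV)
    then show "smooth_on U c" by (rule smooth_on_Cinf) simp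
    have "Cinf (ball 0 1) h" unfolding h_def[abs_def]
      by (intro Cinf_add Cinf_linear[OF fg(2)] Cinf_sqrt Cinf_scaleR Cinf_inner Cinf_ident Cinf_const Cinf_diff open_ball)
        (simp add: dot_square_norm power_less_one_iff)
    then show "smooth_on (c ` U) h" unfolding im by (rule smooth_on_Cinf) simp
  qed (rule hc)
  moreover have "p \<in> U" using p pp by (simp add: U_def)
  ultimately show ?thesis unfolding im[symmetric] using im by (metis open_ball)
qed

lemma manifold_sphere:
  assumes "DIM('f::euclidean_space) = DIM('e::euclidean_space) + 1"
  shows "manifold_with_boundary (submanifold (sphere 0 1) :: ('f, 'e) charted)"
  using sphere_chart[OF assms] by (intro manifold_submanifold[OF refl]) (simp, blast)

lemma closed_manifold_sphere:
  assumes "DIM('f::euclidean_space) = DIM('e::euclidean_space) + 1"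
  shows "closed_manifold (submanifold (sphere 0 1) :: ('f, 'e) charted)" (is "closed_manifold ?M")
proof -
  note M = manifold_sphere[OF assms]
  have "p \<notin> boundary ?M" for p
  proof
    assume p: "p \<in> boundary ?M"
    then have "norm p = 1" using boundary_subset_points[OF M] by auto
    then show False using sphere_chart[OF assms, of p] boundary_open_chart[OF M] p by blast
  qed
  then show ?thesis using M by (auto simp: closed_manifold_def compact_space_subtopology)
qed

lemma cball_interior_chart: "(ball 0 1, \<lambda>x. x) \<in> charts (submanifold (cball 0 1) :: ('f::euclidean_space, 'f) charted)"
proof (rule chart_submanifoldI[where g="\<lambda>x. x"])
  show "openin (top_of_set (cball 0 1)) (ball (0::'f) 1)"
    by (rule open_subset) auto
qed (auto simp: model_open_def smooth_on_id)

text \<open>The chart keeps the part of \<open>x\<close> orthogonal to \<open>p\<close> and replaces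
  the component along \<open>p\<close> by \<open>1 - x \<bullet> x\<close>, which is non-negative on
  the ball and zero exactly on the sphere.\<close>

lemma cball_boundary_chart:
  fixes p :: "'f::euclidean_space"
  assumes p: "norm p = 1"
  shows "\<exists>U c. boundary_chart (submanifold (cball 0 1) :: ('f, 'f) charted) p U c p"
proof -
  have pp: "p \<bullet> p = 1" using p by (simp add: dot_square_norm)
  define U where "U = cball 0 1 \<inter> {x. x \<bullet> p > 0}"
  define c where "c x = x - (x \<bullet> p) *\<^sub>R p + (1 - x \<bullet> x) *\<^sub>R p" for x
  \<comment> \<open>If \<open>z = c x\<close>, then \<open>r z\<close> is the square of the lost
    component \<open>x \<bullet> p\<close>; its sign is known on \<open>U\<close>, so the root in
    \<open>h\<close> recovers it.\<close>
  define r where "r z = 1 - ((z - (z \<bullet> p) *\<^sub>R p) \<bullet> (z - (z \<bullet> p) *\<^sub>R p)) - z \<bullet> p" for z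
  define h where "h z = z - (z \<bullet> p) *\<^sub>R p + sqrt (r z) *\<^sub>R p" for z
  have orth: "(z - (z \<bullet> p) *\<^sub>R p) \<bullet> p = 0" for z by (simp add: inner_diff_left pp)
  have sq: "z \<bullet> z = (z - (z \<bullet> p) *\<^sub>R p) \<bullet> (z - (z \<bullet> p) *\<^sub>R p) + (z \<bullet> p)\<^sup>2" for z
    by (simp add: inner_diff_left inner_diff_right pp inner_commute power2_eq_square)
  have cp: "c x \<bullet> p = 1 - x \<bullet> x" for x using orth[of x] by (simp add: c_def inner_add_left pp)
  have cx: "c x - (c x \<bullet> p) *\<^sub>R p = x - (x \<bullet> p) *\<^sub>R p" for x unfolding cp by (simp add: c_def)
  have rc: "r (c x) = (x \<bullet> p)\<^sup>2" for x using sq[of x] unfolding r_def cx unfolding cp by simp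
  have hc: "h (c x) = x" if "x \<in> U" for x
    using that by (simp add: h_def cx rc U_def)
  have xx: "x \<bullet> x \<le> 1 \<longleftrightarrow> x \<in> cball 0 1" for x :: 'f by (simp add: dot_square_norm power_le_one_iff abs_square_le_1)
  have im: "c ` U = half_space p \<inter> {z. r z > 0}"
  proof (intro equalityI subsetI)
    fix z assume "z \<in> c ` U"
    then obtain x where x: "x \<in> U" "z = c x" by auto
    then show "z \<in> half_space p \<inter> {z. r z > 0}"
      using xx[of x] by (auto simp: half_space_def cp rc U_def)
  next
    fix z assume z: "z \<in> half_space p \<inter> {z. r z > 0}"
    have hp: "h z \<bullet> p = sqrt (r z)" using orth[of z] by (simp add: h_def inner_add_left pp)
    have hz: "h z - (h z \<bullet> p) *\<^sub>R p = z - (z \<bullet> p) *\<^sub>R p" unfolding hp by (simp add: h_def)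
    have hh: "h z \<bullet> h z = 1 - z \<bullet> p" 
    proof -
      have "(sqrt (r z))\<^sup>2 = r z" using z by simp
      then show ?thesis using sq[of "h z"] r_def[of z] unfolding hz unfolding hp by linarith
    qed
    have "h z \<in> U" using z hp hh xx[of "h z"] by (simp add: U_def half_space_def)
    moreover have "c (h z) = z" unfolding c_def[of "h z"] hz hh by simp
    ultimately show "z \<in> c ` U" by (metis imageI)
  qed
  have r: "Cinf UNIV r" unfolding r_def[abs_def]
    by (intro Cinf_diff Cinf_scaleR Cinf_inner Cinf_ident Cinf_const open_UNIV)
  have op: "open {z. r z > 0}"
    using Cinf_continuous_on[OF r] by (intro open_Collect_less continuous_intros) 
  have "(U, c) \<in> charts (submanifold (cball 0 1) :: ('f, 'f) charted)"
  proof (rule chart_submanifoldI[where g=h])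
    have "open {x. x \<bullet> p > 0}" by (intro open_Collect_less continuous_intros)
    then show "openin (top_of_set (cball 0 1)) U" unfolding U_def by (rule openin_open_Int)
    show "model_open (c ` U)" unfolding im model_open_def using op p by (auto intro!: exI[of _ p])
    have "Cinf UNIV c" unfolding c_def[abs_def]
      by (intro Cinf_add Cinf_diff Cinf_scaleR Cinf_inner Cinf_ident Cinf_const open_UNIV)
    then show "smooth_on U c" by (rule smooth_on_Cinf) simp
    have "Cinf {z. r z > 0} h" unfolding h_def[abs_def]
      by (intro Cinf_add Cinf_sqrt Cinf_scaleR Cinf_inner Cinf_ident Cinf_const Cinf_diff op Cinf_subset[OF r]) auto
    then show "smooth_on (c ` U) h" unfolding im by (rule smooth_on_Cinf) simp
  qed (rule hc)
  moreover have "openin (top_of_set (half_space p)) (c ` U)" unfolding im using op by (rule openin_open_Int)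
  moreover have "p \<in> U" using p pp by (simp add: U_def)
  moreover have "c p \<bullet> p = 0" using cp pp by simp
  ultimately show ?thesis using p unfolding boundary_chart_def by (metis norm_zero zero_neq_one)
qed

lemma manifold_cball: "manifold_with_boundary (submanifold (cball 0 1) :: ('f::euclidean_space, 'f) charted)"
proof (rule manifold_submanifold[OF refl])
  fix x :: 'f assume "x \<in> cball 0 1"
  then have "norm x = 1 \<or> x \<in> ball 0 1" by auto
  then show "\<exists>U c. (U, c) \<in> charts (submanifold (cball 0 1) :: ('f, 'f) charted) \<and> x \<in> U"
    using cball_interior_chart cball_boundary_chart[of x] unfolding boundary_chart_def by blast
qed

lemma boundary_cball: "boundary (submanifold (cball 0 1) :: ('f::euclidean_space, 'f) charted) = sphere 0 1" (is "boundary ?B = _")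
proof (intro equalityI subsetI)
  fix p :: 'f assume p: "p \<in> boundary ?B"
  then have "p \<in> cball 0 1" using boundary_subset_points[OF manifold_cball] by auto
  moreover have "p \<notin> ball 0 1" using boundary_open_chart[OF manifold_cball cball_interior_chart] p by auto
  ultimately show "p \<in> sphere 0 1" by auto
next
  fix p :: 'f assume "p \<in> sphere 0 1"
  then show "p \<in> boundary ?B" using cball_boundary_chart[of p] unfolding boundary_def by auto
qed

lemma inv_into_product_chart:
  assumes "inj_on c U" "inj_on d W" "x \<in> c ` U \<times> d ` W"
  shows "inv_into (U \<times> W) (map_prod c d) x = (inv_into U c (fst x), inv_into W d (snd x))"
proof -
  obtain u w where uw: "u \<in> U" "w \<in> W" "x = (c u, d w)" using assms(3) by auto
  have "inj_on (map_prod c d) (U \<times> W)" using assms by (auto simp: inj_on_def)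
  then have "inv_into (U \<times> W) (map_prod c d) (map_prod c d (u, w)) = (u, w)"
    using uw by (intro inv_into_f_f) auto
  then show ?thesis using uw assms by simp
qed

lemma charts_product:
  "(P, k) \<in> charts (product X Y) \<longleftrightarrow>
    (\<exists>U c W d. P = U \<times> W \<and> k = map_prod c d \<and> (U, c) \<in> charts X \<and> (W, d) \<in> charts Y)"
  by (auto simp: product_def)

lemma chart_inverses_continuous_product:
  assumes X: "chart_inverses_continuous X" and Y: "chart_inverses_continuous Y"
  shows "chart_inverses_continuous (product X Y)"
  unfolding chart_inverses_continuous_def
proof (safe)
  fix P k assume "(P, k) \<in> charts (product X Y)"
  then obtain U c W d where P: "P = U \<times> W" "k = map_prod c d" and U: "(U, c) \<in> charts X" and W: "(W, d) \<in> charts Y"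
    by (auto simp: charts_product)
  have Uc: "U \<subseteq> points X" "inj_on c U" "continuous_map (top_of_set (c ` U)) (topo X) (inv_into U c)"
    using X U by (auto simp: chart_inverses_continuous_def)
  have Wd: "W \<subseteq> points Y" "inj_on d W" "continuous_map (top_of_set (d ` W)) (topo Y) (inv_into W d)"
    using Y W by (auto simp: chart_inverses_continuous_def)
  show "x \<in> points (product X Y)" if "x \<in> P" for x using that P Uc Wd by (auto simp: product_def)
  show "inj_on k P" unfolding P using Uc Wd by (auto simp: inj_on_def)
  have "continuous_map (prod_topology (top_of_set (c ` U)) (top_of_set (d ` W))) (prod_topology (topo X) (topo Y))
      (\<lambda>x. (inv_into U c (fst x), inv_into W d (snd x)))"
    by (intro continuous_map_pairedI continuous_map_compose[OF continuous_map_fst Uc(3), unfolded o_def]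
       continuous_map_compose[OF continuous_map_snd Wd(3), unfolded o_def])
  then have "continuous_map (top_of_set (c ` U \<times> d ` W)) (prod_topology (topo X) (topo Y))
      (\<lambda>x. (inv_into U c (fst x), inv_into W d (snd x)))"
    unfolding subtopology_Times[symmetric] by simp
  then have "continuous_map (top_of_set (c ` U \<times> d ` W)) (prod_topology (topo X) (topo Y)) (inv_into P k)"
    unfolding P by (rule continuous_map_eq) (use inv_into_product_chart[OF Uc(2) Wd(2)] in auto)
  moreover have "k ` P = c ` U \<times> d ` W" unfolding P by (auto simp: map_prod_def)
  ultimately show "continuous_map (top_of_set (k ` P)) (topo (product X Y)) (inv_into P k)"
    by (simp add: product_def)
qed

section \<open>Spinning a page around the binding\<close>

lemma Cinf_partial:
  assumes "Cinf W F" "(a, l) \<in> W"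
  shows "((\<lambda>x. F (x, l)) has_derivative (\<lambda>v. frechet_derivative F (at (a, l)) (v, 0))) (at a)"
proof -
  have "((\<lambda>x. (x, l)) has_derivative (\<lambda>v. (v, 0))) (at a)"
    by (auto intro!: derivative_eq_intros)
  from has_derivative_compose[OF this, of F "frechet_derivative F (at (a, l))"]
  show ?thesis using Cinf_has_derivative[OF assms] by simp
qed

text \<open>The derivative \<open>T\<close> in the first variable is bounded below by
  \<open>B\<close>, and near \<open>(p, l0)\<close> the partial derivatives differ from
  \<open>T\<close> by at most \<open>B / 2\<close>. By the mean value inequality
  \<open>F (\<cdot>, l) - T\<close> is Lipschitz with constant \<open>B / 2\<close>, which
  \<open>T\<close> dominates. The radius is uniform in the parameter, as compactness arguments over
  the parameters require.\<close>

lemma C1_uniformly_locally_injective: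
  fixes F :: "'a::euclidean_space \<times> 'l::euclidean_space \<Rightarrow> 'g::euclidean_space"
  assumes F: "Cinf W F" and p: "(p, l0) \<in> W"
    and inj: "\<And>v. frechet_derivative F (at (p, l0)) (v, 0) = 0 \<Longrightarrow> v = 0"
  obtains d where "d > 0"
    "\<And>a l. a \<in> ball p d \<Longrightarrow> l \<in> ball l0 d \<Longrightarrow> (a, l) \<in> W"
    "\<And>a b l. a \<in> ball p d \<Longrightarrow> b \<in> ball p d \<Longrightarrow> l \<in> ball l0 d \<Longrightarrow> F (a, l) = F (b, l) \<Longrightarrow> a = b"
    "\<And>a l v. a \<in> ball p d \<Longrightarrow> l \<in> ball l0 d \<Longrightarrow> frechet_derivative F (at (a, l)) (v, 0) = 0 \<Longrightarrow> v = 0"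
proof -
  define D where "D z v = frechet_derivative F (at z) (v, 0)" for z v
  have D: "((\<lambda>x. F (x, l)) has_derivative D (a, l)) (at a)" if "(a, l) \<in> W" for a l
    using Cinf_partial[OF F that] by (simp add: D_def[abs_def])
  define T where "T = D (p, l0)"
  have linT: "linear T" using D[OF p] has_derivative_linear unfolding T_def by blast
  have "inj T" using linT inj by (auto simp: linear_injective_0 T_def D_def)
  then obtain B where B: "B > 0" "\<And>v. norm (T v) \<ge> B * norm v"
    using linear_inj_bounded_below_pos[OF linT] by blast
  define n where "n = real DIM('a)"
  have n: "n > 0" by (simp add: n_def)
  \<comment> \<open>An error below \<open>c\<close> in each of the \<open>DIM('a)\<close> basis
    directions adds up to at most \<open>B / 2\<close>, half of the lower bound of
    \<open>T\<close>.\<close>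
  define c where "c = B / (2 * n)"
  have c: "c > 0" using B n by (simp add: c_def)
  have "\<exists>d>0. \<forall>z. dist z (p, l0) < d \<longrightarrow> z \<in> W \<and> (\<forall>i\<in>Basis. norm (D z i - T i) < c)"
  proof -
    have "\<forall>i\<in>Basis. eventually (\<lambda>z. dist (D z i) (T i) < c) (nhds (p, l0))"
    proof
      fix i :: 'a
      have "isCont (\<lambda>z. D z i) (p, l0)" unfolding D_def by (rule Cinf_isCont[OF Cinf_frechet[OF F] p])
      then have "((\<lambda>z. D z i) \<longlongrightarrow> T i) (nhds (p, l0))"
        by (simp add: T_def isCont_def tendsto_nhds_iff)
      then show "eventually (\<lambda>z. dist (D z i) (T i) < c) (nhds (p, l0))"
        using c by (rule tendstoD)
    qed
    then have "eventually (\<lambda>z. \<forall>i\<in>Basis. dist (D z i) (T i) < c) (nhds (p, l0))"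
      by (simp add: eventually_ball_finite_distrib)
    moreover have "eventually (\<lambda>z. z \<in> W) (nhds (p, l0))"
      using Cinf_open[OF F] p by (rule eventually_nhds_in_open)
    ultimately have "eventually (\<lambda>z. z \<in> W \<and> (\<forall>i\<in>Basis. dist (D z i) (T i) < c)) (nhds (p, l0))"
      by (rule eventually_conj[rotated])
    then show ?thesis unfolding eventually_nhds_metric by (simp add: dist_norm)
  qed
  then obtain d0 where d0: "d0 > 0"
    "\<And>z. dist z (p, l0) < d0 \<Longrightarrow> z \<in> W \<and> (\<forall>i\<in>Basis. norm (D z i - T i) < c)" by blast
  define d where "d = d0 / 2"
  have near: "dist (a, l) (p, l0) < d0" if "a \<in> ball p d" "l \<in> ball l0 d" for a l
  proof -
    have "dist (a, l) (p, l0) \<le> dist a p + dist l l0"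
      unfolding dist_Pair_Pair using sqrt_sum_squares_le_sum[of "dist a p" "dist l l0"] by simp
    then show ?thesis using that by (simp add: d_def dist_commute)
  qed
  have bd: "norm (D (a, l) v - T v) \<le> B / 2 * norm v" if "a \<in> ball p d" "l \<in> ball l0 d" for a l v
  proof -
    have z: "(a, l) \<in> W" "\<forall>i\<in>Basis. norm (D (a, l) i - T i) < c" using d0(2)[OF near[OF that]] by auto
    have lin: "linear (\<lambda>v. D (a, l) v - T v)"
      using linT has_derivative_linear[OF D[OF z(1)]] by (rule linear_compose_sub[rotated])
    have "norm (D (a, l) v - T v) = norm (\<Sum>i\<in>Basis. (v \<bullet> i) *\<^sub>R (D (a, l) i - T i))"
      using linear_sum[OF lin, of "\<lambda>i. (v \<bullet> i) *\<^sub>R i" Basis] linear_scale[OF lin]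
      by (simp add: euclidean_representation)
    also have "\<dots> \<le> (\<Sum>i\<in>(Basis :: 'a set). norm v * c)"
    proof (rule sum_norm_le)
      fix i :: 'a assume i: "i \<in> Basis"
      show "norm ((v \<bullet> i) *\<^sub>R (D (a, l) i - T i)) \<le> norm v * c"
        unfolding norm_scaleR using z(2) i Basis_le_norm[OF i, of v] c
        by (intro mult_mono) (auto intro: less_imp_le)
    qed
    also have "\<dots> = B / 2 * norm v" using n by (simp add: c_def n_def)
    finally show ?thesis .
  qed
  show thesis
  proof (rule that[of d])
    show "d > 0" using d0 by (simp add: d_def)
    show "(a, l) \<in> W" if "a \<in> ball p d" "l \<in> ball l0 d" for a l
      using d0(2)[OF near[OF that]] by blast
    show "v = 0" if "a \<in> ball p d" "l \<in> ball l0 d" "frechet_derivative F (at (a, l)) (v, 0) = 0" for a l v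
    proof -
      have "B * norm v \<le> B / 2 * norm v"
        using bd[OF that(1,2), of v] B(2)[of v] that(3) by (simp add: D_def)
      then show ?thesis using B(1) by (simp add: mult_le_cancel_right)
    qed
    show "a = b" if ab: "a \<in> ball p d" "b \<in> ball p d" "l \<in> ball l0 d" "F (a, l) = F (b, l)" for a b l
    proof -
      have der: "((\<lambda>x. F (x, l) - T x) has_derivative (\<lambda>v. D (x, l) v - T v)) (at x within ball p d)"
        if "x \<in> ball p d" for x
      proof (rule has_derivative_at_withinI, rule has_derivative_diff)
        show "((\<lambda>x. F (x, l)) has_derivative D (x, l)) (at x)"
          using d0(2)[OF near[OF that ab(3)]] by (intro D) blast
        show "(T has_derivative T) (at x)" using linT by (rule linear_imp_has_derivative)
      qed
      have "norm ((F (a, l) - T a) - (F (b, l) - T b)) \<le> B / 2 * norm (a - b)"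
      proof (rule differentiable_bound[OF convex_ball der])
        show "onorm (\<lambda>v. D (x, l) v - T v) \<le> B / 2" if "x \<in> ball p d" for x
          by (rule onorm_le) (rule bd[OF that ab(3)])
      qed (use ab in auto)
      then have "norm (T (b - a)) \<le> B / 2 * norm (a - b)"
        using ab(4) by (simp add: linear_diff[OF linT] norm_minus_commute)
      then have "B * norm (a - b) \<le> B / 2 * norm (a - b)"
        using B(2)[of "b - a"] by (simp add: norm_minus_commute)
      then show ?thesis using B(1) by (simp add: mult_le_cancel_right)
    qed
  qed
qed

text \<open>The set where \<open>Q\<close> holds locally is open and contains the zeros of
  \<open>r\<close>; on the compact remainder \<open>r\<close> has a positive minimum. With
  \<open>r\<close> a defining function of the boundary, this turns statements at the boundary into
  statements on a collar.\<close>

lemma compact_near_zero_set: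
  fixes r :: "'a::metric_space \<Rightarrow> real"
  assumes K: "compact K" and r: "continuous_on K r" "\<And>x. x \<in> K \<Longrightarrow> 0 \<le> r x"
    and Q: "\<And>x. x \<in> K \<Longrightarrow> r x = 0 \<Longrightarrow> \<exists>S. open S \<and> x \<in> S \<and> (\<forall>y\<in>K \<inter> S. Q y)"
  shows "\<exists>\<epsilon>>0. \<forall>y\<in>K. r y < \<epsilon> \<longrightarrow> Q y"
proof -
  define S where "S = \<Union>{S. open S \<and> (\<forall>y\<in>K \<inter> S. Q y)}"
  have S: "open S" "\<And>y. y \<in> K \<Longrightarrow> y \<in> S \<Longrightarrow> Q y" "\<And>x. x \<in> K \<Longrightarrow> r x = 0 \<Longrightarrow> x \<in> S"
    using Q unfolding S_def by auto
  have cp: "compact (K - S)" using K S(1) by (rule compact_diff)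
  show ?thesis
  proof (cases "K - S = {}")
    case True
    then show ?thesis using S(2) by (intro exI[of _ 1]) auto
  next
    case False
    obtain x where x: "x \<in> K - S" "\<And>y. y \<in> K - S \<Longrightarrow> r x \<le> r y"
      using continuous_attains_inf[OF cp False continuous_on_subset[OF r(1)]] by auto
    have "r x > 0" using x(1) r(2)[of x] S(3)[of x] by force
    then show ?thesis using x(2) S(2) by (intro exI[of _ "r x"]) force
  qed
qed

text \<open>\<open>A\<close> is the page, embedded in the unit sphere, \<open>B\<close> its boundary, \<open>R\<close> a defining function of the
  boundary, \<open>e (a, t)\<close> the point of the mapping torus with coordinates \<open>a\<close> and \<open>t\<close>, so that
  \<open>e (a, 1)\<close> is the image of \<open>a\<close> under the monodromy, and \<open>E (b, z)\<close> the point of the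
  neighbourhood of the binding with coordinates \<open>b\<close> and \<open>z\<close>. All maps are extended arbitrarily to
  the ambient Euclidean spaces.\<close>

locale spinning =
  fixes A B W :: "'f::euclidean_space set" and R :: "'f \<Rightarrow> real"
    and e :: "'f \<times> real \<Rightarrow> 'f" and E :: "'f \<times> complex \<Rightarrow> 'f" and P :: "'f \<Rightarrow> 'f"
  assumes compact_A: "compact A" and B_A: "B \<subseteq> A"
    and Cinf_R: "Cinf UNIV R" and R_bounds: "a \<in> A \<Longrightarrow> 0 \<le> R a" "a \<in> A \<Longrightarrow> R a \<le> 1 / 2"
    and R_eq_0: "a \<in> A \<Longrightarrow> R a = 0 \<longleftrightarrow> a \<in> B"
    and Cinf_e: "Cinf UNIV e" and norm_e: "a \<in> A \<Longrightarrow> t \<in> {0..1} \<Longrightarrow> norm (e (a, t)) = 1"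
    and e_left_inverse: "t \<in> {0..1} \<Longrightarrow> \<exists>L. Cinf UNIV L \<and> (\<forall>a\<in>A. L (e (a, t)) = a)"
    and e_0: "a \<in> A \<Longrightarrow> e (a, 0) = a" and e_1: "a \<in> A \<Longrightarrow> e (a, 1) \<in> A"
    and W: "open W" "B \<subseteq> W" "a \<in> A \<Longrightarrow> a \<in> W \<Longrightarrow> e (a, 1) = a"
    and Cinf_E: "Cinf UNIV E" and norm_E: "b \<in> B \<Longrightarrow> norm z \<le> 1 \<Longrightarrow> norm (E (b, z)) = 1"
    and e_eq_E: "b \<in> B \<Longrightarrow> t \<in> {0..1} \<Longrightarrow> e (b, t) = E (b, cis (2 * pi * t))"
    and Cinf_P: "Cinf UNIV P" and P_E: "b \<in> B \<Longrightarrow> norm z \<le> 1 \<Longrightarrow> P (E (b, z)) = b"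
    and regular: "p \<in> B \<Longrightarrow> \<exists>U G. p \<in> U \<and> Cinf U (G :: 'f \<Rightarrow> 'f) \<and> (\<forall>a\<in>A \<inter> U. G a = 0) \<and>
        (\<forall>v. frechet_derivative G (at p) v = 0 \<longrightarrow> v \<in> tang A p)"
    and tang_B: "p \<in> B \<Longrightarrow> v \<in> tang A p \<Longrightarrow> frechet_derivative R (at p) v = 0 \<Longrightarrow> v \<in> tang B p"
    and R_transverse: "p \<in> B \<Longrightarrow> \<exists>v\<in>tang A p. frechet_derivative R (at p) v \<noteq> 0"
begin

text \<open>The pair \<open>(m, s)\<close> runs along an L-shaped path from \<open>(0, 1)\<close>
  over \<open>(1, 1)\<close> to \<open>(1, 0)\<close>. It must not leave the path: for
  \<open>m < 1\<close> the two terms of the deformation agree on the boundary only if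
  \<open>s = 1\<close>.\<close>

definition \<Lambda> :: "(real \<times> real \<times> real) set" where
  "\<Lambda> = {1} \<times> {0..1} \<times> {0..1} \<union> {0..1} \<times> {1} \<times> {0..1}"

text \<open>For \<open>m\<close> from \<open>0\<close> to \<open>1\<close> and \<open>s = 1\<close>, this deforms the page at angle \<open>t\<close> near its boundary to
  an extension of the inclusion of \<open>\<partial>V \<times> {cis (2 \<pi> t)}\<close>; for \<open>m = 1\<close> and \<open>s\<close> from \<open>1\<close> to \<open>0\<close> it
  is moved on to the binding, where \<open>t\<close> no longer matters.\<close>

definition \<Phi> :: "'f \<times> (real \<times> real \<times> real) \<Rightarrow> 'f" where
  "\<Phi> z = (case z of (a, m, s, t) \<Rightarrow> (1 - m) *\<^sub>R e (a, t) + m *\<^sub>R E (a, s *\<^sub>R cis (2 * pi * t)))"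

definition u :: "'f \<times> (real \<times> real \<times> real) \<Rightarrow> 'f" where
  "u z = sgn (\<Phi> z)"

lemma compact_\<Lambda>: "compact \<Lambda>"
  unfolding \<Lambda>_def by (intro compact_Un compact_Times) auto

lemma Cinf_\<Phi>: "Cinf UNIV \<Phi>"
proof -
  have "Cinf UNIV (\<lambda>z. (1 - fst (snd z)) *\<^sub>R e (fst z, snd (snd (snd z)))
      + fst (snd z) *\<^sub>R E (fst z, fst (snd (snd z)) *\<^sub>R cis (2 * pi * snd (snd (snd z)))))"
    by (intro Cinf_add Cinf_scaleR Cinf_diff Cinf_compose_UNIV[OF Cinf_e] Cinf_compose_UNIV[OF Cinf_E]
      Cinf_Pair Cinf_cis Cinf_mult Cinf_fst Cinf_snd Cinf_const Cinf_ident open_UNIV)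
  then show ?thesis by (rule Cinf_cong) (simp add: \<Phi>_def split_beta)
qed

lemma open_\<Phi>: "open {z. \<Phi> z \<noteq> 0}"
  by (intro open_Collect_neq Cinf_continuous_on[OF Cinf_\<Phi>] continuous_on_const)

lemma Cinf_u: "Cinf {z. \<Phi> z \<noteq> 0} u"
  unfolding u_def[abs_def] by (rule Cinf_sgn[OF Cinf_subset[OF Cinf_\<Phi> open_\<Phi>]]) auto

lemma \<Phi>_B:
  assumes "b \<in> B" "(m, s, t) \<in> \<Lambda>"
  shows "\<Phi> (b, m, s, t) = E (b, s *\<^sub>R cis (2 * pi * t))" "norm (s *\<^sub>R cis (2 * pi * t)) \<le> 1"
  using assms e_eq_E[of b t] by (auto simp: \<Phi>_def \<Lambda>_def algebra_simps)

text \<open>On the boundary the deformed map is a value of \<open>E\<close> of norm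
  \<open>1\<close>, so normalising changes nothing and \<open>P\<close> undoes it. Thus
  \<open>u\<close> embeds the boundary for every parameter in \<open>\<Lambda>\<close>.\<close>

lemma u_B:
  assumes "b \<in> B" "l \<in> \<Lambda>" shows "\<Phi> (b, l) \<noteq> 0" "P (u (b, l)) = b"
proof -
  obtain m s t where l: "l = (m, s, t)" by (cases l)
  have n: "norm (\<Phi> (b, l)) = 1" using \<Phi>_B[of b m s t] norm_E assms l by simp
  then show "\<Phi> (b, l) \<noteq> 0" by auto
  have "u (b, l) = \<Phi> (b, l)" using n by (simp add: u_def sgn_div_norm)
  then show "P (u (b, l)) = b" using \<Phi>_B[of b m s t] P_E assms l by simp
qed

text \<open>The map \<open>(R, u, G)\<close> has injective derivative in the first variable at a
  boundary point: the kernel of the derivative of \<open>G\<close> is tangent to \<open>A\<close>,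
  there the kernel of that of \<open>R\<close> is tangent to \<open>B\<close>, and on these vectors
  \<open>P\<close> inverts \<open>u\<close>.\<close>

lemma local_embedding:
  assumes p: "p \<in> B" and l0: "l0 \<in> \<Lambda>"
  obtains d where "d > 0"
    "\<And>a b l. a \<in> A \<Longrightarrow> b \<in> A \<Longrightarrow> a \<in> ball p d \<Longrightarrow> b \<in> ball p d \<Longrightarrow> l \<in> ball l0 d \<Longrightarrow>
       R a = R b \<Longrightarrow> u (a, l) = u (b, l) \<Longrightarrow> a = b"
    "\<And>a l v. a \<in> A \<Longrightarrow> a \<in> ball p d \<Longrightarrow> l \<in> ball l0 d \<Longrightarrow> v \<in> tang A a \<Longrightarrow>
       frechet_derivative R (at a) v = 0 \<Longrightarrow> frechet_derivative u (at (a, l)) (v, 0) = 0 \<Longrightarrow> v = 0"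
proof -
  obtain U G where G: "p \<in> U" "Cinf U (G :: 'f \<Rightarrow> 'f)" "\<And>a. a \<in> A \<Longrightarrow> a \<in> U \<Longrightarrow> G a = 0"
    "\<And>v. frechet_derivative G (at p) v = 0 \<Longrightarrow> v \<in> tang A p"
    using regular[OF p] by (metis IntI)
  have oU: "open U" using G(2) by (rule Cinf_open)
  define V where "V = {z. \<Phi> z \<noteq> 0} \<inter> U \<times> UNIV"
  have V: "open V" unfolding V_def by (intro open_Int open_\<Phi> open_Times oU open_UNIV)
  \<comment> \<open>\<open>G\<close> vanishes on \<open>A\<close> and supplies injectivity in the
    directions transverse to \<open>A\<close>. The local injectivity lemma can therefore be applied
    on balls of the ambient space, and on \<open>A\<close> only \<open>R\<close> and
    \<open>u\<close> remain.\<close>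
  define F where "F z = (R (fst z), u z, G (fst z))" for z :: "'f \<times> (real \<times> real \<times> real)"
  have F: "Cinf V F" unfolding F_def[abs_def]
    by (intro Cinf_Pair Cinf_compose_UNIV[OF Cinf_R] Cinf_fst Cinf_ident V Cinf_subset[OF Cinf_u] 
       Cinf_compose[OF _ G(2)]) (auto simp: V_def)
  have DF: "frechet_derivative F (at (a, l)) (v, 0) =
      (frechet_derivative R (at a) v, frechet_derivative u (at (a, l)) (v, 0), frechet_derivative G (at a) v)"
    if "(a, l) \<in> V" for a l v
  proof -
    have z: "(a, l) \<in> {z. \<Phi> z \<noteq> 0}" "a \<in> U" using that by (auto simp: V_def)
    have "((\<lambda>x. (R x, u (x, l), G x)) has_derivative (\<lambda>v. (frechet_derivative R (at a) v,
        frechet_derivative u (at (a, l)) (v, 0), frechet_derivative G (at a) v))) (at a)"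
      by (intro has_derivative_Pair Cinf_partial[OF Cinf_u z(1)] Cinf_has_derivative[OF G(2) z(2)]
         Cinf_has_derivative[OF Cinf_R]) auto
    from has_derivative_unique[OF this] Cinf_partial[OF F that]
    show ?thesis by (auto simp: F_def fun_eq_iff)
  qed
  have pV: "(p, l0) \<in> V" using u_B[OF p l0] G(1) by (auto simp: V_def)
  have inj: "v = 0" if "frechet_derivative F (at (p, l0)) (v, 0) = 0" for v
  proof -
    have v: "frechet_derivative R (at p) v = 0" "frechet_derivative u (at (p, l0)) (v, 0) = 0"
       "frechet_derivative G (at p) v = 0"
      using that DF[OF pV] by (auto simp: zero_prod_def)
    have vB: "v \<in> tang B p" using tang_B[OF p G(4)[OF v(3)] v(1)] .
    have "((\<lambda>x. P (u (x, l0))) has_derivative (\<lambda>v. frechet_derivative P (at (u (p, l0))) (frechet_derivative u (at (p, l0)) (v, 0)))) (at p)"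
      by (rule has_derivative_compose[OF Cinf_partial[OF Cinf_u] Cinf_has_derivative[OF Cinf_P]])
        (use u_B[OF p l0] in auto)
    then have "frechet_derivative P (at (u (p, l0))) (frechet_derivative u (at (p, l0)) (v, 0)) = v"
      by (rule tang_unique[OF has_derivative_at_withinI has_derivative_ident open_UNIV _ p _ vB])
        (use u_B l0 in auto)
    then show "v = 0"
      using v(2) linear_0[OF has_derivative_linear[OF Cinf_has_derivative[OF Cinf_P]], of "u (p, l0)"] by simp
  qed
  obtain d where d: "d > 0" "\<And>a l. a \<in> ball p d \<Longrightarrow> l \<in> ball l0 d \<Longrightarrow> (a, l) \<in> V"
    "\<And>a b l. a \<in> ball p d \<Longrightarrow> b \<in> ball p d \<Longrightarrow> l \<in> ball l0 d \<Longrightarrow> F (a, l) = F (b, l) \<Longrightarrow> a = b"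
    "\<And>a l v. a \<in> ball p d \<Longrightarrow> l \<in> ball l0 d \<Longrightarrow> frechet_derivative F (at (a, l)) (v, 0) = 0 \<Longrightarrow> v = 0"
    using C1_uniformly_locally_injective[OF F pV inj] by blast
  show thesis
  proof (rule that[OF d(1)])
    show "a = b" if "a \<in> A" "b \<in> A" "a \<in> ball p d" "b \<in> ball p d" "l \<in> ball l0 d" "R a = R b" "u (a, l) = u (b, l)" for a b l
      using d(2)[of a l] d(2)[of b l] d(3)[of a b l] that G(3) by (simp add: F_def V_def)
    show "v = 0" if a: "a \<in> A" "a \<in> ball p d" "l \<in> ball l0 d" "v \<in> tang A a"
       "frechet_derivative R (at a) v = 0" "frechet_derivative u (at (a, l)) (v, 0) = 0" for a l v
    proof -
      have aU: "a \<in> U" using d(2)[OF a(2,3)] by (simp add: V_def)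
      have "frechet_derivative G (at a) v = 0"
        by (rule tang_unique[OF has_derivative_at_withinI[OF Cinf_has_derivative[OF G(2) aU]] has_derivative_const oU aU a(1) _ a(4)])
          (use G(3) in auto)
      then show ?thesis
        using DF[OF d(2)[OF a(2,3)], of v] a(5,6) by (intro d(4)[OF a(2,3)]) (simp add: zero_prod_def)
    qed
  qed
qed

text \<open>Each property holds near \<open>B\<close> for parameters near a given one; compactness
  of \<open>\<Lambda>\<close> and of \<open>A\<close> gives one \<open>\<epsilon>\<close> for all of
  them.\<close>

lemma collar:
  obtains \<epsilon> where "\<epsilon> > 0" "\<And>a. a \<in> A \<Longrightarrow> R a < \<epsilon> \<Longrightarrow> a \<in> W"
    "\<And>a l. a \<in> A \<Longrightarrow> R a < \<epsilon> \<Longrightarrow> l \<in> \<Lambda> \<Longrightarrow> \<Phi> (a, l) \<noteq> 0"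
    "\<And>a b l. a \<in> A \<Longrightarrow> b \<in> A \<Longrightarrow> R a < \<epsilon> \<Longrightarrow> R a = R b \<Longrightarrow> l \<in> \<Lambda> \<Longrightarrow> u (a, l) = u (b, l) \<Longrightarrow> a = b"
    "\<And>a l v. a \<in> A \<Longrightarrow> R a < \<epsilon> \<Longrightarrow> l \<in> \<Lambda> \<Longrightarrow> v \<in> tang A a \<Longrightarrow>
       frechet_derivative R (at a) v = 0 \<Longrightarrow> frechet_derivative u (at (a, l)) (v, 0) = 0 \<Longrightarrow> v = 0"
proof -
  have contR: "continuous_on S R" for S using Cinf_continuous_on[OF Cinf_R] continuous_on_subset by blast
  obtain \<epsilon>1 where 1: "\<epsilon>1 > 0" "\<And>a. a \<in> A \<Longrightarrow> R a < \<epsilon>1 \<Longrightarrow> a \<in> W"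
    using compact_near_zero_set[OF compact_A contR R_bounds(1), of "\<lambda>a. a \<in> W"] W(1,2) R_eq_0 by blast
  have cK: "compact (A \<times> \<Lambda>)" by (intro compact_Times compact_A compact_\<Lambda>)
  have rK: "continuous_on S (\<lambda>z. R (fst z))" for S :: "('f \<times> real \<times> real \<times> real) set"
    by (intro continuous_on_compose2[OF contR[of UNIV]] continuous_intros) auto
  have "\<exists>\<epsilon>>0. \<forall>y\<in>A \<times> \<Lambda>. R (fst y) < \<epsilon> \<longrightarrow> \<Phi> y \<noteq> 0"
  proof (rule compact_near_zero_set[OF cK rK])
    fix x assume "x \<in> A \<times> \<Lambda>" "R (fst x) = 0"
    then have "\<Phi> x \<noteq> 0" using u_B(1) R_eq_0 by (cases x) auto
    then show "\<exists>S. open S \<and> x \<in> S \<and> (\<forall>y\<in>A \<times> \<Lambda> \<inter> S. \<Phi> y \<noteq> 0)"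
      using open_\<Phi> by (intro exI[of _ "{z. \<Phi> z \<noteq> 0}"]) auto
  qed (use R_bounds in auto)
  then obtain \<epsilon>2 where 2: "\<epsilon>2 > 0" "\<And>a l. a \<in> A \<Longrightarrow> R a < \<epsilon>2 \<Longrightarrow> l \<in> \<Lambda> \<Longrightarrow> \<Phi> (a, l) \<noteq> 0" by force
  define Q where "Q z \<longleftrightarrow> (\<forall>v\<in>tang A (fst z). frechet_derivative R (at (fst z)) v = 0 \<longrightarrow>
      frechet_derivative u (at z) (v, 0) = 0 \<longrightarrow> v = 0)" for z :: "'f \<times> real \<times> real \<times> real"
  have "\<exists>\<epsilon>>0. \<forall>y\<in>A \<times> \<Lambda>. R (fst y) < \<epsilon> \<longrightarrow> Q y"
  proof (rule compact_near_zero_set[OF cK rK])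
    fix x assume x: "x \<in> A \<times> \<Lambda>" "R (fst x) = 0"
    obtain p l0 where p: "x = (p, l0)" "p \<in> B" "l0 \<in> \<Lambda>" using x R_eq_0 by (cases x) auto
    obtain d where d: "d > 0"
      "\<And>a l v. a \<in> A \<Longrightarrow> a \<in> ball p d \<Longrightarrow> l \<in> ball l0 d \<Longrightarrow> v \<in> tang A a \<Longrightarrow>
       frechet_derivative R (at a) v = 0 \<Longrightarrow> frechet_derivative u (at (a, l)) (v, 0) = 0 \<Longrightarrow> v = 0"
      using local_embedding[OF p(2,3)] by metis
    show "\<exists>S. open S \<and> x \<in> S \<and> (\<forall>y\<in>A \<times> \<Lambda> \<inter> S. Q y)"
      using d p by (intro exI[of _ "ball p d \<times> ball l0 d"]) (auto simp: Q_def open_Times)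
  qed (use R_bounds in auto)
  then obtain \<epsilon>3 where 3: "\<epsilon>3 > 0" "\<And>y. y \<in> A \<times> \<Lambda> \<Longrightarrow> R (fst y) < \<epsilon>3 \<Longrightarrow> Q y" by blast
  \<comment> \<open>Only pairs on a common level of \<open>R\<close> are compared, so both points
    approach the boundary together when \<open>R\<close> tends to zero.\<close>
  define K where "K = {z \<in> (A \<times> A) \<times> \<Lambda>. R (fst (fst z)) = R (snd (fst z))}"
  have "closed {z :: ('f \<times> 'f) \<times> real \<times> real \<times> real. R (fst (fst z)) = R (snd (fst z))}"
    by (intro closed_Collect_eq continuous_on_compose2[OF contR[of UNIV]] continuous_intros) auto
  then have cK2: "compact K" unfolding K_def Collect_conj_eq Collect_mem_eq
    by (intro compact_Int_closed compact_Times compact_A compact_\<Lambda>)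
  define Q2 where "Q2 z \<longleftrightarrow> (u (fst (fst z), snd z) = u (snd (fst z), snd z) \<longrightarrow> fst (fst z) = snd (fst z))"
    for z :: "('f \<times> 'f) \<times> real \<times> real \<times> real"
  have "\<exists>\<epsilon>>0. \<forall>y\<in>K. R (fst (fst y)) < \<epsilon> \<longrightarrow> Q2 y"
  proof (rule compact_near_zero_set[OF cK2])
    show "continuous_on K (\<lambda>x. R (fst (fst x)))"
      by (intro continuous_on_compose2[OF contR[of UNIV]] continuous_intros) auto
    show "0 \<le> R (fst (fst x))" if "x \<in> K" for x using that R_bounds by (auto simp: K_def)
    fix x assume x: "x \<in> K" "R (fst (fst x)) = 0"
    obtain p q l0 where p: "x = ((p, q), l0)" "p \<in> B" "q \<in> B" "l0 \<in> \<Lambda>"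
      using x R_eq_0 by (cases x) (auto simp: K_def)
    show "\<exists>S. open S \<and> x \<in> S \<and> (\<forall>y\<in>K \<inter> S. Q2 y)"
    proof (cases "p = q")
      case True
      obtain d where d: "d > 0" "\<And>a b l. a \<in> A \<Longrightarrow> b \<in> A \<Longrightarrow> a \<in> ball p d \<Longrightarrow> b \<in> ball p d \<Longrightarrow> l \<in> ball l0 d \<Longrightarrow>
         R a = R b \<Longrightarrow> u (a, l) = u (b, l) \<Longrightarrow> a = b"
        using local_embedding[OF p(2,4)] by metis
      show ?thesis
        using d p True by (intro exI[of _ "(ball p d \<times> ball p d) \<times> ball l0 d"])
          (auto simp: Q2_def K_def open_Times)
    next
      case False
      \<comment> \<open>Distinct boundary points have distinct images because \<open>P\<close>
        separates them, and by continuity the images stay distinct nearby. Local injectivity handles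
        the diagonal only.\<close>
      define g where "g z = u (fst (fst z), snd z) - u (snd (fst z), snd z)" for z :: "('f \<times> 'f) \<times> real \<times> real \<times> real"
      define S where "S = {z :: ('f \<times> 'f) \<times> real \<times> real \<times> real. \<Phi> (fst (fst z), snd z) \<noteq> 0 \<and> \<Phi> (snd (fst z), snd z) \<noteq> 0}"
      have oS: "open S" unfolding S_def
        by (intro open_Collect_conj open_Collect_neq continuous_on_compose2[OF Cinf_continuous_on[OF Cinf_\<Phi>]] continuous_intros) auto
      have "continuous_on S g" unfolding g_def
        by (intro continuous_intros continuous_on_compose2[OF Cinf_continuous_on[OF Cinf_u]]) (auto simp: S_def)
      then have op: "open (S \<inter> g -` (- {0}))"
        using oS by (intro continuous_open_preimage) auto
      have "x \<in> S" using u_B(1) p by (simp add: S_def)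
      moreover have "u (p, l0) \<noteq> u (q, l0)" using u_B(2)[OF p(2,4)] u_B(2)[OF p(3,4)] False by auto
      ultimately show ?thesis using op p by (intro exI[of _ "S \<inter> g -` (- {0})"]) (auto simp: g_def Q2_def)
    qed
  qed
  then obtain \<epsilon>4 where 4: "\<epsilon>4 > 0" "\<And>y. y \<in> K \<Longrightarrow> R (fst (fst y)) < \<epsilon>4 \<Longrightarrow> Q2 y" by blast
  show thesis
  proof (rule that[of "min (min \<epsilon>1 \<epsilon>2) (min \<epsilon>3 \<epsilon>4)"])
    show "a = b" if "a \<in> A" "b \<in> A" "R a < min (min \<epsilon>1 \<epsilon>2) (min \<epsilon>3 \<epsilon>4)" "R a = R b" "l \<in> \<Lambda>" "u (a, l) = u (b, l)" for a b l
      using 4(2)[of "((a, b), l)"] that by (simp add: K_def Q2_def)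
    show "v = 0" if "a \<in> A" "R a < min (min \<epsilon>1 \<epsilon>2) (min \<epsilon>3 \<epsilon>4)" "l \<in> \<Lambda>" "v \<in> tang A a"
       "frechet_derivative R (at a) v = 0" "frechet_derivative u (at (a, l)) (v, 0) = 0" for a l v
      using 3(2)[of "(a, l)"] that by (simp add: Q_def)
  qed (use 1 2 3 4 in auto)
qed

text \<open>The conclusions are the ingredients of proper embeddings and of an isotopy relative to
  the boundary, expressed by ambient derivatives; the last one closes up the family by the
  monodromy.\<close>

lemma spun_family:
  obtains H :: "'f \<times> real \<Rightarrow> 'f" and O' where "Cinf O' H" "A \<times> {0..1} \<subseteq> O'"
    "\<And>t. t \<in> {0..1} \<Longrightarrow> inj_on (\<lambda>a. H (a, t)) A"
    "\<And>a t. a \<in> A \<Longrightarrow> t \<in> {0..1} \<Longrightarrow> norm (H (a, t)) \<le> 1"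
    "\<And>a t. a \<in> A \<Longrightarrow> t \<in> {0..1} \<Longrightarrow> norm (H (a, t)) = 1 \<longleftrightarrow> a \<in> B"
    "\<And>a t v. a \<in> A \<Longrightarrow> t \<in> {0..1} \<Longrightarrow> v \<in> tang A a \<Longrightarrow> frechet_derivative H (at (a, t)) (v, 0) = 0 \<Longrightarrow> v = 0"
    "\<And>a t. a \<in> B \<Longrightarrow> t \<in> {0..1} \<Longrightarrow> \<exists>v\<in>tang A a. H (a, t) \<bullet> frechet_derivative H (at (a, t)) (v, 0) \<noteq> 0"
    "\<And>a t. a \<in> B \<Longrightarrow> t \<in> {0..1} \<Longrightarrow> H (a, t) = H (a, 0)"
    "\<And>a. a \<in> A \<Longrightarrow> H (a, 1) = H (e (a, 1), 0)"
proof -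
  obtain \<epsilon> where \<epsilon>: "\<epsilon> > 0" "\<And>a. a \<in> A \<Longrightarrow> R a < \<epsilon> \<Longrightarrow> a \<in> W"
    "\<And>a l. a \<in> A \<Longrightarrow> R a < \<epsilon> \<Longrightarrow> l \<in> \<Lambda> \<Longrightarrow> \<Phi> (a, l) \<noteq> 0"
    "\<And>a b l. a \<in> A \<Longrightarrow> b \<in> A \<Longrightarrow> R a < \<epsilon> \<Longrightarrow> R a = R b \<Longrightarrow> l \<in> \<Lambda> \<Longrightarrow> u (a, l) = u (b, l) \<Longrightarrow> a = b"
    "\<And>a l v. a \<in> A \<Longrightarrow> R a < \<epsilon> \<Longrightarrow> l \<in> \<Lambda> \<Longrightarrow> v \<in> tang A a \<Longrightarrow>
       frechet_derivative R (at a) v = 0 \<Longrightarrow> frechet_derivative u (at (a, l)) (v, 0) = 0 \<Longrightarrow> v = 0"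
    by (rule collar) (rule that)
  \<comment> \<open>As \<open>r\<close> falls from \<open>2 * \<epsilon> / 3\<close> to
    \<open>\<epsilon> / 3\<close>, the first entry \<open>m\<close> rises from \<open>0\<close> to
    \<open>1\<close> while \<open>s = 1\<close>; as \<open>r\<close> falls on to \<open>0\<close>,
    the second entry \<open>s\<close> drops to \<open>0\<close> while \<open>m = 1\<close>. So the
    values stay in \<open>\<Lambda>\<close>.\<close>
  define \<kappa> where "\<kappa> r t = (1 - smooth_step (3 * r / \<epsilon> - 1), smooth_step (3 * r / \<epsilon>), t)" for r t :: real
  have \<kappa>_in: "\<kappa> r t \<in> \<Lambda>" if "t \<in> {0..1}" for r t
  proof (cases "3 * r / \<epsilon> \<le> 1")
    case True
    then have "smooth_step (3 * r / \<epsilon> - 1) = 0" by (intro smooth_step_eq_0) simp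
    then show ?thesis using that by (simp add: \<kappa>_def \<Lambda>_def smooth_step_nonneg smooth_step_le_1)
  next
    case False
    then have "smooth_step (3 * r / \<epsilon>) = 1" by (intro smooth_step_eq_1) simp
    then show ?thesis using that by (simp add: \<kappa>_def \<Lambda>_def smooth_step_nonneg smooth_step_le_1)
  qed
  have \<kappa>_far: "fst (\<kappa> r t) = 0" if "r > 2 * \<epsilon> / 3" for r t
    using that \<epsilon>(1) by (simp add: \<kappa>_def smooth_step_eq_1 field_simps)
  have \<kappa>_0: "\<kappa> 0 t = (1, 0, t)" for t by (simp add: \<kappa>_def smooth_step_eq_0)
  have Cinf_\<kappa>: "Cinf S (\<lambda>x. \<kappa> (f x) (g x))" if "Cinf S f" "Cinf S g" for S f g
  proof -
    have "Cinf S (\<lambda>x. (1 - smooth_step (3 * inverse \<epsilon> * f x - 1), smooth_step (3 * inverse \<epsilon> * f x), g x))"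
      by (intro Cinf_Pair Cinf_diff Cinf_smooth_step Cinf_mult Cinf_const that Cinf_open[OF that(1)])
    then show ?thesis by (rule Cinf_cong) (simp add: \<kappa>_def divide_inverse mult_ac)
  qed
  define k where "k z = u (fst z, \<kappa> (R (fst z)) (snd z))" for z
  \<comment> \<open>\<open>R\<close> itself need not be invariant under the monodromy. The
    interpolation makes the radius at time \<open>1\<close> equal to the radius at time
    \<open>0\<close> of the image point; in the collar it is just \<open>R\<close>.\<close>
  define \<rho> where "\<rho> z = (1 - snd z) * R (fst z) + snd z * R (e (fst z, 1))" for z
  define H where "H z = (1 - \<rho> z) *\<^sub>R k z" for z
  define O' where "O' = {z. \<Phi> (fst z, \<kappa> (R (fst z)) (snd z)) \<noteq> 0}"
  have Cinf_pt: "Cinf UNIV (\<lambda>z. (fst z, \<kappa> (R (fst z)) (snd z)))"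
    by (intro Cinf_Pair Cinf_\<kappa> Cinf_compose_UNIV[OF Cinf_R] Cinf_fst Cinf_snd Cinf_ident open_UNIV)
  have O': "open O'" unfolding O'_def
    by (intro open_Collect_neq Cinf_continuous_on[OF Cinf_compose_UNIV[OF Cinf_\<Phi> Cinf_pt]] continuous_on_const)
  have Cinf_k: "Cinf O' k" unfolding k_def
    by (rule Cinf_compose[OF Cinf_subset[OF Cinf_pt O'] Cinf_u]) (auto simp: O'_def)
  have Cinf_\<rho>: "Cinf UNIV \<rho>" unfolding \<rho>_def
    by (intro Cinf_add Cinf_mult Cinf_diff Cinf_compose_UNIV[OF Cinf_R] Cinf_compose_UNIV[OF Cinf_e]
        Cinf_Pair Cinf_fst Cinf_snd Cinf_const Cinf_ident open_UNIV)
  have Cinf_H: "Cinf O' H" unfolding H_def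
    by (intro Cinf_scaleR Cinf_diff Cinf_const Cinf_k O' Cinf_subset[OF Cinf_\<rho>]) auto
  \<comment> \<open>The bend ends at \<open>2 * \<epsilon> / 3\<close>, strictly before
    \<open>\<epsilon>\<close>. At points with \<open>\<epsilon> \<le> R a\<close> the undeformed
    formula thus holds on a whole neighbourhood and may be differentiated.\<close>
  have far: "\<Phi> (a, \<kappa> (R a) t) = e (a, t)" if "R a > 2 * \<epsilon> / 3" for a t
    using \<kappa>_far[OF that, of t] by (simp add: \<Phi>_def \<kappa>_def split_beta)
  have k_far: "k (a, t) = e (a, t)" if "a \<in> A" "t \<in> {0..1}" "R a > 2 * \<epsilon> / 3" for a t
    using far[OF that(3), of t] norm_e[OF that(1,2)] by (simp add: k_def u_def sgn_div_norm)
  have in_O': "(a, t) \<in> O'" if "a \<in> A" "t \<in> {0..1}" for a t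
  proof (cases "R a < \<epsilon>")
    case True
    then show ?thesis using \<epsilon>(3)[OF that(1) True \<kappa>_in[OF that(2)]] by (simp add: O'_def)
  next
    case False
    then have "R a > 2 * \<epsilon> / 3" using \<epsilon>(1) by simp
    then show ?thesis using far[of a t] norm_e[OF that] by (auto simp: O'_def)
  qed
  have norm_k: "norm (k (a, t)) = 1" if "a \<in> A" "t \<in> {0..1}" for a t
    using in_O'[OF that] by (simp add: k_def u_def O'_def norm_sgn)
  have \<rho>_near: "\<rho> (a, t) = R a" if "a \<in> A" "R a < \<epsilon>" for a t
    using W(3)[OF that(1) \<epsilon>(2)[OF that]] by (simp add: \<rho>_def algebra_simps)
  \<comment> \<open>The collar is fixed pointwise, so by injectivity of the monodromy no other point
    can be moved into it.\<close>
  have e1_far: "\<epsilon> \<le> R (e (a, 1))" if a: "a \<in> A" "\<epsilon> \<le> R a" for a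
  proof (rule ccontr)
    assume *: "\<not> \<epsilon> \<le> R (e (a, 1))"
    obtain L where L: "\<And>a. a \<in> A \<Longrightarrow> L (e (a, 1)) = a" using e_left_inverse[of 1] by auto
    have "e (e (a, 1), 1) = e (a, 1)" using * W(3) \<epsilon>(2) e_1[OF a(1)] by simp
    then have "e (a, 1) = a" using L[OF a(1)] L[OF e_1[OF a(1)]] by simp
    then show False using * a by simp
  qed
  have \<rho>_far: "\<epsilon> \<le> \<rho> (a, t)" if "a \<in> A" "t \<in> {0..1}" "\<epsilon> \<le> R a" for a t
  proof -
    have "(1 - t) * \<epsilon> + t * \<epsilon> \<le> \<rho> (a, t)"
      unfolding \<rho>_def using that e1_far[of a] by (auto intro!: add_mono mult_left_mono)
    then show ?thesis by (simp add: algebra_simps)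
  qed
  \<comment> \<open>The upper bound keeps the factor \<open>1 - \<rho>\<close> away from zero, so
    that scaling by it loses no information; this is why \<open>R\<close> is bounded by
    \<open>1 / 2\<close>.\<close>
  have \<rho>_bounds: "0 \<le> \<rho> (a, t)" "\<rho> (a, t) \<le> 1 / 2" if "a \<in> A" "t \<in> {0..1}" for a t
  proof -
    show "0 \<le> \<rho> (a, t)" unfolding \<rho>_def using that R_bounds e_1[of a] by auto
    have "\<rho> (a, t) \<le> (1 - t) * (1 / 2) + t * (1 / 2)"
      unfolding \<rho>_def fst_conv snd_conv
      using that R_bounds e_1[of a] by (intro add_mono mult_left_mono) auto
    then show "\<rho> (a, t) \<le> 1 / 2" by (simp add: field_simps)
  qed
  have \<rho>_0: "\<rho> (a, t) = 0 \<longleftrightarrow> a \<in> B" if "a \<in> A" "t \<in> {0..1}" for a t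
    using \<rho>_near[OF that(1), of t] \<rho>_far[OF that] R_eq_0[OF that(1)] \<epsilon>(1) by (cases "R a < \<epsilon>") auto
  have norm_H: "norm (H (a, t)) = 1 - \<rho> (a, t)" if "a \<in> A" "t \<in> {0..1}" for a t
    using \<rho>_bounds[OF that] norm_k[OF that] by (simp add: H_def)
  define k' where "k' a t v = frechet_derivative k (at (a, t)) (v, 0)" for a t v
  define \<rho>' where "\<rho>' a t v = frechet_derivative \<rho> (at (a, t)) (v, 0)" for a t v
  define H' where "H' a t v = frechet_derivative H (at (a, t)) (v, 0)" for a t v
  have dk: "((\<lambda>x. k (x, t)) has_derivative k' a t) (at a)" if "a \<in> A" "t \<in> {0..1}" for a t
    using Cinf_partial[OF Cinf_k in_O'[OF that]] by (simp add: k'_def[abs_def])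
  have d\<rho>: "((\<lambda>x. \<rho> (x, t)) has_derivative \<rho>' a t) (at a)" for a t
    using Cinf_partial[OF Cinf_\<rho>, of a t] by (simp add: \<rho>'_def[abs_def])
  have dH: "((\<lambda>x. H (x, t)) has_derivative H' a t) (at a)" if "a \<in> A" "t \<in> {0..1}" for a t
    using Cinf_partial[OF Cinf_H in_O'[OF that]] by (simp add: H'_def[abs_def])
  have dR: "(R has_derivative frechet_derivative R (at a)) (at a)" for a
    using Cinf_has_derivative[OF Cinf_R] by simp
  have H'_eq: "H' a t v = (1 - \<rho> (a, t)) *\<^sub>R k' a t v - \<rho>' a t v *\<^sub>R k (a, t)" if "a \<in> A" "t \<in> {0..1}" for a t v
  proof -
    have "((\<lambda>x. (1 - \<rho> (x, t)) *\<^sub>R k (x, t)) has_derivative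
        (\<lambda>v. (1 - \<rho> (a, t)) *\<^sub>R k' a t v + (0 - \<rho>' a t v) *\<^sub>R k (a, t))) (at a)"
      by (intro has_derivative_scaleR has_derivative_diff has_derivative_const dk[OF that] d\<rho>)
    from has_derivative_unique[OF this, of "H' a t"] dH[OF that]
    show ?thesis by (simp add: H_def fun_eq_iff)
  qed
  \<comment> \<open>On \<open>A\<close> the norm of \<open>H\<close> is \<open>1 - \<rho>\<close>;
    differentiating its square along a tangent vector isolates the derivative of
    \<open>\<rho>\<close>. This serves both the immersion property and transversality.\<close>
  have radial: "H (a, t) \<bullet> H' a t v = - (1 - \<rho> (a, t)) * \<rho>' a t v"
    if at: "a \<in> A" "t \<in> {0..1}" and v: "v \<in> tang A a" for a t v
  proof -
    have 1: "((\<lambda>x. H (x, t) \<bullet> H (x, t)) has_derivative (\<lambda>v. H (a, t) \<bullet> H' a t v + H' a t v \<bullet> H (a, t))) (at a within A)"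
      by (rule has_derivative_at_withinI[OF has_derivative_inner[OF dH[OF at] dH[OF at]]])
    have 2: "((\<lambda>x. (1 - \<rho> (x, t)) * (1 - \<rho> (x, t))) has_derivative
      (\<lambda>v. (1 - \<rho> (a, t)) * (0 - \<rho>' a t v) + (0 - \<rho>' a t v) * (1 - \<rho> (a, t)))) (at a within A)"
      by (rule has_derivative_at_withinI, intro has_derivative_mult has_derivative_diff has_derivative_const d\<rho>)
    have "H (a, t) \<bullet> H' a t v + H' a t v \<bullet> H (a, t) =
       (1 - \<rho> (a, t)) * (0 - \<rho>' a t v) + (0 - \<rho>' a t v) * (1 - \<rho> (a, t))"
      by (rule tang_unique[OF 1 2 open_UNIV _ at(1) _ v])
        (use norm_H at(2) in \<open>auto simp: dot_square_norm power2_eq_square\<close>)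
    then show ?thesis by (simp add: inner_commute algebra_simps)
  qed
  have \<rho>'_near: "\<rho>' a t v = frechet_derivative R (at a) v"
    if "a \<in> A" "R a < \<epsilon>" "v \<in> tang A a" for a t v
  proof (rule tang_unique[OF has_derivative_at_withinI[OF d\<rho>] has_derivative_at_withinI[OF dR] _ _ that(1) _ that(3)])
    show "open {x. R x < \<epsilon>}"
      by (intro open_Collect_less Cinf_continuous_on[OF Cinf_R] continuous_on_const)
  qed (use that \<rho>_near in auto)
  have immersion: "v = 0" if at: "a \<in> A" "t \<in> {0..1}" and v: "v \<in> tang A a" and H'0: "H' a t v = 0" for a t v
  proof -
    have \<rho>1: "1 - \<rho> (a, t) \<noteq> 0" using \<rho>_bounds[OF at] by simp
    have \<rho>'0: "\<rho>' a t v = 0" using radial[OF at v] H'0 \<rho>1 by simp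
    have k'0: "k' a t v = 0" using H'_eq[OF at, of v] H'0 \<rho>'0 \<rho>1 by simp
    show "v = 0"
    proof (cases "R a < \<epsilon>")
      case True
      \<comment> \<open>Since the derivative of \<open>R\<close> kills \<open>v\<close>, the
        parameters \<open>\<kappa>\<close> are constant to first order along \<open>v\<close>, and
        the statement for constant parameters applies.\<close>
      have R'0: "frechet_derivative R (at a) v = 0" using \<rho>'_near[OF at(1) True v] \<rho>'0 by simp
      have "Cinf UNIV (\<lambda>r. \<kappa> r t)" by (intro Cinf_\<kappa> Cinf_ident Cinf_const open_UNIV)
      then obtain l' where l': "((\<lambda>r. \<kappa> r t) has_derivative l') (at (R a))"
        using Cinf_has_derivative by blast
      have 1: "((\<lambda>x. (x, \<kappa> (R x) t)) has_derivative (\<lambda>v. (v, l' (frechet_derivative R (at a) v)))) (at a)"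
        by (intro has_derivative_Pair has_derivative_ident has_derivative_compose[OF dR l'])
      have 2: "(u has_derivative frechet_derivative u (at (a, \<kappa> (R a) t))) (at (a, \<kappa> (R a) t))"
        using in_O'[OF at] by (intro Cinf_has_derivative[OF Cinf_u]) (simp add: O'_def)
      have "((\<lambda>x. k (x, t)) has_derivative (\<lambda>v. frechet_derivative u (at (a, \<kappa> (R a) t)) (v, l' (frechet_derivative R (at a) v)))) (at a)"
        using has_derivative_compose[OF 1, of u] 2 by (simp add: k_def)
      from fun_cong[OF has_derivative_unique[OF this dk[OF at]], of v]
      have "frechet_derivative u (at (a, \<kappa> (R a) t)) (v, l' 0) = 0" unfolding k'0 R'0 .
      then have "frechet_derivative u (at (a, \<kappa> (R a) t)) (v, 0) = 0"
        using linear_0[OF has_derivative_linear[OF l']] by simp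
      then show ?thesis by (rule \<epsilon>(5)[OF at(1) True \<kappa>_in[OF at(2)] v R'0])
    next
      case False
      \<comment> \<open>Here the page is not bent, and the left inverse \<open>L\<close> of the
        stage \<open>e (\<cdot>, t)\<close> detects \<open>v\<close>.\<close>
      then have Ra: "R a > 2 * \<epsilon> / 3" using \<epsilon>(1) by simp
      obtain L where L: "Cinf UNIV L" "\<And>a. a \<in> A \<Longrightarrow> L (e (a, t)) = a"
        using e_left_inverse[OF at(2)] by auto
      have "((\<lambda>x. L (k (x, t))) has_derivative (\<lambda>v. frechet_derivative L (at (k (a, t))) (k' a t v))) (at a)"
        by (rule has_derivative_compose[OF dk[OF at] Cinf_has_derivative[OF L(1)]]) simp
      then have "frechet_derivative L (at (k (a, t))) (k' a t v) = v"
      proof (rule tang_unique[OF has_derivative_at_withinI has_derivative_ident _ _ at(1) _ v])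
        show "open {x. 2 * \<epsilon> / 3 < R x}"
          by (intro open_Collect_less Cinf_continuous_on[OF Cinf_R] continuous_on_const)
      qed (use Ra L k_far at(2) in auto)
      then show ?thesis
        using k'0 linear_0[OF has_derivative_linear[OF Cinf_has_derivative[OF L(1)]], of "k (a, t)"] by simp
    qed
  qed
  show thesis
  proof (rule that[of O' H])
    show "Cinf O' H" by (rule Cinf_H)
    show "A \<times> {0..1} \<subseteq> O'" using in_O' by auto
    show "norm (H (a, t)) \<le> 1" "norm (H (a, t)) = 1 \<longleftrightarrow> a \<in> B" if "a \<in> A" "t \<in> {0..1}" for a t
      using norm_H[OF that] \<rho>_bounds[OF that] \<rho>_0[OF that] by auto
    show "v = 0" if "a \<in> A" "t \<in> {0..1}" "v \<in> tang A a" "frechet_derivative H (at (a, t)) (v, 0) = 0" for a t v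
      using immersion that by (simp add: H'_def)
    show "\<exists>v\<in>tang A a. H (a, t) \<bullet> frechet_derivative H (at (a, t)) (v, 0) \<noteq> 0" if aB: "a \<in> B" and t: "t \<in> {0..1}" for a t
    proof -
      have a: "a \<in> A" "R a < \<epsilon>" using aB B_A R_eq_0[of a] \<epsilon>(1) by auto
      obtain v where v: "v \<in> tang A a" "frechet_derivative R (at a) v \<noteq> 0" using R_transverse[OF aB] by blast
      have "H (a, t) \<bullet> H' a t v \<noteq> 0"
        using radial[OF a(1) t v(1)] \<rho>'_near[OF a v(1)] v(2) \<rho>_bounds[OF a(1) t] by simp
      then show ?thesis using v(1) by (auto simp: H'_def)
    qed
    show "H (a, t) = H (a, 0)" if "a \<in> B" "t \<in> {0..1}" for a t
    proof -
      have a: "a \<in> A" "R a = 0" using that(1) B_A R_eq_0[of a] by auto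
      then have "\<rho> (a, s) = 0" for s using \<rho>_near[of a s] \<epsilon>(1) by simp
      \<comment> \<open>At the boundary the parameters are \<open>(1, 0, t)\<close>, so the point is
        \<open>E (a, 0)\<close>, whatever \<open>t\<close> is.\<close>
      then show ?thesis using a by (simp add: H_def k_def \<kappa>_0 u_def \<Phi>_def)
    qed
    show "H (a, 1) = H (e (a, 1), 0)" if a: "a \<in> A" for a
    proof (cases "R a < \<epsilon>")
      case True
      then have "e (a, 1) = a" using W(3) \<epsilon>(2) a by blast
      \<comment> \<open>In the collar \<open>e (a, 1) = a = e (a, 0)\<close>, and \<open>cis\<close>
        has the same value at \<open>0\<close> and \<open>2 * pi\<close>, so the bent stages at
        times \<open>1\<close> and \<open>0\<close> agree.\<close>
      then show ?thesis using e_0[OF a] by (simp add: H_def \<rho>_def k_def u_def \<Phi>_def \<kappa>_def)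
    next
      case False
      have "R a > 2 * \<epsilon> / 3" "R (e (a, 1)) > 2 * \<epsilon> / 3" using False e1_far[OF a] \<epsilon>(1) by auto
      then have "k (a, 1) = e (a, 1)" "k (e (a, 1), 0) = e (a, 1)"
        using k_far[of a 1] k_far[of "e (a, 1)" 0] e_0 e_1 a by auto
      then show ?thesis by (simp add: H_def \<rho>_def)
    qed
    show "inj_on (\<lambda>a. H (a, t)) A" if t: "t \<in> {0..1}" for t
    proof (rule inj_onI)
      fix a b assume ab: "a \<in> A" "b \<in> A" "H (a, t) = H (b, t)"
      \<comment> \<open>Equal images have equal norms, hence equal radii. The radius tells whether a
        point lies in the collar, and there it gives equal values of \<open>R\<close> and with them
        equal parameters.\<close>
      have \<rho>_eq: "\<rho> (a, t) = \<rho> (b, t)" using norm_H[OF ab(1) t] norm_H[OF ab(2) t] ab(3) by simp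
      then have k_eq: "k (a, t) = k (b, t)" using ab(3) \<rho>_bounds[OF ab(1) t] by (simp add: H_def)
      show "a = b"
      proof (cases "R a < \<epsilon>")
        case True
        then have "R b < \<epsilon>" using \<rho>_near[OF ab(1) True, of t] \<rho>_far[OF ab(2) t] \<rho>_eq by linarith
        then have "R a = R b" using \<rho>_near[OF ab(1) True, of t] \<rho>_near[OF ab(2), of t] \<rho>_eq by simp
        then show ?thesis using \<epsilon>(4)[OF ab(1,2) True _ \<kappa>_in[OF t, of "R a"]] k_eq by (simp add: k_def)
      next
        case False
        then have "\<epsilon> \<le> R b" using \<rho>_near[OF ab(2), of t] \<rho>_far[OF ab(1) t] \<rho>_eq by linarith
        then have "e (a, t) = e (b, t)" using k_eq k_far[OF ab(1) t] k_far[OF ab(2) t] False \<epsilon>(1) by simp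
        moreover obtain L where "\<And>a. a \<in> A \<Longrightarrow> L (e (a, t)) = a" using e_left_inverse[OF t] by auto
        ultimately show ?thesis using ab by metis
      qed
    qed
  qed
qed

end

section \<open>Pages as compact subsets of Euclidean space\<close>

lemma smooth_on_has_derivative:
  assumes "smooth_on S f" "x \<in> S"
  obtains f' where "(f has_derivative f') (at x within S)"
proof -
  obtain W F where W: "x \<in> W" "Cinf W F" "\<forall>y\<in>S \<inter> W. F y = f y"
    using assms unfolding smooth_on_iff by metis
  obtain d where d: "d > 0" "ball x d \<subseteq> W" using W Cinf_open openE by metis
  have "(F has_derivative frechet_derivative F (at x)) (at x within S)"
    using Cinf_has_derivative[OF W(2,1)] by (rule has_derivative_at_withinI)
  then have "(f has_derivative frechet_derivative F (at x)) (at x within S)"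
    by (rule has_derivative_transform_within[OF _ d(1) assms(2)])
      (use W(3) d(2) in \<open>auto simp: subset_iff dist_commute\<close>)
  then show thesis by (rule that)
qed

text \<open>With a negative derivative, \<open>g\<close> would drop below zero shortly after the
  start of the segment.\<close>

lemma derivative_nonneg_along_segment:
  fixes g :: "'a::euclidean_space \<Rightarrow> real"
  assumes g: "(g has_derivative g') (at y within S)" and S: "\<And>t. 0 \<le> t \<Longrightarrow> t \<le> 1 \<Longrightarrow> y + t *\<^sub>R v \<in> S"
    and nn: "\<And>z. z \<in> S \<Longrightarrow> 0 \<le> g z" and g0: "g y = 0"
  shows "0 \<le> g' v"
proof (rule ccontr)
  assume neg: "\<not> 0 \<le> g' v"
  have "((\<lambda>t::real. y + t *\<^sub>R v) has_derivative (\<lambda>t. t *\<^sub>R v)) (at 0 within {0..1})"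
    by (auto intro!: derivative_eq_intros)
  moreover have "(g has_derivative g') (at (y + 0 *\<^sub>R v) within (\<lambda>t. y + t *\<^sub>R v) ` {0..1})"
    by (rule has_derivative_subset) (use g S in auto)
  ultimately have "(g \<circ> (\<lambda>t. y + t *\<^sub>R v) has_derivative g' \<circ> (\<lambda>t. t *\<^sub>R v)) (at 0 within {0..1})"
    by (rule diff_chain_within)
  moreover have "g' \<circ> (\<lambda>t. t *\<^sub>R v) = (\<lambda>t. g' v * t)"
    using has_derivative_linear[OF g] by (auto simp: linear_scale fun_eq_iff)
  ultimately have "(g \<circ> (\<lambda>t. y + t *\<^sub>R v) has_real_derivative g' v) (at 0 within {0..1})"
    by (simp add: has_field_derivative_def)
  from has_real_derivative_neg_dec_right[OF this] neg
  obtain d where d: "d > 0" "\<And>h. 0 < h \<Longrightarrow> h \<in> {0..1} \<Longrightarrow> h < d \<Longrightarrow> g (y + h *\<^sub>R v) < g y" by auto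
  define h where "h = min (d / 2) 1"
  have h: "0 < h" "h \<le> 1" "h < d" using d(1) by (auto simp: h_def min_def)
  then have "g (y + h *\<^sub>R v) < 0" using d(2)[of h] g0 by auto
  moreover have "0 \<le> g (y + h *\<^sub>R v)" using h by (intro nn S) auto
  ultimately show False by simp
qed

text \<open>A continuous injection of a compact space into a Hausdorff space is an embedding. Chart
  domains of the page thus become traces of open sets of the ambient space, as local smoothness
  requires.\<close>

lemma compact_embedding_open:
  fixes g :: "'a \<Rightarrow> 'f::metric_space"
  assumes "compact_space X" "continuous_map X euclidean g" "inj_on g (topspace X)" "openin X U"
  obtains O' where "open O'" "g ` U = g ` topspace X \<inter> O'"
proof -
  have "embedding_map X euclidean g"
    by (rule continuous_imp_embedding_map) (use assms Hausdorff_space_euclidean in auto)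
  then have "homeomorphic_map X (top_of_set (g ` topspace X)) g"
    by (simp add: embedding_map_def)
  then have "openin (top_of_set (g ` topspace X)) (g ` U)"
    using assms(4) homeomorphic_map_openness openin_subset by metis
  then show thesis using that by (auto simp: openin_open)
qed

lemma manifold_chart_at:
  assumes "manifold_with_boundary X" "x \<in> points X"
  obtains U c where "(U, c) \<in> charts X" "x \<in> U"
  using assms unfolding manifold_with_boundary_def by fastforce

text \<open>\<open>e'\<close> and \<open>E'\<close> are the maps of the two pieces of an open book into the sphere, the first one
  pulled back to \<open>V \<times> \<real>\<close>. That they are diffeomorphisms onto their images is expressed by smooth
  left inverses, read off in charts.\<close>

locale book_maps =
  fixes V :: "('a, 'e::euclidean_space) charted" and \<phi> :: "'a \<Rightarrow> 'a"
    and e' :: "'a \<times> real \<Rightarrow> 'f::euclidean_space" and E' :: "'a \<times> complex \<Rightarrow> 'f"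
  assumes page: "page_with_monodromy V \<phi>"
    and cont_e: "continuous_map (topo V) euclidean (\<lambda>x. e' (x, t))"
    and inj_e: "inj_on (\<lambda>x. e' (x, t)) (points V)"
    and norm_e': "x \<in> points V \<Longrightarrow> norm (e' (x, t)) = 1"
    and smooth_e': "(U, c) \<in> charts V \<Longrightarrow> smooth_on (c ` U \<times> UNIV) (\<lambda>(y, t). e' (inv_into U c y, t))"
    and smooth_e'_inverse: "(U, c) \<in> charts V \<Longrightarrow>
      \<exists>h. smooth_on ((\<lambda>x. e' (x, t)) ` U) h \<and> (\<forall>x\<in>U. h (e' (x, t)) = c x)"
    and e'_1: "x \<in> points V \<Longrightarrow> e' (x, 1) = e' (\<phi> x, 0)"
    and cont_E: "continuous_map (prod_topology (subtopology (topo V) (boundary V)) (top_of_set (cball 0 1))) euclidean E'"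
    and inj_E: "inj_on E' (boundary V \<times> cball 0 1)"
    and norm_E': "x \<in> boundary V \<Longrightarrow> norm z \<le> 1 \<Longrightarrow> norm (E' (x, z)) = 1"
    and smooth_E': "(U, c) \<in> charts V \<Longrightarrow>
      smooth_on (c ` (U \<inter> boundary V) \<times> cball 0 1) (\<lambda>(y, z). E' (inv_into U c y, z))"
    and smooth_E'_inverse: "(U, c) \<in> charts V \<Longrightarrow>
      \<exists>h. smooth_on (E' ` ((U \<inter> boundary V) \<times> cball 0 1)) h \<and>
        (\<forall>x\<in>U \<inter> boundary V. \<forall>z\<in>cball 0 1. h (E' (x, z)) = c x)"
    and e'_E': "x \<in> boundary V \<Longrightarrow> e' (x, t) = E' (x, cis (2 * pi * t))"
begin

lemma V: "manifold_with_boundary V" and compact_V: "compact_space (topo V)"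
  using page by (auto simp: page_with_monodromy_def)

text \<open>The page at angle \<open>0\<close> serves as the Euclidean model of \<open>V\<close>;
  \<open>j\<close> leads back to the abstract page.\<close>

definition \<iota> :: "'a \<Rightarrow> 'f" where "\<iota> x = e' (x, 0)"
definition j :: "'f \<Rightarrow> 'a" where "j = inv_into (points V) \<iota>"
definition A :: "'f set" where "A = \<iota> ` points V"
definition B :: "'f set" where "B = \<iota> ` boundary V"

lemma bd_points: "boundary V \<subseteq> points V" by (rule boundary_subset_points[OF V])

lemma inj_\<iota>: "inj_on \<iota> (points V)" using inj_e[of 0] by (simp add: \<iota>_def[abs_def])
lemma cont_\<iota>: "continuous_map (topo V) euclidean \<iota>" using cont_e[of 0] by (simp add: \<iota>_def[abs_def])
lemma j_\<iota>: "x \<in> points V \<Longrightarrow> j (\<iota> x) = x" by (simp add: j_def inj_\<iota>)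

lemma \<iota>_in_B: "x \<in> points V \<Longrightarrow> \<iota> x \<in> B \<longleftrightarrow> x \<in> boundary V"
  unfolding B_def using inj_on_image_mem_iff[OF inj_\<iota> _ bd_points] by blast

lemma compact_A: "compact A"
  using image_compactin[OF _ cont_\<iota>] compact_V by (simp add: A_def compact_space_def)

lemma compact_B: "compact B"
  using image_compactin[OF closedin_compact_space[OF compact_V closedin_boundary[OF V]] cont_\<iota>]
  by (simp add: B_def)

lemma chart_open:
  assumes "openin (topo V) U"
  obtains O' where "open O'" "\<iota> ` U = A \<inter> O'"
  using compact_embedding_open[OF compact_V cont_\<iota> inj_\<iota> assms] unfolding A_def by blast

lemma chart_smooth: "(U, c) \<in> charts V \<Longrightarrow> smooth_on (\<iota> ` U) (\<lambda>a. c (j a))"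
proof -
  assume U: "(U, c) \<in> charts V"
  obtain h where h: "smooth_on (\<iota> ` U) h" "\<And>x. x \<in> U \<Longrightarrow> h (\<iota> x) = c x"
    using smooth_e'_inverse[OF U, of 0] by (auto simp: \<iota>_def[abs_def])
  show "smooth_on (\<iota> ` U) (\<lambda>a. c (j a))"
    by (rule smooth_on_cong[OF h(1)]) (use h(2) manifold_chart(6)[OF V U] j_\<iota> in auto)
qed

lemma chart_inverse_smooth: "(U, c) \<in> charts V \<Longrightarrow> smooth_on (c ` U) (\<lambda>y. \<iota> (inv_into U c y))"
proof -
  assume U: "(U, c) \<in> charts V"
  have "smooth_on (c ` U) (\<lambda>y. case (y, 0) of (y, t) \<Rightarrow> e' (inv_into U c y, t))"
    by (rule smooth_on_compose[OF _ smooth_e'[OF U]]) (auto intro!: smooth_on_Pair smooth_on_id smooth_on_const)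
  then show ?thesis by (simp add: \<iota>_def)
qed

text \<open>In each chart the map is \<open>smooth_e'\<close> after the chart, which is smooth on
  the embedded page. These local descriptions fit together on the compact set
  \<open>A \<times> {0..1}\<close>, from which smooth maps extend.\<close>

lemma extend_e:
  obtains e where "Cinf UNIV e" "\<And>x t. x \<in> points V \<Longrightarrow> t \<in> {0..1} \<Longrightarrow> e (\<iota> x, t) = e' (x, t)"
proof -
  have "smooth_on (A \<times> {0..1}) (\<lambda>z. e' (j (fst z), snd z))"
  proof (rule smooth_on_local)
    fix z assume "z \<in> A \<times> {0..1::real}"
    then obtain x t where x: "x \<in> points V" "t \<in> {0..1}" "z = (\<iota> x, t)" by (auto simp: A_def)
    obtain U c where U: "(U, c) \<in> charts V" "x \<in> U" using manifold_chart_at[OF V x(1)] .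
    note Uc = manifold_chart[OF V U(1)]
    obtain O' where O': "open O'" "\<iota> ` U = A \<inter> O'" using chart_open[OF Uc(1)] .
    let ?S = "A \<times> {0..1::real} \<inter> O' \<times> UNIV"
    have "smooth_on ?S (\<lambda>z. (c (j (fst z)), snd z))"
      by (intro smooth_on_Pair smooth_on_snd smooth_on_id smooth_on_compose[OF _ chart_smooth[OF U(1)]] smooth_on_fst)
        (use O' in auto)
    then have "smooth_on ?S (\<lambda>z. case (c (j (fst z)), snd z) of (y, t) \<Rightarrow> e' (inv_into U c y, t))"
    proof (rule smooth_on_compose[OF _ smooth_e'[OF U(1)]])
      show "(\<lambda>z. (c (j (fst z)), snd z)) ` ?S \<subseteq> c ` U \<times> UNIV"
        using O'(2) Uc(6) j_\<iota> by (force simp: image_iff set_eq_iff)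
    qed
    then have "smooth_on ?S (\<lambda>z. e' (j (fst z), snd z))"
    proof (rule smooth_on_cong)
      fix z assume "z \<in> ?S"
      then have "fst z \<in> \<iota> ` U" unfolding O'(2) by auto
      then have "j (fst z) \<in> U" using j_\<iota> Uc(6) by auto
      then show "(case (c (j (fst z)), snd z) of (y, t) \<Rightarrow> e' (inv_into U c y, t)) = e' (j (fst z), snd z)"
        using Uc(3) by simp
    qed
    moreover have "z \<in> O' \<times> UNIV" using O'(2) U(2) x by auto
    ultimately show "\<exists>S. open S \<and> z \<in> S \<and> smooth_on (A \<times> {0..1} \<inter> S) (\<lambda>z. e' (j (fst z), snd z))"
      using O'(1) open_Times[OF O'(1) open_UNIV] by blast
  qed
  then obtain e where "Cinf UNIV e" "\<And>z. z \<in> A \<times> {0..1} \<Longrightarrow> e z = e' (j (fst z), snd z)"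
    using smooth_on_extend[of "A \<times> {0..1}"] compact_A compact_Times compact_Icc by blast
  then show thesis using that[of e] j_\<iota> by (auto simp: A_def)
qed

text \<open>The stage at angle \<open>t\<close> is compared with the one at angle \<open>0\<close>:
  the chart coordinate is smooth on the image of either, and compactness of the image allows the
  extension.\<close>

lemma left_inverse_e:
  obtains L where "Cinf UNIV L" "\<And>x. x \<in> points V \<Longrightarrow> L (e' (x, t)) = \<iota> x"
proof -
  let ?e = "\<lambda>x. e' (x, t)" and ?A = "(\<lambda>x. e' (x, t)) ` points V"
  let ?j = "inv_into (points V) ?e"
  have "smooth_on ?A (\<lambda>p. \<iota> (?j p))"
  proof (rule smooth_on_local)
    fix p assume "p \<in> ?A"
    then obtain x where x: "x \<in> points V" "p = ?e x" by auto
    obtain U c where U: "(U, c) \<in> charts V" "x \<in> U" using manifold_chart_at[OF V x(1)] .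
    note Uc = manifold_chart[OF V U(1)]
    obtain O' where O': "open O'" "?e ` U = ?A \<inter> O'"
      using compact_embedding_open[OF compact_V cont_e inj_e Uc(1)] by blast
    obtain h where h: "smooth_on (?e ` U) h" "\<And>x. x \<in> U \<Longrightarrow> h (?e x) = c x"
      using smooth_e'_inverse[OF U(1), of t] by blast
    have "smooth_on (?A \<inter> O') (\<lambda>p. \<iota> (inv_into U c (h p)))"
      unfolding O'(2)[symmetric] by (rule smooth_on_compose[OF h(1) chart_inverse_smooth[OF U(1)]]) (use h(2) in auto)
    then have "smooth_on (?A \<inter> O') (\<lambda>p. \<iota> (?j p))"
    proof (rule smooth_on_cong)
      fix p assume "p \<in> ?A \<inter> O'"
      then obtain y where "y \<in> U" "p = ?e y" unfolding O'(2)[symmetric] by auto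
      then show "\<iota> (inv_into U c (h p)) = \<iota> (?j p)"
        using h(2) Uc(3,6) inv_into_f_f[OF inj_e, of y] by auto
    qed
    then show "\<exists>S. open S \<and> p \<in> S \<and> smooth_on (?A \<inter> S) (\<lambda>p. \<iota> (?j p))"
      using O' U(2) x by blast
  qed
  moreover have "compact ?A"
    using image_compactin[OF _ cont_e] compact_V by (simp add: compact_space_def)
  ultimately obtain L where L: "Cinf UNIV L" "\<And>p. p \<in> ?A \<Longrightarrow> L p = \<iota> (?j p)"
    using smooth_on_extend by blast
  show thesis
  proof (rule that[OF L(1)])
    show "L (e' (x, t)) = \<iota> x" if "x \<in> points V" for x
      using L(2)[of "e' (x, t)"] inv_into_f_f[OF inj_e that, of t] that by simp
  qed
qed

text \<open>\<open>E'\<close> has meaning over the boundary only. The extension provides values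
  \<open>E (a, z)\<close> at points \<open>a\<close> of the page near the boundary as well, and
  these are what the bent page consists of.\<close>

lemma extend_E:
  obtains E where "Cinf UNIV E" "\<And>x z. x \<in> boundary V \<Longrightarrow> norm z \<le> 1 \<Longrightarrow> E (\<iota> x, z) = E' (x, z)"
proof -
  have "smooth_on (B \<times> cball 0 1) (\<lambda>z. E' (j (fst z), snd z))"
  proof (rule smooth_on_local)
    fix z assume "z \<in> B \<times> cball (0::complex) 1"
    then obtain x t where x: "x \<in> boundary V" "t \<in> cball 0 1" "z = (\<iota> x, t)" by (auto simp: B_def)
    then have "x \<in> points V" using bd_points by auto
    then obtain U c where U: "(U, c) \<in> charts V" "x \<in> U" using manifold_chart_at[OF V] by blast
    note Uc = manifold_chart[OF V U(1)]
    obtain O' where O': "open O'" "\<iota> ` U = A \<inter> O'" using chart_open[OF Uc(1)] .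
    let ?S = "B \<times> cball (0::complex) 1 \<inter> O' \<times> UNIV"
    have S: "j (fst z) \<in> U \<inter> boundary V" "fst z \<in> \<iota> ` U" if "z \<in> ?S" for z
    proof -
      obtain y where y: "y \<in> boundary V" "fst z = \<iota> y" using \<open>z \<in> ?S\<close> by (auto simp: B_def)
      then have "\<iota> y \<in> A \<inter> O'" using \<open>z \<in> ?S\<close> bd_points by (auto simp: A_def)
      then obtain y' where "y' \<in> U" "\<iota> y = \<iota> y'" unfolding O'(2)[symmetric] by auto
      then have "y \<in> U" using inj_onD[OF inj_\<iota>, of y y'] y(1) bd_points Uc(6) by auto
      then show "j (fst z) \<in> U \<inter> boundary V" "fst z \<in> \<iota> ` U" using j_\<iota> y bd_points by auto
    qed
    have "smooth_on ?S (\<lambda>z. (c (j (fst z)), snd z))"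
      by (intro smooth_on_Pair smooth_on_snd smooth_on_id smooth_on_compose[OF _ chart_smooth[OF U(1)]] smooth_on_fst)
        (blast intro: S(2))
    then have "smooth_on ?S (\<lambda>z. case (c (j (fst z)), snd z) of (y, t) \<Rightarrow> E' (inv_into U c y, t))"
      by (rule smooth_on_compose[OF _ smooth_E'[OF U(1)]]) (use S in auto)
    then have "smooth_on ?S (\<lambda>z. E' (j (fst z), snd z))"
    proof (rule smooth_on_cong)
      fix z assume "z \<in> ?S"
      then show "(case (c (j (fst z)), snd z) of (y, t) \<Rightarrow> E' (inv_into U c y, t)) = E' (j (fst z), snd z)"
        using S(1)[of z] Uc(3) by simp
    qed
    moreover have "z \<in> O' \<times> UNIV" using O'(2) U(2) x by auto
    ultimately show "\<exists>S. open S \<and> z \<in> S \<and> smooth_on (B \<times> cball 0 1 \<inter> S) (\<lambda>z. E' (j (fst z), snd z))"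
      using O'(1) open_Times[OF O'(1) open_UNIV] by blast
  qed
  then obtain E where E: "Cinf UNIV E" "\<And>z. z \<in> B \<times> cball 0 1 \<Longrightarrow> E z = E' (j (fst z), snd z)"
    using smooth_on_extend[of "B \<times> cball 0 1"] compact_B compact_Times compact_cball by blast
  have "E (\<iota> x, z) = E' (x, z)" if "x \<in> boundary V" "norm z \<le> 1" for x z
    using E(2)[of "(\<iota> x, z)"] that j_\<iota>[of x] bd_points by (auto simp: B_def)
  then show thesis using that[of E] E(1) by blast
qed

text \<open>On the neighbourhood of the binding this is the projection to the binding. Through it
  every stage of the bending is seen to be injective on the boundary.\<close>

lemma left_inverse_E:
  obtains P where "Cinf UNIV P" "\<And>x z. x \<in> boundary V \<Longrightarrow> norm z \<le> 1 \<Longrightarrow> P (E' (x, z)) = \<iota> x"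
proof -
  let ?X = "prod_topology (subtopology (topo V) (boundary V)) (top_of_set (cball (0::complex) 1))"
  have tX: "topspace ?X = boundary V \<times> cball 0 1" using bd_points by auto
  have cX: "compact_space ?X"
    using closedin_compact_space[OF compact_V closedin_boundary[OF V]] compactin_subspace
    by (auto simp: compact_space_prod_topology compact_space_subtopology)
  let ?A = "E' ` (boundary V \<times> cball 0 1)" and ?j = "inv_into (boundary V \<times> cball 0 1) E'"
  have "smooth_on ?A (\<lambda>p. \<iota> (fst (?j p)))"
  proof (rule smooth_on_local)
    fix p assume "p \<in> ?A"
    then obtain x z where x: "x \<in> boundary V" "z \<in> cball 0 1" "p = E' (x, z)" by auto
    then have "x \<in> points V" using bd_points by auto
    then obtain U c where U: "(U, c) \<in> charts V" "x \<in> U" using manifold_chart_at[OF V] by blast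
    note Uc = manifold_chart[OF V U(1)]
    have "openin ?X ((U \<inter> boundary V) \<times> cball 0 1)"
      using Uc(1) by (auto simp: openin_prod_Times_iff intro: openin_subtopology_Int)
    then obtain O' where O': "open O'" "E' ` ((U \<inter> boundary V) \<times> cball 0 1) = ?A \<inter> O'"
      using compact_embedding_open[OF cX cont_E, unfolded tX, OF inj_E] by metis
    obtain h where h: "smooth_on (E' ` ((U \<inter> boundary V) \<times> cball 0 1)) h"
        "\<And>x z. x \<in> U \<inter> boundary V \<Longrightarrow> z \<in> cball 0 1 \<Longrightarrow> h (E' (x, z)) = c x"
      using smooth_E'_inverse[OF U(1)] by blast
    have "smooth_on (?A \<inter> O') (\<lambda>p. \<iota> (inv_into U c (h p)))"
      unfolding O'(2)[symmetric] by (rule smooth_on_compose[OF h(1) chart_inverse_smooth[OF U(1)]]) (use h(2) in auto)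
    then have "smooth_on (?A \<inter> O') (\<lambda>p. \<iota> (fst (?j p)))"
    proof (rule smooth_on_cong)
      fix p assume "p \<in> ?A \<inter> O'"
      then obtain y w where y: "y \<in> U \<inter> boundary V" "w \<in> cball 0 1" "p = E' (y, w)" unfolding O'(2)[symmetric] by auto
      then have "?j p = (y, w)" using inv_into_f_f[OF inj_E, of "(y, w)"] by auto
      then show "\<iota> (inv_into U c (h p)) = \<iota> (fst (?j p))"
        using h(2)[OF y(1,2)] Uc(3) y by auto
    qed
    moreover have "p \<in> O'" using O'(2) U(2) x by blast
    ultimately show "\<exists>S. open S \<and> p \<in> S \<and> smooth_on (?A \<inter> S) (\<lambda>p. \<iota> (fst (?j p)))"
      using O'(1) by blast
  qed
  moreover have "compact ?A"
    using image_compactin[OF _ cont_E, of "topspace ?X"] cX unfolding tX compact_space_def by simp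
  ultimately obtain P where P: "Cinf UNIV P" "\<And>p. p \<in> ?A \<Longrightarrow> P p = \<iota> (fst (?j p))"
    using smooth_on_extend by blast
  show thesis
  proof (rule that[OF P(1)])
    show "P (E' (x, z)) = \<iota> x" if "x \<in> boundary V" "norm z \<le> 1" for x z
      using P(2)[of "E' (x, z)"] inv_into_f_f[OF inj_E, of "(x, z)"] that by auto
  qed
qed

text \<open>A chart and its inverse have mutually inverse derivatives between \<open>tang A\<close>
  and the model space. The derivative of the chart within \<open>A\<close> is determined on
  \<open>tang A\<close> only, hence the restriction in the first identity.\<close>

lemma chart_data:
  assumes U: "(U, c) \<in> charts V" and x: "x \<in> U"
  obtains O' c' \<psi>' where "open O'" "\<iota> x \<in> O'" "\<iota> ` U = A \<inter> O'"
    "((\<lambda>a. c (j a)) has_derivative c') (at (\<iota> x) within A)"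
    "((\<lambda>y. \<iota> (inv_into U c y)) has_derivative \<psi>') (at (c x) within c ` U)"
    "\<And>v. v \<in> tang A (\<iota> x) \<Longrightarrow> \<psi>' (c' v) = v" "\<And>w. c' (\<psi>' w) = w" "\<And>w. \<psi>' w \<in> tang A (\<iota> x)"
proof -
  note Uc = manifold_chart[OF V U]
  have xV: "x \<in> points V" using x Uc(6) by auto
  obtain O' where O': "open O'" "\<iota> ` U = A \<inter> O'" using chart_open[OF Uc(1)] .
  have xO: "\<iota> x \<in> O'" "\<iota> x \<in> A" using O'(2) x by auto
  obtain c' where "((\<lambda>a. c (j a)) has_derivative c') (at (\<iota> x) within \<iota> ` U)"
    using smooth_on_has_derivative[OF chart_smooth[OF U]] x by blast
  then have c': "((\<lambda>a. c (j a)) has_derivative c') (at (\<iota> x) within A)"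
    unfolding O'(2) at_within_Int_open[OF O'(1) xO(1)] .
  obtain \<psi>' where \<psi>': "((\<lambda>y. \<iota> (inv_into U c y)) has_derivative \<psi>') (at (c x) within c ` U)"
    using smooth_on_has_derivative[OF chart_inverse_smooth[OF U]] x by blast
  have inU: "\<exists>y\<in>U. a = \<iota> y \<and> j a = y" if "a \<in> A" "a \<in> O'" for a
  proof -
    have "a \<in> \<iota> ` U" using O'(2) that by auto
    then show ?thesis using j_\<iota> Uc(6) by auto
  qed
  have T: "tang (c ` U) (c x) = UNIV" using tang_model_open[OF Uc(2)] x by blast
  have c_im: "c (j a) \<in> c ` U" if "a \<in> A" "a \<in> O'" for a using inU[OF that] by auto
  have jx: "c (j (\<iota> x)) = c x" using j_\<iota>[OF xV] by simp
  have \<psi>x: "\<iota> (inv_into U c (c x)) = \<iota> x" using Uc(3) x by simp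
  have \<psi>A: "\<iota> (inv_into U c y) \<in> A" if "y \<in> c ` U" for y
    using that Uc(3,6) by (auto simp: A_def)
  have \<psi>T: "\<psi>' w \<in> tang A (\<iota> x)" for w
  proof -
    have "\<psi>' w \<in> tang A (\<iota> (inv_into U c (c x)))"
      by (rule tang_image[OF \<psi>' open_UNIV UNIV_I _ \<psi>A]) (simp_all add: x T)
    then show ?thesis unfolding \<psi>x .
  qed
  have 1: "\<psi>' (c' v) = v" if "v \<in> tang A (\<iota> x)" for v
  proof -
    have "((\<lambda>y. \<iota> (inv_into U c y)) \<circ> (\<lambda>a. c (j a)) has_derivative \<psi>' \<circ> c') (at (\<iota> x) within (A \<inter> O'))"
    proof (rule diff_chain_within)
      show "((\<lambda>a. c (j a)) has_derivative c') (at (\<iota> x) within A \<inter> O')"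
        using c' by (rule has_derivative_subset) auto
      show "((\<lambda>y. \<iota> (inv_into U c y)) has_derivative \<psi>') (at (c (j (\<iota> x))) within (\<lambda>a. c (j a)) ` (A \<inter> O'))"
        unfolding jx by (rule has_derivative_subset[OF \<psi>']) (use c_im in auto)
    qed
    then have "((\<lambda>y. \<iota> (inv_into U c y)) \<circ> (\<lambda>a. c (j a)) has_derivative \<psi>' \<circ> c') (at (\<iota> x) within A)"
      unfolding at_within_Int_open[OF O'(1) xO(1)] .
    then have "(\<psi>' \<circ> c') v = v"
    proof (rule tang_unique[OF _ has_derivative_ident O'(1) xO _ that])
      fix a assume "a \<in> A" "a \<in> O'"
      then show "((\<lambda>y. \<iota> (inv_into U c y)) \<circ> (\<lambda>a. c (j a))) a = a"
        using inU[of a] Uc(3) by auto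
    qed
    then show ?thesis by simp
  qed
  have 2: "c' (\<psi>' w) = w" for w
  proof -
    have "((\<lambda>a. c (j a)) \<circ> (\<lambda>y. \<iota> (inv_into U c y)) has_derivative c' \<circ> \<psi>') (at (c x) within c ` U)"
    proof (rule diff_chain_within[OF \<psi>'])
      show "((\<lambda>a. c (j a)) has_derivative c') (at (\<iota> (inv_into U c (c x))) within (\<lambda>y. \<iota> (inv_into U c y)) ` c ` U)"
        unfolding \<psi>x by (rule has_derivative_subset[OF c']) (use Uc(3,6) in \<open>auto simp: A_def\<close>)
    qed
    then have "(c' \<circ> \<psi>') w = w"
      by (rule tang_unique[OF _ has_derivative_ident open_UNIV])
        (use x T Uc(3,6) j_\<iota> in auto)
    then show ?thesis by simp
  qed
  show thesis by (rule that[OF O'(1) xO(1) O'(2) c' \<psi>' 1 2 \<psi>T])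
qed

lemma boundary_chart_at:
  assumes "x \<in> boundary V"
  obtains U c b where "(U, c) \<in> charts V" "x \<in> U" "b \<noteq> 0" "openin (top_of_set (half_space b)) (c ` U)"
    "c x \<bullet> b = 0" "\<And>y. y \<in> U \<Longrightarrow> y \<in> boundary V \<longleftrightarrow> c y \<bullet> b = 0"
proof -
  obtain U c b where U: "(U, c) \<in> charts V" "x \<in> U" "b \<noteq> 0" "openin (top_of_set (half_space b)) (c ` U)"
    "c x \<bullet> b = 0" using assms by (auto simp: boundary_def boundary_chart_def)
  then show thesis using that boundary_half_space_chart[OF V U(1,3,4)] by blast
qed

text \<open>Vectors pointing into the page, described by duality: every non-negative function that
  is zero at \<open>q\<close> has non-negative derivative along them. One such vector serves all
  local defining functions at once, whatever charts they come from, so nothing cancels in their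
  sum.\<close>

definition inward :: "'f \<Rightarrow> 'f \<Rightarrow> bool" where
  "inward q v \<longleftrightarrow> v \<in> tang A q \<and>
     (\<forall>h :: 'f \<Rightarrow> real. Cinf UNIV h \<longrightarrow> (\<forall>a\<in>A. 0 \<le> h a) \<longrightarrow> h q = 0 \<longrightarrow> 0 \<le> frechet_derivative h (at q) v)"

text \<open>In a half-space chart the height above the edge, cut off by a bump, has the required
  properties, with the normal \<open>b\<close> as inward direction. Near an interior point a bump
  alone will do.\<close>

lemma local_defining_function:
  assumes p: "p \<in> A"
  shows "\<exists>r O'. Cinf UNIV (r :: 'f \<Rightarrow> real) \<and> open O' \<and> p \<in> O' \<and> (\<forall>a\<in>A. 0 \<le> r a) \<and> (\<forall>a\<in>B. r a = 0) \<and>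
    (\<forall>a\<in>A \<inter> O'. a \<notin> B \<longrightarrow> 0 < r a) \<and> (\<forall>q\<in>B \<inter> O'. \<exists>v. inward q v \<and> 0 < frechet_derivative r (at q) v)"
proof -
  obtain x where x: "x \<in> points V" "p = \<iota> x" using p by (auto simp: A_def)
  obtain U c where U: "(U, c) \<in> charts V" "x \<in> U" using manifold_chart_at[OF V x(1)] .
  note Uc = manifold_chart[OF V U(1)]
  obtain O1 where O1: "open O1" "\<iota> ` U = A \<inter> O1" using chart_open[OF Uc(1)] .
  have pO1: "p \<in> O1" using O1(2) U(2) x by blast
  have inU: "\<exists>y\<in>U. a = \<iota> y \<and> j a = y \<and> y \<in> points V" if "a \<in> A" "a \<in> O1" for a
  proof -
    have "a \<in> \<iota> ` U" using O1(2) that by auto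
    then show ?thesis using j_\<iota> Uc(6) by auto
  qed
  consider (interior) "open (c ` U)" | (bd) b where "b \<noteq> 0" "openin (top_of_set (half_space b)) (c ` U)"
    using Uc(2) by (auto simp: model_open_def)
  then show ?thesis
  proof cases
    \<comment> \<open>The support of the bump fits into the chart domain, which contains no boundary
      point; the condition at points of \<open>B\<close> is therefore vacuous.\<close>
    case interior
    obtain s where s: "s > 0" "ball p s \<subseteq> O1" using O1(1) pO1 openE by metis
    define r where "r = s / 2"
    have r: "r > 0" "\<And>a. dist p a < 2 * r \<Longrightarrow> a \<in> O1" using s by (auto simp: r_def)
    have BU: "a \<notin> O1" if "a \<in> B" for a
    proof
      assume "a \<in> O1"
      moreover have "a \<in> A" using that bd_points by (auto simp: A_def B_def)
      ultimately obtain y where "y \<in> U" "a = \<iota> y" "y \<in> points V" using inU by blast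
      then show False using that \<iota>_in_B boundary_open_chart[OF V U(1) interior] by auto
    qed
    have B0: "bump p r a = 0" if "a \<in> B" for a
      using BU[OF that] r(2)[of a] by (intro bump_eq_0[OF r(1)]) (auto simp: not_less[symmetric])
    have pos: "0 < bump p r a" if "a \<in> ball p r" for a
      using bump_eq_1[OF r(1), of p a] that by simp
    show ?thesis
    proof (intro exI conjI)
      show "Cinf UNIV (bump p r)" by (rule Cinf_bump)
      show "open (ball p r)" "p \<in> ball p r" using r(1) by auto
      show "\<forall>q\<in>B \<inter> ball p r. \<exists>v. inward q v \<and> 0 < frechet_derivative (bump p r) (at q) v"
        using B0 pos by force
    qed (use B0 pos bump_nonneg in auto)
  next
    case bd
    obtain W C where C: "p \<in> W" "Cinf W C" "\<And>a. a \<in> \<iota> ` U \<Longrightarrow> a \<in> W \<Longrightarrow> C a = c (j a)"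
      using chart_smooth[OF U(1)] U(2) x(2) unfolding smooth_on_iff by (metis IntI imageI)
    have "open (W \<inter> O1)" using Cinf_open[OF C(2)] O1(1) by blast
    moreover have "p \<in> W \<inter> O1" using C(1) pO1 by blast
    ultimately obtain s where s: "s > 0" "cball p s \<subseteq> W \<inter> O1" using open_contains_cball by metis
    define \<delta> where "\<delta> = s / 2"
    have \<delta>: "\<delta> > 0" "cball p (2 * \<delta>) \<subseteq> W \<inter> O1" using s by (auto simp: \<delta>_def)
    define r where "r a = (if a \<in> W then bump p \<delta> a *\<^sub>R (C a \<bullet> b) else 0)" for a
    have Cr: "Cinf UNIV r" unfolding r_def[abs_def]
      by (intro Cinf_cutoff Cinf_inner C(2) Cinf_const Cinf_open[OF C(2)] \<delta>(1)) (use \<delta>(2) in auto)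
    have r_eq: "r a = bump p \<delta> a * (c (j a) \<bullet> b)" if "a \<in> A" "a \<in> O1" for a
    proof (cases "a \<in> W")
      case True
      then show ?thesis using C(3)[of a] O1(2) that by (simp add: r_def)
    next
      case False
      then have "a \<notin> cball p (2 * \<delta>)" using \<delta>(2) by auto
      then show ?thesis using bump_eq_0[OF \<delta>(1), of p a] False by (simp add: r_def)
    qed
    have r_far: "r a = 0" if "a \<notin> O1" for a
    proof -
      have "a \<notin> cball p (2 * \<delta>)" using \<delta>(2) that by auto
      then show ?thesis using bump_eq_0[OF \<delta>(1), of p a] by (simp add: r_def)
    qed
    have hs: "c y \<bullet> b \<ge> 0" if "y \<in> U" for y
      using openin_subset[OF bd(2)] that by (auto simp: half_space_def)
    note bdU = boundary_half_space_chart[OF V U(1) bd]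
    have nn: "0 \<le> r a" if aA: "a \<in> A" for a
    proof (cases "a \<in> O1")
      case True
      obtain y where y: "y \<in> U" "j a = y" using inU[OF aA True] by blast
      then show ?thesis using r_eq[OF aA True] hs[OF y(1)] bump_nonneg[of p \<delta> a] by simp
    qed (use r_far in auto)
    have r0: "r a = 0" if "a \<in> B" for a
    proof (cases "a \<in> O1")
      case True
      have aA: "a \<in> A" using that bd_points by (auto simp: A_def B_def)
      obtain y where y: "y \<in> U" "a = \<iota> y" "j a = y" "y \<in> points V" using inU[OF aA True] by blast
      then have "c y \<bullet> b = 0" using bdU \<iota>_in_B that by auto
      then show ?thesis using r_eq[OF aA True] y by simp
    qed (use r_far in auto)
    have pos: "0 < r a" if a: "a \<in> A" "a \<in> ball p \<delta>" "a \<notin> B" for a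
    proof -
      have aO: "a \<in> O1" using a(2) \<delta> by (auto simp: subset_iff)
      obtain y where y: "y \<in> U" "a = \<iota> y" "j a = y" "y \<in> points V" using inU[OF a(1) aO] by blast
      then have "c y \<bullet> b > 0" using bdU \<iota>_in_B[of y] a(3) hs[of y] by fastforce
      moreover have "bump p \<delta> a = 1" using bump_eq_1[OF \<delta>(1), of p a] a(2) by simp
      ultimately show ?thesis using r_eq[OF a(1) aO] y by simp
    qed
    have inw: "\<exists>v. inward q v \<and> 0 < frechet_derivative r (at q) v" if q: "q \<in> B" "q \<in> ball p \<delta>" for q
    proof -
      have qO: "q \<in> O1" using q(2) \<delta> by (auto simp: subset_iff)
      have qA: "q \<in> A" using q(1) bd_points by (auto simp: A_def B_def)
      obtain y where y: "y \<in> U" "q = \<iota> y" "j q = y" "y \<in> points V" using inU[OF qA qO] by blast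
      have yb: "c y \<bullet> b = 0" using bdU \<iota>_in_B q(1) y by auto
      obtain O' c' \<psi>' where cd: "((\<lambda>a. c (j a)) has_derivative c') (at (\<iota> y) within A)"
        "((\<lambda>y. \<iota> (inv_into U c y)) has_derivative \<psi>') (at (c y) within c ` U)"
        "\<And>w. c' (\<psi>' w) = w" "\<And>w. \<psi>' w \<in> tang A (\<iota> y)"
        using chart_data[OF U(1) y(1)] by metis
      obtain e where e: "e > 0" "ball (c y) e \<inter> half_space b \<subseteq> c ` U"
        using bd(2) y(1) unfolding openin_contains_ball by blast
      obtain s where s: "s > 0" "\<And>t. 0 \<le> t \<Longrightarrow> t \<le> 1 \<Longrightarrow> c y + t *\<^sub>R s *\<^sub>R b \<in> ball (c y) e"
        using small_multiple[OF e(1)] by metis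
      have seg: "c y + t *\<^sub>R s *\<^sub>R b \<in> c ` U" if "0 \<le> t" "t \<le> 1" for t
        using e(2) s(1) s(2)[OF that] yb that by (auto simp: half_space_def inner_add_left)
      have bsc: "\<psi>' b = inverse s *\<^sub>R \<psi>' (s *\<^sub>R b)"
        using has_derivative_linear[OF cd(2)] s(1) by (simp add: linear_scale)
      have "inward q (\<psi>' b)"
        unfolding inward_def
      proof (intro conjI allI impI)
        show "\<psi>' b \<in> tang A q" using cd(4) y by simp
        fix h :: "'f \<Rightarrow> real" assume h: "Cinf UNIV h" "\<forall>a\<in>A. 0 \<le> h a" "h q = 0"
        have hd: "(h has_derivative frechet_derivative h (at q)) (at q)" using Cinf_has_derivative[OF h(1)] by simp
        have "((\<lambda>z. h (\<iota> (inv_into U c z))) has_derivative (\<lambda>w. frechet_derivative h (at q) (\<psi>' w))) (at (c y) within c ` U)"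
          using has_derivative_compose[OF cd(2), of h "frechet_derivative h (at q)"] hd y Uc(3) by simp
        then have "0 \<le> frechet_derivative h (at q) (\<psi>' (s *\<^sub>R b))"
        proof (rule derivative_nonneg_along_segment)
          show "h (\<iota> (inv_into U c (c y))) = 0" using h(3) y Uc(3) by simp
          show "0 \<le> h (\<iota> (inv_into U c z))" if "z \<in> c ` U" for z
            using h(2) that Uc(3,6) by (auto simp: A_def)
        qed (rule seg)
        then show "0 \<le> frechet_derivative h (at q) (\<psi>' b)"
          unfolding bsc using s(1) has_derivative_linear[OF hd] by (simp add: linear_scale)
      qed
      \<comment> \<open>In the product rule the bump is \<open>1\<close> and the height is
        \<open>0\<close> at \<open>q\<close>, so only the derivative of the height survives, and
        along the normal it is \<open>b \<bullet> b\<close>.\<close>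
      moreover have "frechet_derivative r (at q) (\<psi>' b) = b \<bullet> b"
      proof -
        have rd: "(r has_derivative frechet_derivative r (at q)) (at q)" using Cinf_has_derivative[OF Cr] by simp
        have bdv: "(bump p \<delta> has_derivative frechet_derivative (bump p \<delta>) (at q)) (at q)" using Cinf_has_derivative[OF Cinf_bump] by simp
        have "((\<lambda>a. bump p \<delta> a * (c (j a) \<bullet> b)) has_derivative
           (\<lambda>v. bump p \<delta> q * (c' v \<bullet> b) + frechet_derivative (bump p \<delta>) (at q) v * (c (j q) \<bullet> b))) (at q within A)"
          using cd(1) y(2) by (intro has_derivative_mult has_derivative_at_withinI[OF bdv] has_derivative_inner_left) simp
        then have "frechet_derivative r (at q) (\<psi>' b) =
            bump p \<delta> q * (c' (\<psi>' b) \<bullet> b) + frechet_derivative (bump p \<delta>) (at q) (\<psi>' b) * (c (j q) \<bullet> b)"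
          by (rule tang_unique[OF has_derivative_at_withinI[OF rd] _ O1(1) qO qA])
            (use r_eq cd(4) y in auto)
        moreover have "bump p \<delta> q = 1" using bump_eq_1[OF \<delta>(1), of p q] q(2) by simp
        ultimately show ?thesis using cd(3) yb y(3) by simp
      qed
      ultimately show ?thesis using bd(1) by (intro exI[of _ "\<psi>' b"]) simp
    qed
    show ?thesis
    proof (intro exI conjI)
      show "Cinf UNIV r" by (rule Cr)
      show "open (ball p \<delta>)" "p \<in> ball p \<delta>" using \<delta>(1) by auto
    qed (use nn r0 pos inw in auto)
  qed
qed

text \<open>A finite sum of local defining functions. At a boundary point one summand has positive
  derivative along some inward vector, and along it no summand has negative derivative.\<close>

lemma defining_function:
  obtains R :: "'f \<Rightarrow> real" where "Cinf UNIV R" "\<And>a. a \<in> A \<Longrightarrow> 0 \<le> R a" "\<And>a. a \<in> A \<Longrightarrow> R a \<le> 1 / 2"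
    "\<And>a. a \<in> A \<Longrightarrow> R a = 0 \<longleftrightarrow> a \<in> B"
    "\<And>p. p \<in> B \<Longrightarrow> \<exists>v\<in>tang A p. frechet_derivative R (at p) v \<noteq> 0"
proof -
  define Q where "Q p r O' \<longleftrightarrow> Cinf UNIV (r :: 'f \<Rightarrow> real) \<and> open O' \<and> p \<in> O' \<and> (\<forall>a\<in>A. 0 \<le> r a) \<and> (\<forall>a\<in>B. r a = 0) \<and>
    (\<forall>a\<in>A \<inter> O'. a \<notin> B \<longrightarrow> 0 < r a) \<and> (\<forall>q\<in>B \<inter> O'. \<exists>v. inward q v \<and> 0 < frechet_derivative r (at q) v)"
    for p r O'
  have "\<forall>p\<in>A. \<exists>r O'. Q p r O'" using local_defining_function unfolding Q_def by blast
  then obtain r O' where Q: "\<And>p. p \<in> A \<Longrightarrow> Q p (r p) (O' p)" by metis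
  then have r: "\<And>p. p \<in> A \<Longrightarrow> Cinf UNIV (r p :: 'f \<Rightarrow> real)" "\<And>p. p \<in> A \<Longrightarrow> open (O' p)" "\<And>p. p \<in> A \<Longrightarrow> p \<in> O' p"
    "\<And>p a. p \<in> A \<Longrightarrow> a \<in> A \<Longrightarrow> 0 \<le> r p a" "\<And>p a. p \<in> A \<Longrightarrow> a \<in> B \<Longrightarrow> r p a = 0"
    "\<And>p a. p \<in> A \<Longrightarrow> a \<in> A \<Longrightarrow> a \<in> O' p \<Longrightarrow> a \<notin> B \<Longrightarrow> 0 < r p a"
    "\<And>p q. p \<in> A \<Longrightarrow> q \<in> B \<Longrightarrow> q \<in> O' p \<Longrightarrow> \<exists>v. inward q v \<and> 0 < frechet_derivative (r p) (at q) v"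
    unfolding Q_def by blast+
  obtain C where C: "C \<subseteq> A" "finite C" "A \<subseteq> (\<Union>p\<in>C. O' p)"
    using compactE_image[OF compact_A, of A O'] r(2,3) by (metis UN_I subsetI)
  have BA: "B \<subseteq> A" using bd_points by (auto simp: A_def B_def)
  define S where "S a = (\<Sum>p\<in>C. r p a)" for a
  have CS: "Cinf UNIV S" unfolding S_def[abs_def] by (intro Cinf_sum open_UNIV r(1)) (use C(1) in auto)
  have S_nn: "0 \<le> S a" if "a \<in> A" for a unfolding S_def using r(4) C(1) that by (intro sum_nonneg) auto
  have S_0: "S a = 0 \<longleftrightarrow> a \<in> B" if a: "a \<in> A" for a
  proof
    assume 0: "S a = 0"
    obtain p where p: "p \<in> C" "a \<in> O' p" using C(3) a by blast
    have "r p a \<le> S a" unfolding S_def by (rule member_le_sum) (use p r(4) C a in auto)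
    then show "a \<in> B" using r(6)[of p a] p C(1) a 0 by force
  next
    assume "a \<in> B"
    then show "S a = 0" unfolding S_def using r(5) C(1) by (intro sum.neutral) auto
  qed
  have Sd: "\<exists>v\<in>tang A q. 0 < frechet_derivative S (at q) v" if q: "q \<in> B" for q
  proof -
    obtain p where p: "p \<in> C" "q \<in> O' p" using C(3) q BA by blast
    then obtain v where v: "inward q v" "0 < frechet_derivative (r p) (at q) v" using r(7) C(1) q by blast
    have "(S has_derivative (\<lambda>v. \<Sum>p\<in>C. frechet_derivative (r p) (at q) v)) (at q)"
      unfolding S_def[abs_def] using Cinf_has_derivative[OF r(1)] C(1) by (intro has_derivative_sum) auto
    then have eq: "frechet_derivative S (at q) v = (\<Sum>p\<in>C. frechet_derivative (r p) (at q) v)"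
      using frechet_derivative_at by metis
    have nn: "0 \<le> frechet_derivative (r p) (at q) v" if "p \<in> C" for p
      using v(1) r(1,4,5) C(1) that q unfolding inward_def by blast
    have "frechet_derivative (r p) (at q) v \<le> (\<Sum>p\<in>C. frechet_derivative (r p) (at q) v)"
      by (rule member_le_sum) (use p nn C(2) in auto)
    then show ?thesis using v eq by (intro bexI[of _ v]) (auto simp: inward_def)
  qed
  have "bounded (S ` A)"
    using compact_continuous_image[OF continuous_on_subset[OF Cinf_continuous_on[OF CS]] compact_A] compact_imp_bounded by blast
  then obtain M where M: "M > 0" "\<And>a. a \<in> A \<Longrightarrow> norm (S a) \<le> M" unfolding bounded_pos by blast
  \<comment> \<open>\<open>M\<close> bounds the sum on the compact page, so this scaling yields the
    bound \<open>1 / 2\<close>.\<close>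
  define R where "R a = inverse (2 * M) * S a" for a
  have CR: "Cinf UNIV R" unfolding R_def[abs_def] by (intro Cinf_mult Cinf_const CS open_UNIV)
  have Rd': "frechet_derivative R (at q) v = inverse (2 * M) * frechet_derivative S (at q) v" for q v
  proof -
    have "(R has_derivative (\<lambda>v. inverse (2 * M) * frechet_derivative S (at q) v)) (at q)"
      unfolding R_def[abs_def] using Cinf_has_derivative[OF CS] by (intro has_derivative_mult_right) auto
    then show ?thesis using frechet_derivative_at by metis
  qed
  have Rd: "\<exists>v\<in>tang A p. frechet_derivative R (at p) v \<noteq> 0" if pB: "p \<in> B" for p
  proof -
    obtain v where v: "v \<in> tang A p" "0 < frechet_derivative S (at p) v" using Sd[OF pB] by blast
    have "frechet_derivative R (at p) v \<noteq> 0" unfolding Rd' using v(2) M(1) by simp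
    then show ?thesis using v(1) by blast
  qed
  show thesis
  proof (rule that[OF CR])
    show "0 \<le> R a" if "a \<in> A" for a using S_nn[OF that] M(1) by (simp add: R_def)
    show "R a \<le> 1 / 2" if "a \<in> A" for a using M(2)[OF that] M(1) by (simp add: R_def field_simps)
    show "R a = 0 \<longleftrightarrow> a \<in> B" if "a \<in> A" for a using S_0[OF that] M(1) by (simp add: R_def)
  qed (rule Rd)
qed

lemma spinning_page:
  obtains W R e E P where "spinning A B W R e E P"
    "\<And>x t. x \<in> points V \<Longrightarrow> t \<in> {0..1} \<Longrightarrow> e (\<iota> x, t) = e' (x, t)"
proof -
  obtain e where e: "Cinf UNIV e" "\<And>x t. x \<in> points V \<Longrightarrow> t \<in> {0..1} \<Longrightarrow> e (\<iota> x, t) = e' (x, t)"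
    using extend_e by blast
  obtain E where E: "Cinf UNIV E" "\<And>x z. x \<in> boundary V \<Longrightarrow> norm z \<le> 1 \<Longrightarrow> E (\<iota> x, z) = E' (x, z)"
    using extend_E by blast
  obtain P where P: "Cinf UNIV P" "\<And>x z. x \<in> boundary V \<Longrightarrow> norm z \<le> 1 \<Longrightarrow> P (E' (x, z)) = \<iota> x"
    using left_inverse_E by blast
  obtain R :: "'f \<Rightarrow> real" where R: "Cinf UNIV R" "\<And>a. a \<in> A \<Longrightarrow> 0 \<le> R a" "\<And>a. a \<in> A \<Longrightarrow> R a \<le> 1 / 2"
    "\<And>a. a \<in> A \<Longrightarrow> R a = 0 \<longleftrightarrow> a \<in> B"
    "\<And>p. p \<in> B \<Longrightarrow> \<exists>v\<in>tang A p. frechet_derivative R (at p) v \<noteq> 0"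
    using defining_function by blast
  obtain W' where W': "openin (topo V) W'" "boundary V \<subseteq> W'" "\<forall>x\<in>W'. \<phi> x = x"
    using page by (auto simp: page_with_monodromy_def)
  obtain W where W: "open W" "\<iota> ` W' = A \<inter> W" using chart_open[OF W'(1)] .
  have \<phi>: "\<phi> x \<in> points V" if "x \<in> points V" for x
    using page that by (auto simp: page_with_monodromy_def diffeomorphism_def bij_betw_def)
  have BA: "B \<subseteq> A" using bd_points by (auto simp: A_def B_def)
  have "spinning A B W R e E P"
  proof
    show "compact A" by (rule compact_A)
    show "B \<subseteq> A" by (rule BA)
    show "norm (e (a, t)) = 1" if "a \<in> A" "t \<in> {0..1}" for a t
      using that e(2) norm_e' by (auto simp: A_def)
    show "\<exists>L. Cinf UNIV L \<and> (\<forall>a\<in>A. L (e (a, t)) = a)" if "t \<in> {0..1}" for t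
    proof -
      obtain L where "Cinf UNIV L" "\<And>x. x \<in> points V \<Longrightarrow> L (e' (x, t)) = \<iota> x"
        using left_inverse_e[of t] by metis
      then have "\<forall>a\<in>A. L (e (a, t)) = a" using e(2) \<open>t \<in> {0..1}\<close> by (simp add: A_def)
      then show ?thesis using \<open>Cinf UNIV L\<close> by blast
    qed
    show "e (a, 0) = a" if "a \<in> A" for a using that e(2) by (auto simp: A_def \<iota>_def)
    have e1: "e (\<iota> x, 1) = \<iota> (\<phi> x)" if "x \<in> points V" for x
      using that e(2) e'_1 by (simp add: \<iota>_def)
    show "e (a, 1) \<in> A" if "a \<in> A" for a using that e1 \<phi> by (auto simp: A_def)
    show "B \<subseteq> W" using W'(2) W(2) by (auto simp: B_def)
    show "e (a, 1) = a" if "a \<in> A" "a \<in> W" for a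
    proof -
      have "a \<in> \<iota> ` W'" using that W(2) by auto
      then show ?thesis using e1 W'(1,3) openin_subset by fastforce
    qed
    show "norm (E (b, z)) = 1" if "b \<in> B" "norm z \<le> 1" for b z
      using that E(2) norm_E' by (auto simp: B_def)
    show "e (b, t) = E (b, cis (2 * pi * t))" if "b \<in> B" "t \<in> {0..1}" for b t
      using that e(2) E(2) e'_E' bd_points by (auto simp: B_def)
    show "P (E (b, z)) = b" if "b \<in> B" "norm z \<le> 1" for b z
      using that E(2) P(2) by (auto simp: B_def)
  next
    fix p assume "p \<in> B"
    then obtain x where x: "x \<in> boundary V" "p = \<iota> x" by (auto simp: B_def)
    obtain U c b where U: "(U, c) \<in> charts V" "x \<in> U" "b \<noteq> 0" "openin (top_of_set (half_space b)) (c ` U)"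
      "c x \<bullet> b = 0" "\<And>y. y \<in> U \<Longrightarrow> y \<in> boundary V \<longleftrightarrow> c y \<bullet> b = 0"
      using boundary_chart_at[OF x(1)] by blast
    note Uc = manifold_chart[OF V U(1)]
    obtain O' c' \<psi>' where cd: "open O'" "\<iota> x \<in> O'" "\<iota> ` U = A \<inter> O'"
      "((\<lambda>a. c (j a)) has_derivative c') (at (\<iota> x) within A)"
      "((\<lambda>y. \<iota> (inv_into U c y)) has_derivative \<psi>') (at (c x) within c ` U)"
      "\<And>v. v \<in> tang A (\<iota> x) \<Longrightarrow> \<psi>' (c' v) = v" "\<And>w. \<psi>' w \<in> tang A (\<iota> x)"
      by (rule chart_data[OF U(1,2)]) (rule that)
    have T: "tang (c ` U) (c x) = UNIV" using tang_model_open[OF Uc(2)] U(2) by blast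
    obtain Wc C where C: "p \<in> Wc" "Cinf Wc C" "\<And>a. a \<in> \<iota> ` U \<Longrightarrow> a \<in> Wc \<Longrightarrow> C a = c (j a)"
      using chart_smooth[OF U(1)] U(2) x(2) unfolding smooth_on_iff by (metis IntI imageI)
    obtain Wp Ps where Ps: "c x \<in> Wp" "Cinf Wp Ps" "\<And>y. y \<in> c ` U \<Longrightarrow> y \<in> Wp \<Longrightarrow> Ps y = \<iota> (inv_into U c y)"
      using chart_inverse_smooth[OF U(1)] U(2) unfolding smooth_on_iff by (metis IntI imageI)
    have Cp: "C p = c x" using C(3)[of p] C(1) U(2) x j_\<iota> bd_points by auto
    define D where "D = O' \<inter> (Wc \<inter> C -` Wp)"
    have oD: "open D" unfolding D_def
      using continuous_open_preimage[OF Cinf_continuous_on[OF C(2)] Cinf_open[OF C(2)] Cinf_open[OF Ps(2)]] cd(1) by blast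
    have pD: "p \<in> D" using C(1) Ps(1) Cp cd(2) x(2) by (simp add: D_def)
    \<comment> \<open>\<open>Ps\<close> after \<open>C\<close> factors through the model space and
      is the identity on \<open>A\<close> near \<open>p\<close>. If the derivative of
      \<open>G\<close> kills \<open>v\<close>, then \<open>v = Ps' (C' v)\<close>, which is tangent
      to \<open>A\<close>.\<close>
    define G where "G a = a - Ps (C a)" for a
    have PsC: "Cinf D (\<lambda>a. Ps (C a))"
      by (rule Cinf_compose[OF Cinf_subset[OF C(2) oD] Ps(2)]) (auto simp: D_def)
    have G: "Cinf D G" unfolding G_def[abs_def] by (intro Cinf_diff Cinf_ident oD PsC)
    have G0: "G a = 0" if "a \<in> A" "a \<in> D" for a
    proof -
      have "a \<in> \<iota> ` U" using that cd(3) by (auto simp: D_def)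
      then obtain y where y: "y \<in> U" "a = \<iota> y" by auto
      then have "C a = c y" using C(3)[of a] that j_\<iota> Uc(6) by (auto simp: D_def)
      then have "Ps (C a) = \<iota> y" using Ps(3)[of "c y"] that y(1) Uc(3) by (auto simp: D_def)
      then show ?thesis using y by (simp add: G_def)
    qed
    define C' where "C' = frechet_derivative C (at p)"
    define Ps' where "Ps' = frechet_derivative Ps (at (c x))"
    have C'd: "(C has_derivative C') (at p)" unfolding C'_def by (rule Cinf_has_derivative[OF C(2,1)])
    have Psd: "(Ps has_derivative Ps') (at (c x))" unfolding Ps'_def by (rule Cinf_has_derivative[OF Ps(2,1)])
    have Gd: "frechet_derivative G (at p) v = v - Ps' (C' v)" for v
    proof -
      have "(G has_derivative (\<lambda>v. v - Ps' (C' v))) (at p)" unfolding G_def[abs_def]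
        using has_derivative_compose[OF C'd, of Ps Ps'] Psd unfolding Cp by (intro has_derivative_diff has_derivative_ident) auto
      then show ?thesis using frechet_derivative_at by metis
    qed
    have Ps'T: "Ps' w \<in> tang A p" for w
    proof -
      have "Ps' w \<in> tang A (Ps (c x))"
        by (rule tang_image[OF has_derivative_at_withinI[OF Psd] Cinf_open[OF Ps(2)] Ps(1), of "c ` U"])
          (use Ps(3) U(2) T Uc(3,6) in \<open>auto simp: A_def\<close>)
      then show ?thesis using Ps(3)[of "c x"] Ps(1) U(2) Uc(3) x(2) by simp
    qed
    show "\<exists>U G. p \<in> U \<and> Cinf U (G :: 'f \<Rightarrow> 'f) \<and> (\<forall>a\<in>A \<inter> U. G a = 0) \<and>
        (\<forall>v. frechet_derivative G (at p) v = 0 \<longrightarrow> v \<in> tang A p)"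
    proof (intro exI[of _ D] exI[of _ G] conjI allI impI)
      show "v \<in> tang A p" if "frechet_derivative G (at p) v = 0" for v
        using that Ps'T[of "C' v"] by (simp add: Gd)
    qed (use pD G G0 in auto)
    fix v assume v: "v \<in> tang A p" "frechet_derivative R (at p) v = 0"
    let ?K = "{z \<in> c ` U. z \<bullet> b = 0}"
    have xK: "c x \<in> ?K" using U(2,5) by simp
    have Rd: "(R has_derivative frechet_derivative R (at p)) (at p)" using Cinf_has_derivative[OF R(1)] by simp
    have \<psi>x: "\<iota> (inv_into U c (c x)) = p" using Uc(3) U(2) x(2) by simp
    have \<psi>K: "((\<lambda>y. \<iota> (inv_into U c y)) has_derivative \<psi>') (at (c x) within ?K)"
      using cd(5) by (rule has_derivative_subset) auto
    have K_B: "\<iota> (inv_into U c z) \<in> B" if "z \<in> ?K" for z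
      using that U(6) Uc(3) by (auto simp: B_def)
    \<comment> \<open>The derivative of \<open>R\<close> read in the boundary chart. Since
      \<open>R\<close> is zero on \<open>B\<close>, it kills the edge of the half-space; by
      transversality it is not zero, so its kernel is exactly the edge, whose vectors correspond to
      vectors tangent to \<open>B\<close>.\<close>
    define l where "l w = frechet_derivative R (at p) (\<psi>' w)" for w
    have ld: "((\<lambda>z. R (\<iota> (inv_into U c z))) has_derivative l) (at (c x) within ?K)"
      using has_derivative_compose[OF \<psi>K, of R "frechet_derivative R (at p)"] Rd unfolding \<psi>x l_def[abs_def] by simp
    have lin: "linear l"
      unfolding l_def[abs_def]
      using linear_compose[OF has_derivative_linear[OF cd(5)] has_derivative_linear[OF Rd]] by (simp add: o_def)
    have tK: "w \<in> tang ?K (c x)" if "w \<bullet> b = 0" for w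
      using tang_halfspace_boundary[OF U(4) _ U(5) that] U(2) by blast
    have l0: "l w = 0" if "w \<bullet> b = 0" for w
      by (rule tang_unique[OF ld has_derivative_const open_UNIV _ xK _ tK[OF that]])
        (use K_B R(4) BA in auto)
    have l_eq: "l w = (w \<bullet> b / (b \<bullet> b)) * l b" for w
    proof -
      have "l (w - (w \<bullet> b / (b \<bullet> b)) *\<^sub>R b) = 0" by (rule l0) (use U(3) in \<open>simp add: inner_diff_left\<close>)
      then show ?thesis by (simp add: linear_diff[OF lin] linear_scale[OF lin])
    qed
    have lb: "l b \<noteq> 0"
    proof
      assume lb: "l b = 0"
      obtain v0 where v0: "v0 \<in> tang A p" "frechet_derivative R (at p) v0 \<noteq> 0" using R(5)[OF \<open>p \<in> B\<close>] by blast
      then have "l (c' v0) \<noteq> 0" using cd(6) x(2) by (simp add: l_def)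
      then show False using l_eq[of "c' v0"] lb by simp
    qed
    have "l (c' v) = 0" using v cd(6) x(2) by (simp add: l_def)
    then have "c' v \<bullet> b = 0" using l_eq[of "c' v"] lb U(3) by simp
    then have "\<psi>' (c' v) \<in> tang B (\<iota> (inv_into U c (c x)))"
      using K_B by (intro tang_image[OF \<psi>K open_UNIV _ xK _ tK]) auto
    then show "v \<in> tang B p" using cd(6) v(1) x(2) \<psi>x by simp
  qed (use e(1) E(1) P(1) R W(1) in auto)
  then show thesis using that e(2) by blast
qed

end

section \<open>Proper embeddings into the ball and the isotopy\<close>

lemma chart_inverses_continuous_submanifold:
  "chart_inverses_continuous (submanifold A :: ('f::euclidean_space, 'e::euclidean_space) charted)"
  unfolding chart_inverses_continuous_def
proof (clarify, intro conjI)
  fix U c assume U: "(U, c) \<in> charts (submanifold A :: ('f, 'e) charted)"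
  have Uc: "openin (top_of_set A) U" "inj_on c U" "smooth_on (c ` U) (inv_into U c)"
    using U by (auto simp: charts_submanifold)
  have UA: "U \<subseteq> A" using openin_subset[OF Uc(1)] by simp
  then show "U \<subseteq> points (submanifold A :: ('f, 'e) charted)" by simp
  show "inj_on c U" by (rule Uc(2))
  have "inv_into U c ` c ` U \<subseteq> A" using UA Uc(2) by auto
  then show "continuous_map (top_of_set (c ` U)) (topo (submanifold A :: ('f, 'e) charted)) (inv_into U c)"
    using smooth_on_continuous_on[OF Uc(3)] by (simp add: image_subset_iff_funcset)
qed

text \<open>All vectors are tangent to the ball, even at points of the sphere, so the chain rule for
  the chart and its inverse holds on the whole space and makes \<open>d'\<close> injective.\<close>

lemma ball_chart_derivative:
  fixes d :: "'f::euclidean_space \<Rightarrow> 'f"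
  assumes W: "(W, d) \<in> charts (submanifold (cball 0 1) :: ('f, 'f) charted)" and q: "q \<in> W"
  obtains d' where "(d has_derivative d') (at q within W)" "inj d'" "linear d'"
proof -
  have Wd: "openin (top_of_set (cball 0 1)) W" "inj_on d W" "smooth_on W d" "smooth_on (d ` W) (inv_into W d)"
    using W by (auto simp: charts_submanifold)
  obtain d' where d': "(d has_derivative d') (at q within W)" using smooth_on_has_derivative[OF Wd(3) q] .
  obtain g where g: "(inv_into W d has_derivative g) (at (d q) within d ` W)"
    using smooth_on_has_derivative[OF Wd(4)] q by blast
  obtain S where S: "open S" "W = cball 0 1 \<inter> S" using Wd(1) by (auto simp: openin_open)
  have T: "tang W q = UNIV"
    using tang_cball[of q] q S tang_Int_open[of S q "cball 0 1"] by auto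
  have "(inv_into W d \<circ> d has_derivative g \<circ> d') (at q within W)"
    by (rule diff_chain_within[OF d' g])
  then have "(g \<circ> d') v = v" for v
    by (rule tang_unique[OF _ has_derivative_ident open_UNIV]) (use q T Wd(2) in auto)
  then have "inj d'" by (metis comp_apply injI)
  then show thesis using that[OF d'] has_derivative_linear[OF d'] by blast
qed

text \<open>Vectors pointing strictly into the ball are sent to vectors with non-negative
  \<open>b\<close>-component. If \<open>u\<close> were sent into the hyperplane, then
  \<open>u\<close> or \<open>- u\<close> would point strictly inward and could be perturbed by a
  vector sent to \<open>- b\<close>: it would still point inward, but its image would have negative
  component.\<close>

lemma ball_chart_transverse:
  fixes d :: "'f::euclidean_space \<Rightarrow> 'f"
  assumes bc: "boundary_chart (submanifold (cball 0 1) :: ('f, 'f) charted) q W d b"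
    and d': "(d has_derivative d') (at q within W)" "inj d'"
    and q: "norm q = 1" and u: "q \<bullet> u \<noteq> 0"
  shows "d' u \<bullet> b \<noteq> 0"
proof
  assume 0: "d' u \<bullet> b = 0"
  have W: "(W, d) \<in> charts (submanifold (cball 0 1) :: ('f, 'f) charted)" "q \<in> W" "b \<noteq> 0"
    "openin (top_of_set (half_space b)) (d ` W)" "d q \<bullet> b = 0"
    using bc by (auto simp: boundary_chart_def)
  have lin: "linear d'" using has_derivative_linear[OF d'(1)] .
  obtain S where S: "open S" "W = cball 0 1 \<inter> S"
    using W(1) by (auto simp: charts_submanifold openin_open)
  obtain e where e: "e > 0" "ball q e \<subseteq> S" using S W(2) openE by blast
  have dd: "((\<lambda>x. d x \<bullet> b) has_derivative (\<lambda>v. d' v \<bullet> b)) (at q within W)"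
    by (rule has_derivative_inner_left[OF d'(1)])
  have nn: "0 \<le> d x \<bullet> b" if "x \<in> W" for x
    using openin_subset[OF W(4)] that by (auto simp: half_space_def)
  have inward: "0 \<le> d' v \<bullet> b" if v: "q \<bullet> v < 0" for v
  proof -
    obtain s where s: "s > 0" "\<And>t. 0 \<le> t \<Longrightarrow> t \<le> 1 \<Longrightarrow> q + t *\<^sub>R s *\<^sub>R v \<in> ball q e"
      using small_multiple[OF e(1)] by metis
    \<comment> \<open>The second bound makes the quadratic term of the squared norm of
      \<open>q + t r v\<close> at most half as large as the negative linear term, so the segment
      stays in the ball; the first keeps it in the chart domain.\<close>
    define r where "r = min s (- (q \<bullet> v) / (v \<bullet> v))"
    have vv: "v \<bullet> v > 0" using v by auto
    have r: "r > 0" "r \<le> s" "r * (v \<bullet> v) \<le> - (q \<bullet> v)"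
      using s(1) v vv by (auto simp: r_def min_def field_simps)
    have "0 \<le> d' (r *\<^sub>R v) \<bullet> b"
    proof (rule derivative_nonneg_along_segment[OF dd])
      fix t :: real assume t: "0 \<le> t" "t \<le> 1"
      have "q + t *\<^sub>R r *\<^sub>R v = q + (t * (r / s)) *\<^sub>R s *\<^sub>R v" using s(1) by simp
      also have "\<dots> \<in> ball q e"
      proof (rule s(2))
        have "r / s \<le> 1" "0 \<le> r / s" using r(1,2) s(1) by simp_all
        then show "0 \<le> t * (r / s)" "t * (r / s) \<le> 1"
          using t by (intro mult_nonneg_nonneg mult_le_one; simp)+
      qed
      finally have "q + t *\<^sub>R r *\<^sub>R v \<in> S" using e(2) by blast
      moreover have "(q + t *\<^sub>R r *\<^sub>R v) \<bullet> (q + t *\<^sub>R r *\<^sub>R v) = 1 + t * r * (2 * (q \<bullet> v) + t * (r * (v \<bullet> v)))"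
        using q by (simp add: inner_add_left inner_add_right inner_commute dot_square_norm[of q] algebra_simps)
      moreover have "t * r * (2 * (q \<bullet> v) + t * (r * (v \<bullet> v))) \<le> 0"
      proof (rule mult_nonneg_nonpos)
        have "t * (r * (v \<bullet> v)) \<le> 1 * (r * (v \<bullet> v))" using t r(1) vv by (intro mult_right_mono) auto
        then show "2 * (q \<bullet> v) + t * (r * (v \<bullet> v)) \<le> 0" using r(3) v by linarith
      qed (use t r(1) in auto)
      ultimately show "q + t *\<^sub>R r *\<^sub>R v \<in> W"
        using S(2) by (simp add: norm_eq_sqrt_inner)
    qed (use nn W(5) in auto)
    then show ?thesis using r(1) by (simp add: linear_scale[OF lin] zero_le_mult_iff)
  qed
  have "surj d'" using linear_injective_imp_surjective[OF lin d'(2)] by simp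
  then obtain u1 where u1: "d' u1 = - b" by (metis surjD)
  define w where "w = (if q \<bullet> u < 0 then u else - u)"
  have w: "q \<bullet> w < 0" "d' w \<bullet> b = 0" using u 0 by (auto simp: w_def linear_neg[OF lin])
  \<comment> \<open>Chosen so that the perturbation contributes at most
    \<open>- (q \<bullet> w) / 2\<close> and the sum keeps a negative inner product with
    \<open>q\<close>.\<close>
  define \<epsilon> where "\<epsilon> = - (q \<bullet> w) / (2 * (\<bar>q \<bullet> u1\<bar> + 1))"
  have \<epsilon>: "\<epsilon> > 0" unfolding \<epsilon>_def using w by (intro divide_pos_pos) auto
  have "\<epsilon> * (q \<bullet> u1) \<le> \<epsilon> * (\<bar>q \<bullet> u1\<bar> + 1)" using \<epsilon> by (intro mult_left_mono) auto
  also have "\<dots> = - (q \<bullet> w) / 2" unfolding \<epsilon>_def by (simp add: field_simps add_eq_0_iff)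
  finally have "q \<bullet> (w + \<epsilon> *\<^sub>R u1) < 0" using w(1) by (simp add: inner_add_right)
  then have "0 \<le> d' (w + \<epsilon> *\<^sub>R u1) \<bullet> b" by (rule inward)
  also have "\<dots> = - (\<epsilon> * (b \<bullet> b))"
    using w(2) u1 by (simp add: linear_add[OF lin] linear_scale[OF lin] inner_add_left inner_diff_left)
  finally show False using mult_pos_pos[OF \<epsilon>, of "b \<bullet> b"] W(3) by simp
qed

context book_maps
begin

text \<open>Translates ambient conditions on a smooth map of the embedded page into the chart-wise
  definition of a proper embedding of \<open>V\<close>.\<close>

lemma proper_embedding_page:
  fixes K :: "'f \<Rightarrow> 'f"
  assumes K: "Cinf S K" "A \<subseteq> S" "inj_on K A"
    and norm_K: "\<And>a. a \<in> A \<Longrightarrow> norm (K a) \<le> 1" "\<And>a. a \<in> A \<Longrightarrow> norm (K a) = 1 \<longleftrightarrow> a \<in> B"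
    and imm: "\<And>a v. a \<in> A \<Longrightarrow> v \<in> tang A a \<Longrightarrow> frechet_derivative K (at a) v = 0 \<Longrightarrow> v = 0"
    and trans: "\<And>a. a \<in> B \<Longrightarrow> \<exists>v\<in>tang A a. K a \<bullet> frechet_derivative K (at a) v \<noteq> 0"
  shows "proper_embedding V (submanifold (cball 0 1) :: ('f, 'f) charted) (\<lambda>x. K (\<iota> x))"
proof -
  let ?D = "submanifold (cball 0 1) :: ('f, 'f) charted" and ?g = "\<lambda>x. K (\<iota> x)"
  note ci = manifold_chart_inverses_continuous[OF V]
  have \<iota>A: "\<iota> x \<in> A" if "x \<in> points V" for x using that by (simp add: A_def)
  have "continuous_map (topo V) (top_of_set A) \<iota>"
    using cont_\<iota> by (auto simp: continuous_map_in_subtopology A_def)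
  moreover have "continuous_map (top_of_set A) (top_of_set (cball 0 1)) K"
    using continuous_on_subset[OF Cinf_continuous_on[OF K(1)] K(2)] norm_K(1) by (simp add: image_subset_iff Pi_iff)
  ultimately have cg: "continuous_map (topo V) (top_of_set (cball 0 1)) ?g"
    using continuous_map_compose[of "topo V" _ \<iota> _ K] by (simp add: o_def)
  have sm: "smooth_map V ?D ?g"
  proof (rule smooth_map_submanifoldI[OF cg ci])
    fix U c assume U: "(U, c) \<in> charts V"
    have "smooth_on (c ` U) (\<lambda>y. K (\<iota> (inv_into U c y)))"
      by (rule smooth_on_compose[OF chart_inverse_smooth[OF U] smooth_on_Cinf[OF K(1,2)]])
        (use manifold_chart(3,6)[OF V U] \<iota>A in auto)
    then show "smooth_on (c ` U) (?g \<circ> inv_into U c)" by (simp add: o_def)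
  qed
  \<comment> \<open>One chain rule for both uses: the inverse chart sends the model space
    isomorphically to \<open>tang A\<close>, then \<open>K\<close> acts, then the chart of the ball.
    Injectivity of the outer factors gives the immersion property, surjectivity onto
    \<open>tang A\<close> gives transversality.\<close>
  have deriv: "\<exists>\<psi>' d'. ((d \<circ> ?g \<circ> inv_into U c) has_derivative (\<lambda>w. d' (frechet_derivative K (at (\<iota> p)) (\<psi>' w))))
        (at (c p) within c ` {x \<in> U. ?g x \<in> W}) \<and>
      (d has_derivative d') (at (?g p) within W) \<and> inj d' \<and> linear d' \<and>
      (\<forall>w. \<psi>' w \<in> tang A (\<iota> p)) \<and> inj \<psi>' \<and> linear \<psi>' \<and> (\<forall>v\<in>tang A (\<iota> p). \<exists>w. \<psi>' w = v)"
    if U: "(U, c) \<in> charts V" "p \<in> U" and W: "(W, d) \<in> charts ?D" "?g p \<in> W" for U c W d p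
  proof -
    note Uc = manifold_chart[OF V U(1)]
    obtain d' where d': "(d has_derivative d') (at (?g p) within W)" "inj d'" "linear d'"
      using ball_chart_derivative[OF W] .
    obtain c' \<psi>' where cd: "((\<lambda>y. \<iota> (inv_into U c y)) has_derivative \<psi>') (at (c p) within c ` U)"
      "\<And>v. v \<in> tang A (\<iota> p) \<Longrightarrow> \<psi>' (c' v) = v" "\<And>w. c' (\<psi>' w) = w" "\<And>w. \<psi>' w \<in> tang A (\<iota> p)"
      by (rule chart_data[OF U]) (rule that)
    let ?T = "c ` {x \<in> U. ?g x \<in> W}"
    have cp: "inv_into U c (c p) = p" using Uc(3) U(2) by simp
    have pS: "\<iota> p \<in> S" using U(2) Uc(6) \<iota>A K(2) by blast
    have Kd: "(K has_derivative frechet_derivative K (at (\<iota> p))) (at (\<iota> (inv_into U c (c p))))"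
      unfolding cp by (rule Cinf_has_derivative[OF K(1) pS])
    have "((\<lambda>y. K (\<iota> (inv_into U c y))) has_derivative (\<lambda>w. frechet_derivative K (at (\<iota> p)) (\<psi>' w))) (at (c p) within ?T)"
      by (rule has_derivative_compose[OF has_derivative_subset[OF cd(1)] Kd]) auto
    moreover have "(d has_derivative d') (at (K (\<iota> (inv_into U c (c p)))) within (\<lambda>y. K (\<iota> (inv_into U c y))) ` ?T)"
      unfolding cp by (rule has_derivative_subset[OF d'(1)]) (use Uc(3) in auto)
    ultimately have "(d \<circ> (\<lambda>y. K (\<iota> (inv_into U c y))) has_derivative d' \<circ> (\<lambda>w. frechet_derivative K (at (\<iota> p)) (\<psi>' w))) (at (c p) within ?T)"
      by (rule diff_chain_within)
    then have "(d \<circ> ?g \<circ> inv_into U c has_derivative (\<lambda>w. d' (frechet_derivative K (at (\<iota> p)) (\<psi>' w)))) (at (c p) within ?T)"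
      by (simp add: o_def)
    moreover have "inj \<psi>'" using cd(3) by (metis injI)
    moreover have "linear \<psi>'" using has_derivative_linear[OF cd(1)] .
    ultimately show ?thesis using d' cd(2,4) by blast
  qed
  have linK: "linear (frechet_derivative K (at a))" if "a \<in> A" for a
    using has_derivative_linear[OF Cinf_has_derivative[OF K(1)]] that K(2) by blast
  have "immersion V ?D ?g"
    unfolding immersion_def
  proof (intro conjI sm ballI, clarify)
    fix U c W d p assume U: "(U, c) \<in> charts V" "p \<in> U" and W: "(W, d) \<in> charts ?D" "?g p \<in> W"
    obtain \<psi>' d' where D: "((d \<circ> ?g \<circ> inv_into U c) has_derivative (\<lambda>w. d' (frechet_derivative K (at (\<iota> p)) (\<psi>' w))))
        (at (c p) within c ` {x \<in> U. ?g x \<in> W})" "inj d'" "linear d'" "\<And>w. \<psi>' w \<in> tang A (\<iota> p)" "inj \<psi>'" "linear \<psi>'"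
      using deriv[OF U W] by blast
    have pA: "\<iota> p \<in> A" using U manifold_chart(6)[OF V U(1)] \<iota>A by blast
    have "w = 0" if "d' (frechet_derivative K (at (\<iota> p)) (\<psi>' w)) = 0" for w
    proof -
      have "frechet_derivative K (at (\<iota> p)) (\<psi>' w) = 0" using D(2,3) that by (metis linear_injective_0)
      then have "\<psi>' w = 0" using imm[OF pA D(4)] by blast
      then show "w = 0" using D(5,6) by (metis linear_injective_0)
    qed
    then have "inj (\<lambda>w. d' (frechet_derivative K (at (\<iota> p)) (\<psi>' w)))"
      using linear_injective_0[OF has_derivative_linear[OF D(1)]] by blast
    then show "\<exists>L. (d \<circ> ?g \<circ> inv_into U c has_derivative L) (at (c p) within c ` {x \<in> U. ?g x \<in> W}) \<and> inj L"
      using D(1) by blast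
  qed
  moreover have "embedding_map (topo V) (topo ?D) ?g"
  proof (rule continuous_imp_embedding_map)
    show "inj_on ?g (points V)"
      using comp_inj_on[OF inj_\<iota> K(3)[unfolded A_def]] by (simp add: o_def)
  qed (use cg compact_V in \<open>auto simp: Hausdorff_space_subtopology Hausdorff_space_euclidean\<close>)
  moreover have "{x \<in> points V. ?g x \<in> boundary ?D} = boundary V"
    unfolding boundary_cball using norm_K(2) \<iota>A \<iota>_in_B bd_points by auto
  moreover have "transverse_to_boundary V ?D ?g"
    unfolding transverse_to_boundary_def
  proof (intro ballI, clarify)
    fix U c p W d b assume U: "(U, c) \<in> charts V" "p \<in> U" and p: "p \<in> boundary V"
      and bc: "boundary_chart ?D (?g p) W d b"
    then have W: "(W, d) \<in> charts ?D" "?g p \<in> W" by (auto simp: boundary_chart_def)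
    obtain \<psi>' d' where D: "((d \<circ> ?g \<circ> inv_into U c) has_derivative (\<lambda>w. d' (frechet_derivative K (at (\<iota> p)) (\<psi>' w))))
        (at (c p) within c ` {x \<in> U. ?g x \<in> W})" "(d has_derivative d') (at (?g p) within W)" "inj d'"
        "\<And>v. v \<in> tang A (\<iota> p) \<Longrightarrow> \<exists>w. \<psi>' w = v"
      using deriv[OF U W] by blast
    have pB: "\<iota> p \<in> B" using p by (simp add: B_def)
    then obtain v where v: "v \<in> tang A (\<iota> p)" "K (\<iota> p) \<bullet> frechet_derivative K (at (\<iota> p)) v \<noteq> 0" using trans by blast
    obtain w where w: "\<psi>' w = v" using D(4)[OF v(1)] by blast
    have "norm (?g p) = 1" using norm_K(2)[of "\<iota> p"] pB \<iota>A bd_points p by blast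
    then have "d' (frechet_derivative K (at (\<iota> p)) v) \<bullet> b \<noteq> 0"
      by (rule ball_chart_transverse[OF bc D(2,3) _ v(2)])
    then show "\<exists>L v. (d \<circ> ?g \<circ> inv_into U c has_derivative L) (at (c p) within c ` {x \<in> U. ?g x \<in> W}) \<and> L v \<bullet> b \<noteq> 0"
      using D(1) w by blast
  qed
  ultimately show ?thesis by (simp add: proper_embedding_def smooth_embedding_def)
qed

lemma spun_embeds_ball: "spun_embeds V \<phi> (submanifold (cball 0 1) :: ('f, 'f) charted) id"
proof -
  let ?D = "submanifold (cball 0 1) :: ('f, 'f) charted"
  let ?I = "submanifold {0..1} :: (real, real) charted"
  obtain W R e E P where sp: "spinning A B W R e E P"
    and e: "\<And>x t. x \<in> points V \<Longrightarrow> t \<in> {0..1} \<Longrightarrow> e (\<iota> x, t) = e' (x, t)"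
    using spinning_page by blast
  obtain H :: "'f \<times> real \<Rightarrow> 'f" and O' where H: "Cinf O' H" "A \<times> {0..1} \<subseteq> O'"
    "\<And>t. t \<in> {0..1} \<Longrightarrow> inj_on (\<lambda>a. H (a, t)) A"
    "\<And>a t. a \<in> A \<Longrightarrow> t \<in> {0..1} \<Longrightarrow> norm (H (a, t)) \<le> 1"
    "\<And>a t. a \<in> A \<Longrightarrow> t \<in> {0..1} \<Longrightarrow> norm (H (a, t)) = 1 \<longleftrightarrow> a \<in> B"
    "\<And>a t v. a \<in> A \<Longrightarrow> t \<in> {0..1} \<Longrightarrow> v \<in> tang A a \<Longrightarrow> frechet_derivative H (at (a, t)) (v, 0) = 0 \<Longrightarrow> v = 0"
    "\<And>a t. a \<in> B \<Longrightarrow> t \<in> {0..1} \<Longrightarrow> \<exists>v\<in>tang A a. H (a, t) \<bullet> frechet_derivative H (at (a, t)) (v, 0) \<noteq> 0"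
    "\<And>a t. a \<in> B \<Longrightarrow> t \<in> {0..1} \<Longrightarrow> H (a, t) = H (a, 0)"
    "\<And>a. a \<in> A \<Longrightarrow> H (a, 1) = H (e (a, 1), 0)"
    by (rule spinning.spun_family[OF sp]) (rule that)
  have \<iota>A: "\<iota> x \<in> A" if "x \<in> points V" for x using that by (simp add: A_def)
  have \<phi>: "\<phi> x \<in> points V" if "x \<in> points V" for x
    using page that by (auto simp: page_with_monodromy_def diffeomorphism_def bij_betw_def)
  have BA: "B \<subseteq> A" using bd_points by (auto simp: A_def B_def)
  have H1: "H (\<iota> x, 1) = H (\<iota> (\<phi> x), 0)" if "x \<in> points V" for x
    using H(9)[OF \<iota>A[OF that]] e[OF that, of 1] e'_1[OF that] by (simp add: \<iota>_def)
  have pe: "proper_embedding V ?D (\<lambda>x. H (\<iota> x, t))" if t: "t \<in> {0..1}" for t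
  proof -
    let ?S = "{a. (a, t) \<in> O'}"
    have "?S = (\<lambda>a. (a, t)) -` O'" by auto
    moreover have "open ((\<lambda>a. (a, t)) -` O')"
      by (intro open_vimage Cinf_open[OF H(1)] continuous_intros)
    ultimately have oS: "open ?S" by simp
    have C: "Cinf ?S (\<lambda>a. H (a, t))"
      by (rule Cinf_compose[OF Cinf_Pair[OF Cinf_ident[OF oS] Cinf_const[OF oS]] H(1)]) auto
    have AO: "(a, t) \<in> O'" if "a \<in> A" for a using H(2) that t by auto
    have fd: "frechet_derivative (\<lambda>a. H (a, t)) (at a) = (\<lambda>v. frechet_derivative H (at (a, t)) (v, 0))" if "a \<in> A" for a
      using frechet_derivative_at[OF Cinf_partial[OF H(1) AO[OF that]]] by simp
    show ?thesis
    proof (rule proper_embedding_page[OF C])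
      show "A \<subseteq> ?S" using AO by auto
      show "v = 0" if "a \<in> A" "v \<in> tang A a" "frechet_derivative (\<lambda>a. H (a, t)) (at a) v = 0" for a v
        using H(6)[OF that(1) t that(2)] that(3) fd[OF that(1)] by simp
      show "\<exists>v\<in>tang A a. H (a, t) \<bullet> frechet_derivative (\<lambda>a. H (a, t)) (at a) v \<noteq> 0" if "a \<in> B" for a
        unfolding fd[OF subsetD[OF BA that]] by (rule H(7)[OF that t])
    qed (use H(3,4,5) t in auto)
  qed
  \<comment> \<open>Time is reversed: the isotopy has to start at the monodromy followed by the
    embedding, which is the stage at angle \<open>1\<close>, and to end at the embedding itself, the
    stage at angle \<open>0\<close>.\<close>
  define F where "F = (\<lambda>(x, t). H (\<iota> x, 1 - t))"
  have "isotopic_rel_boundary V ?D ((\<lambda>x. H (\<iota> x, 0)) \<circ> \<phi>) (id \<circ> (\<lambda>x. H (\<iota> x, 0)))"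
    unfolding isotopic_rel_boundary_def
  proof (intro exI[of _ F] conjI ballI)
    show "proper_embedding V ?D (\<lambda>x. F (x, t))" if "t \<in> {0..1}" for t
      using pe[of "1 - t"] that by (simp add: F_def)
    show "F (x, 0) = ((\<lambda>x. H (\<iota> x, 0)) \<circ> \<phi>) x" if "x \<in> points V" for x
      using H1[OF that] by (simp add: F_def)
    show "F (x, 1) = (id \<circ> (\<lambda>x. H (\<iota> x, 0))) x" for x by (simp add: F_def)
    show "F (x, t) = ((\<lambda>x. H (\<iota> x, 0)) \<circ> \<phi>) x" if "x \<in> boundary V" "t \<in> {0..1}" for x t
    proof -
      have "\<iota> x \<in> B" using that by (simp add: B_def)
      then have "H (\<iota> x, 1 - t) = H (\<iota> x, 1)" using H(8)[of "\<iota> x" "1 - t"] H(8)[of "\<iota> x" 1] that by auto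
      then show ?thesis using H1[of x] bd_points that by (auto simp: F_def)
    qed
    show "smooth_map (product V ?I) ?D F"
    proof (rule smooth_map_submanifoldI)
      show "chart_inverses_continuous (product V ?I)"
        by (rule chart_inverses_continuous_product[OF manifold_chart_inverses_continuous[OF V] chart_inverses_continuous_submanifold])
      have c1: "continuous_map (prod_topology (topo V) (top_of_set {0..1::real})) (prod_topology (top_of_set A) (top_of_set {0..1::real})) (\<lambda>z. (\<iota> (fst z), 1 - snd z))"
      proof (rule continuous_map_pairedI)
        have 1: "continuous_map (topo V) (top_of_set A) \<iota>"
          using cont_\<iota> by (auto simp: continuous_map_in_subtopology A_def)
        show "continuous_map (prod_topology (topo V) (top_of_set {0..1::real})) (top_of_set A) (\<lambda>z. \<iota> (fst z))"
          by (rule continuous_map_compose[OF continuous_map_fst 1, unfolded o_def])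
        have 2: "continuous_map (top_of_set {0..1::real}) (top_of_set {0..1::real}) (\<lambda>t. 1 - t)"
          by (auto intro!: continuous_intros)
        show "continuous_map (prod_topology (topo V) (top_of_set {0..1::real})) (top_of_set {0..1::real}) (\<lambda>z. 1 - snd z)"
          by (rule continuous_map_compose[OF continuous_map_snd 2, unfolded o_def])
      qed
      have c2: "continuous_map (prod_topology (top_of_set A) (top_of_set {0..1::real})) (top_of_set (cball 0 1)) H"
        unfolding subtopology_Times[symmetric]
        using continuous_on_subset[OF Cinf_continuous_on[OF H(1)] H(2)] H(4) by (auto simp: image_subset_iff)
      show "continuous_map (topo (product V ?I)) (top_of_set (cball 0 1)) F"
      proof -
        have "F = H \<circ> (\<lambda>z. (\<iota> (fst z), 1 - snd z))" by (auto simp: F_def)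
        then show ?thesis using continuous_map_compose[OF c1 c2] by (simp add: product_def)
      qed
      fix Q k assume "(Q, k) \<in> charts (product V ?I)"
      then obtain U c T d where Q: "Q = U \<times> T" "k = map_prod c d" and U: "(U, c) \<in> charts V" and T: "(T, d) \<in> charts ?I"
        by (auto simp: charts_product)
      note Uc = manifold_chart[OF V U]
      have T': "openin (top_of_set {0..1}) T" and Td: "inj_on d T" "smooth_on (d ` T) (inv_into T d)"
        using T by (auto simp: charts_submanifold)
      have T01: "T \<subseteq> {0..1}" using openin_subset[OF T'] by simp
      have kQ: "k ` Q = c ` U \<times> d ` T" unfolding Q by (auto simp: map_prod_def)
      have 1: "smooth_on (k ` Q) (\<lambda>z. \<iota> (inv_into U c (fst z)))"
        by (rule smooth_on_compose[OF smooth_on_fst[OF smooth_on_id] chart_inverse_smooth[OF U]]) (auto simp: kQ)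
      have 2: "smooth_on (k ` Q) (\<lambda>z. inv_into T d (snd z))"
        by (rule smooth_on_compose[OF smooth_on_snd[OF smooth_on_id] Td(2)]) (auto simp: kQ)
      have 3: "smooth_on (k ` Q) (\<lambda>z. 1 - inv_into T d (snd z))"
        by (rule smooth_on_Cinf_compose[OF _ 2]) (intro Cinf_diff Cinf_const Cinf_ident open_UNIV)
      have "smooth_on (k ` Q) (\<lambda>z. H (\<iota> (inv_into U c (fst z)), 1 - inv_into T d (snd z)))"
        by (rule smooth_on_compose[OF smooth_on_Pair[OF 1 3] smooth_on_Cinf[OF H(1,2)]])
          (use Uc(3,6) Td(1) T01 \<iota>A in \<open>auto simp: kQ subset_iff\<close>)
      then show "smooth_on (k ` Q) (F \<circ> inv_into Q k)"
      proof (rule smooth_on_cong)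
        fix z assume z: "z \<in> k ` Q"
        have "inv_into Q k z = (inv_into U c (fst z), inv_into T d (snd z))"
          unfolding Q by (rule inv_into_product_chart[OF Uc(3) Td(1)]) (use z kQ in simp)
        then show "H (\<iota> (inv_into U c (fst z)), 1 - inv_into T d (snd z)) = (F \<circ> inv_into Q k) z"
          by (simp add: F_def)
      qed
    qed
  qed
  then show ?thesis using pe[of 0] unfolding spun_embeds_def by auto
qed

end

section \<open>Open books\<close>

lemma topspace_quotient_topology [simp]: "topspace (quotient_topology X q) = q ` topspace X"
proof
  have "openin (quotient_topology X q) (topspace (quotient_topology X q))" by (rule openin_topspace)
  then show "topspace (quotient_topology X q) \<subseteq> q ` topspace X" unfolding openin_quotient_topology by blast
  have "{x \<in> topspace X. q x \<in> q ` topspace X} = topspace X" by auto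
  then have "openin (quotient_topology X q) (q ` topspace X)" unfolding openin_quotient_topology by simp
  then show "q ` topspace X \<subseteq> topspace (quotient_topology X q)" by (rule openin_subset)
qed

lemma continuous_map_quotient: "continuous_map X (quotient_topology X q) q"
  unfolding continuous_map_def by (auto simp: openin_quotient_topology)

lemma continuous_map_from_quotient:
  assumes "continuous_map X Y (\<lambda>x. g (q x))"
  shows "continuous_map (quotient_topology X q) Y g"
  unfolding continuous_map_def
proof (intro conjI allI impI)
  show "g \<in> topspace (quotient_topology X q) \<rightarrow> topspace Y"
    using assms by (auto simp: continuous_map_def)
  fix S assume "openin Y S"
  then have "openin X {x \<in> topspace X. g (q x) \<in> S}" using assms by (auto simp: continuous_map_def)
  moreover have "{x \<in> topspace X. q x \<in> {y \<in> q ` topspace X. g y \<in> S}} = {x \<in> topspace X. g (q x) \<in> S}" by auto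
  ultimately show "openin (quotient_topology X q) {x \<in> topspace (quotient_topology X q). g x \<in> S}"
    by (simp add: openin_quotient_topology)
qed

lemma restrict_to_UNIV: "restrict_to X UNIV = (X :: ('a, 'e) charted)"
proof -
  have "(\<lambda>(U, c). (U \<inter> UNIV, c)) ` charts X = charts X" by (auto simp: image_iff)
  then show ?thesis by (simp add: restrict_to_def)
qed

section \<open>Mapping tori and the space of an open book\<close>

locale page =
  fixes V :: "('a, 'e::euclidean_space) charted" and \<phi> :: "'a \<Rightarrow> 'a"
  assumes page: "page_with_monodromy V \<phi>"
begin

abbreviation T :: "(('a \<times> real) set, 'e \<times> real) charted" where "T \<equiv> mapping_torus V \<phi>"
abbreviation cls :: "'a \<times> real \<Rightarrow> ('a \<times> real) set" where "cls \<equiv> torus_class V \<phi>"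
abbreviation tinc where "tinc \<equiv> torus_inclusion V \<phi>"

lemma V: "manifold_with_boundary V" and compact_V: "compact_space (topo V)"
  using page by (auto simp: page_with_monodromy_def)

lemma \<phi>_in: "x \<in> points V \<Longrightarrow> \<phi> x \<in> points V" and inj_\<phi>: "inj_on \<phi> (points V)"
  using page by (auto simp: page_with_monodromy_def diffeomorphism_def bij_betw_def)

lemma \<phi>_boundary: "x \<in> boundary V \<Longrightarrow> \<phi> x = x"
  using page by (auto simp: page_with_monodromy_def)

lemma bd_points: "boundary V \<subseteq> points V" by (rule boundary_subset_points[OF V])

lemma funpow_in: "x \<in> points V \<Longrightarrow> (\<phi> ^^ k) x \<in> points V"
  by (induction k) (auto intro: \<phi>_in)

lemma funpow_inj: "x \<in> points V \<Longrightarrow> y \<in> points V \<Longrightarrow> (\<phi> ^^ k) x = (\<phi> ^^ k) y \<Longrightarrow> x = y"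
  by (induction k) (use inj_\<phi> funpow_in in \<open>auto simp: inj_on_def\<close>)

lemma funpow_boundary: "x \<in> boundary V \<Longrightarrow> (\<phi> ^^ k) x = x"
  by (induction k) (auto simp: \<phi>_boundary)

lemma funpow_eq_cancel:
  assumes "x \<in> points V" "y \<in> points V" "(\<phi> ^^ k) x = (\<phi> ^^ m) y" "m \<le> k"
  shows "(\<phi> ^^ (k - m)) x = y"
proof -
  have "(\<phi> ^^ m) ((\<phi> ^^ (k - m)) x) = (\<phi> ^^ m) y"
    using assms(3,4) by (simp flip: funpow_add[THEN fun_cong, unfolded o_def])
  then show ?thesis using funpow_inj funpow_in assms(1,2) by blast
qed

lemma torus_rel_iff:
  "((x, t), (y, s)) \<in> torus_rel V \<phi> \<longleftrightarrow> x \<in> points V \<and> y \<in> points V \<and>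
        (\<exists>k::nat. (t = s + real k \<and> y = (\<phi> ^^ k) x) \<or> (s = t + real k \<and> x = (\<phi> ^^ k) y))"
  by (simp add: torus_rel_def)

text \<open>The relation uses natural powers in both directions instead of integer powers. Two
  shifts in the same direction add up; opposite ones cancel, in one case by injectivity of the
  monodromy.\<close>

lemma torus_rel_trans_aux:
  assumes V: "x \<in> points V" "y \<in> points V" "z \<in> points V"
    and 1: "(t = s + real k \<and> y = (\<phi> ^^ k) x) \<or> (s = t + real k \<and> x = (\<phi> ^^ k) y)"
    and 2: "(s = w + real m \<and> z = (\<phi> ^^ m) y) \<or> (w = s + real m \<and> y = (\<phi> ^^ m) z)"
  shows "\<exists>k::nat. (t = w + real k \<and> z = (\<phi> ^^ k) x) \<or> (w = t + real k \<and> x = (\<phi> ^^ k) z)"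
  using 1 2
proof (elim disjE conjE)
  assume "t = s + real k" "y = (\<phi> ^^ k) x" "s = w + real m" "z = (\<phi> ^^ m) y"
  then show ?thesis by (intro exI[of _ "m + k"]) (simp add: funpow_add)
next
  assume *: "t = s + real k" "y = (\<phi> ^^ k) x" "w = s + real m" "y = (\<phi> ^^ m) z"
  show ?thesis
  proof (cases "m \<le> k")
    case True
    then show ?thesis using funpow_eq_cancel[OF V(1,3), of k m] * by (intro exI[of _ "k - m"]) (simp add: of_nat_diff)
  next
    case False
    then show ?thesis using funpow_eq_cancel[OF V(3,1), of m k] * by (intro exI[of _ "m - k"]) (simp add: of_nat_diff)
  qed
next
  assume *: "s = t + real k" "x = (\<phi> ^^ k) y" "s = w + real m" "z = (\<phi> ^^ m) y"
  show ?thesis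
  proof (cases "m \<le> k")
    case True
    then have "x = (\<phi> ^^ (k - m)) z" using * funpow_add[of "k - m" m \<phi>] by simp
    then show ?thesis using * True by (intro exI[of _ "k - m"]) (simp add: of_nat_diff)
  next
    case False
    then have "z = (\<phi> ^^ (m - k)) x" using * funpow_add[of "m - k" k \<phi>] by simp
    then show ?thesis using * False by (intro exI[of _ "m - k"]) (simp add: of_nat_diff)
  qed
next
  assume "s = t + real k" "x = (\<phi> ^^ k) y" "w = s + real m" "y = (\<phi> ^^ m) z"
  then show ?thesis by (intro exI[of _ "k + m"]) (simp add: funpow_add)
qed

lemma equiv_torus_rel: "equiv (points V \<times> UNIV) (torus_rel V \<phi>)"
proof (rule equivI)
  show "torus_rel V \<phi> \<subseteq> (points V \<times> UNIV) \<times> (points V \<times> UNIV)" by (auto simp: torus_rel_iff)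
  show "refl_on (points V \<times> UNIV) (torus_rel V \<phi>)"
    by (rule refl_onI) (auto simp: torus_rel_iff intro!: exI[of _ 0])
  show "sym (torus_rel V \<phi>)" by (rule symI) (auto simp: torus_rel_iff)
  show "trans (torus_rel V \<phi>)"
  proof (rule transI)
    fix p q r assume pqr: "(p, q) \<in> torus_rel V \<phi>" "(q, r) \<in> torus_rel V \<phi>"
    obtain x t y s z w where [simp]: "p = (x, t)" "q = (y, s)" "r = (z, w)" by (metis surj_pair)
    show "(p, r) \<in> torus_rel V \<phi>"
      using pqr torus_rel_trans_aux[of x y z t s _ w] by (auto simp: torus_rel_iff)
  qed
qed

lemma cls_eq_iff:
  "x \<in> points V \<Longrightarrow> y \<in> points V \<Longrightarrow> cls (x, t) = cls (y, s) \<longleftrightarrow> ((x, t), (y, s)) \<in> torus_rel V \<phi>"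
  unfolding torus_class_def using eq_equiv_class_iff[OF equiv_torus_rel] by simp

text \<open>Equivalent points differ by an integer in the angle, so within a strip of width
  \<open>1\<close> they coincide. This makes the torus charts well defined.\<close>

lemma cls_inj:
  assumes "x \<in> points V" "y \<in> points V" "\<bar>t - s\<bar> < 1" "cls (x, t) = cls (y, s)"
  shows "x = y" "t = s"
proof -
  obtain k :: nat where k: "(t = s + real k \<and> y = (\<phi> ^^ k) x) \<or> (s = t + real k \<and> x = (\<phi> ^^ k) y)"
    using assms(4) unfolding cls_eq_iff[OF assms(1,2)] torus_rel_iff by blast
  then have "real k < 1" using assms(3) by auto
  then have "k = 0" by simp
  then show "x = y" "t = s" using k by auto
qed

lemma cls_1: "x \<in> points V \<Longrightarrow> cls (x, 1) = cls (\<phi> x, 0)"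
  using cls_eq_iff[of x "\<phi> x" 1 0] \<phi>_in by (auto simp: torus_rel_iff intro!: exI[of _ 1])

lemma topo_T: "topo T = quotient_topology (prod_topology (topo V) euclideanreal) cls"
  by (simp add: mapping_torus_def)

lemma points_T: "points T = cls ` (points V \<times> UNIV)" by (simp add: topo_T)

lemma continuous_cls: "continuous_map (prod_topology (topo V) euclideanreal) (topo T) cls"
  unfolding topo_T by (rule continuous_map_quotient)

definition torus_chart :: "'a set \<Rightarrow> ('a \<Rightarrow> 'e) \<Rightarrow> real \<Rightarrow> ('a \<times> real) set \<Rightarrow> 'e \<times> real" where
  "torus_chart U c s = map_prod c id \<circ> inv_into (U \<times> {s<..<s+1}) cls"

lemma charts_T:
  "(Q, k) \<in> charts T \<longleftrightarrow> (\<exists>U c s. Q = cls ` (U \<times> {s<..<s+1}) \<and> k = torus_chart U c s \<and> (U, c) \<in> charts V)"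
  by (auto simp: mapping_torus_def torus_chart_def)

lemma inj_cls: "U \<subseteq> points V \<Longrightarrow> inj_on cls (U \<times> {s<..<s+1})"
  using cls_inj by (auto intro!: inj_onI simp: subset_iff) (smt (verit))+

lemma torus_chart_cls:
  "U \<subseteq> points V \<Longrightarrow> x \<in> U \<Longrightarrow> s < t \<Longrightarrow> t < s + 1 \<Longrightarrow> torus_chart U c s (cls (x, t)) = (c x, t)"
  using inv_into_f_f[OF inj_cls, of U "(x, t)" s] by (simp add: torus_chart_def)

lemma torus_chart_image: "U \<subseteq> points V \<Longrightarrow> torus_chart U c s ` cls ` (U \<times> {s<..<s+1}) = c ` U \<times> {s<..<s+1}"
  using torus_chart_cls[of U] by (force simp: image_iff)

lemma inj_torus_chart: "(U, c) \<in> charts V \<Longrightarrow> inj_on (torus_chart U c s) (cls ` (U \<times> {s<..<s+1}))"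
proof (rule inj_onI)
  fix p q assume U: "(U, c) \<in> charts V" and pq: "p \<in> cls ` (U \<times> {s<..<s+1})" "q \<in> cls ` (U \<times> {s<..<s+1})"
    "torus_chart U c s p = torus_chart U c s q"
  obtain x t y w where "p = cls (x, t)" "q = cls (y, w)" "x \<in> U" "y \<in> U" "t \<in> {s<..<s+1}" "w \<in> {s<..<s+1}"
    using pq by auto
  then show "p = q" using pq(3) torus_chart_cls[of U] manifold_chart(3,6)[OF V U] by (auto simp: inj_on_def)
qed

lemma inv_torus_chart:
  assumes U: "(U, c) \<in> charts V" and z: "z \<in> c ` U \<times> {s<..<s+1}"
  shows "inv_into (cls ` (U \<times> {s<..<s+1})) (torus_chart U c s) z = cls (inv_into U c (fst z), snd z)"
proof -
  obtain x t where x: "x \<in> U" "s < t" "t < s + 1" "z = (c x, t)" using z by auto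
  have "inv_into (cls ` (U \<times> {s<..<s+1})) (torus_chart U c s) (torus_chart U c s (cls (x, t))) = cls (x, t)"
    by (rule inv_into_f_f[OF inj_torus_chart[OF U]]) (use x in auto)
  then show ?thesis using x torus_chart_cls[of U x s t c] manifold_chart(3,6)[OF V U] by simp
qed

lemma chart_inverses_continuous_T: "chart_inverses_continuous T"
  unfolding chart_inverses_continuous_def
proof (clarify, intro conjI)
  fix Q k assume "(Q, k) \<in> charts T"
  then obtain U c s where Q: "Q = cls ` (U \<times> {s<..<s+1})" "k = torus_chart U c s" and U: "(U, c) \<in> charts V"
    by (auto simp: charts_T)
  note Uc = manifold_chart[OF V U]
  show "Q \<subseteq> points T" using Uc(6) by (auto simp: Q points_T)
  show "inj_on k Q" unfolding Q by (rule inj_torus_chart[OF U])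
  have kQ: "k ` Q = c ` U \<times> {s<..<s+1}" unfolding Q by (rule torus_chart_image[OF Uc(6)])
  have "continuous_map (prod_topology (top_of_set (c ` U)) (top_of_set {s<..<s+1}))
      (prod_topology (topo V) euclideanreal) (\<lambda>z. (inv_into U c (fst z), snd z))"
    by (intro continuous_map_pairedI continuous_map_compose[OF continuous_map_fst Uc(4), unfolded o_def]
        continuous_map_into_fulltopology[OF continuous_map_snd])
  then have "continuous_map (top_of_set (k ` Q)) (prod_topology (topo V) euclideanreal) (\<lambda>z. (inv_into U c (fst z), snd z))"
    unfolding kQ subtopology_Times[symmetric] by simp
  then have "continuous_map (top_of_set (k ` Q)) (topo T) (cls \<circ> (\<lambda>z. (inv_into U c (fst z), snd z)))"
    using continuous_cls by (rule continuous_map_compose)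
  then show "continuous_map (top_of_set (k ` Q)) (topo T) (inv_into Q k)"
    by (rule continuous_map_eq) (use inv_torus_chart[OF U] kQ Q in auto)
qed

text \<open>Powers of the monodromy fix boundary points, so such a class consists of integer shifts
  of one point. An arbitrary representative therefore yields the same point of the binding and the
  same point of the circle.\<close>

lemma cls_boundary:
  assumes b: "b \<in> boundary V" and p: "p \<in> cls (b, t)"
  shows "fst p = b" "cis (2 * pi * snd p) = cis (2 * pi * t)"
proof -
  obtain y s where ys: "p = (y, s)" by (cases p)
  have bV: "b \<in> points V" using b bd_points by auto
  obtain k :: nat where y: "y \<in> points V" and k: "(t = s + real k \<and> y = (\<phi> ^^ k) b) \<or> (s = t + real k \<and> b = (\<phi> ^^ k) y)"
    using p unfolding ys torus_class_def Image_singleton_iff torus_rel_iff by blast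
  have "y = b" using k funpow_boundary[OF b, of k] funpow_inj[OF y bV, of k] by auto
  then show "fst p = b" using ys by simp
  have "cis (2 * pi * real k) = 1" using cis_multiple_2pi[of "real k"] by simp
  then have "cis (2 * pi * (w + real k)) = cis (2 * pi * w)" for w
    by (simp add: distrib_left flip: cis_mult)
  then show "cis (2 * pi * snd p) = cis (2 * pi * t)" using k ys by auto
qed

lemma cls_self: "x \<in> points V \<Longrightarrow> (x, t) \<in> cls (x, t)"
  by (auto simp: torus_class_def torus_rel_iff intro!: exI[of _ 0])

lemma cls_in_torus_boundary:
  assumes "x \<in> points V" shows "cls (x, t) \<in> torus_boundary V \<phi> \<longleftrightarrow> x \<in> boundary V"
proof
  assume "cls (x, t) \<in> torus_boundary V \<phi>"
  then obtain b s where b: "b \<in> boundary V" "cls (x, t) = cls (b, s)" by (auto simp: torus_boundary_def)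
  then show "x \<in> boundary V" using cls_boundary(1)[OF b(1), of "(x, t)" s] cls_self[OF assms, of t] by auto
qed (auto simp: torus_boundary_def)

lemma boundary_identification_cls:
  assumes "b \<in> boundary V" shows "boundary_identification (cls (b, t)) = (b, cis (2 * pi * t))"
proof -
  have "(SOME p. p \<in> cls (b, t)) \<in> cls (b, t)"
    using someI[of "\<lambda>p. p \<in> cls (b, t)", OF cls_self[of b t]] assms bd_points by blast
  from cls_boundary[OF assms this] show ?thesis
    unfolding boundary_identification_def by (simp add: split_beta)
qed

lemma tinc_boundary: "b \<in> boundary V \<Longrightarrow> tinc (cls (b, t)) = Inr (b, cis (2 * pi * t))"
  using cls_in_torus_boundary[of b t] bd_points boundary_identification_cls[of b t]
  by (auto simp: torus_inclusion_def glue_left_def)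

lemma tinc_interior: "x \<in> points V \<Longrightarrow> x \<notin> boundary V \<Longrightarrow> tinc (cls (x, t)) = Inl (cls (x, t))"
  using cls_in_torus_boundary[of x t] by (auto simp: torus_inclusion_def glue_left_def)

abbreviation BN where "BN \<equiv> binding_nbhd V"

lemma topo_BN: "topo BN = prod_topology (subtopology (topo V) (boundary V)) (top_of_set (cball 0 1))"
  by (simp add: binding_nbhd_def product_def restrict_to_def)

lemma points_BN: "points BN = boundary V \<times> cball 0 1"
  using bd_points by (auto simp: topo_BN)

lemma ci_BN: "chart_inverses_continuous BN"
  unfolding binding_nbhd_def
  by (intro chart_inverses_continuous_product chart_inverses_continuous_restrict
      chart_inverses_continuous_submanifold manifold_chart_inverses_continuous[OF V])

lemma topspace_adjunction:
  assumes "\<And>x. x \<in> topspace X \<Longrightarrow> x \<in> S \<Longrightarrow> h x \<in> topspace Y"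
  shows "topspace (adjunction_topology X Y S h) = Inl ` (topspace X - S) \<union> Inr ` topspace Y"
proof
  have "openin (adjunction_topology X Y S h) (topspace (adjunction_topology X Y S h))" by (rule openin_topspace)
  then show "topspace (adjunction_topology X Y S h) \<subseteq> Inl ` (topspace X - S) \<union> Inr ` topspace Y"
    unfolding openin_adjunction_topology by blast
  have "{x \<in> topspace X. glue_left S h x \<in> Inl ` (topspace X - S) \<union> Inr ` topspace Y} = topspace X"
    using assms by (auto simp: glue_left_def)
  moreover have "{y \<in> topspace Y. (Inr y :: 'b + 'c) \<in> Inl ` (topspace X - S) \<union> Inr ` topspace Y} = topspace Y" by auto
  ultimately have "openin (adjunction_topology X Y S h) (Inl ` (topspace X - S) \<union> Inr ` topspace Y)"
    unfolding openin_adjunction_topology by simp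
  then show "Inl ` (topspace X - S) \<union> Inr ` topspace Y \<subseteq> topspace (adjunction_topology X Y S h)"
    by (rule openin_subset)
qed

abbreviation OB where "OB \<equiv> open_book_space V \<phi>"

lemma topspace_OB: "topspace OB = Inl ` (points T - torus_boundary V \<phi>) \<union> Inr ` points BN"
  unfolding open_book_space_def
proof (rule topspace_adjunction)
  fix P assume "P \<in> torus_boundary V \<phi>"
  then obtain b t where "b \<in> boundary V" "P = cls (b, t)" by (auto simp: torus_boundary_def)
  then show "boundary_identification P \<in> points BN"
    by (simp add: boundary_identification_cls points_BN)
qed

lemma openin_OB:
  "openin OB S \<longleftrightarrow> S \<subseteq> topspace OB \<and> openin (topo T) {x \<in> points T. tinc x \<in> S} \<and>
     openin (topo BN) {y \<in> points BN. Inr y \<in> S}"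
  unfolding topspace_OB unfolding open_book_space_def openin_adjunction_topology torus_inclusion_def by blast

lemma tinc_OB: "P \<in> points T \<Longrightarrow> tinc P \<in> topspace OB"
proof -
  assume P: "P \<in> points T"
  show ?thesis
  proof (cases "P \<in> torus_boundary V \<phi>")
    case True
    then obtain b t where "b \<in> boundary V" "P = cls (b, t)" by (auto simp: torus_boundary_def)
    then show ?thesis by (simp add: tinc_boundary topspace_OB points_BN)
  next
    case False
    then show ?thesis using P by (simp add: torus_inclusion_def glue_left_def topspace_OB)
  qed
qed

lemma continuous_tinc: "continuous_map (topo T) OB tinc"
  unfolding continuous_map_def using tinc_OB openin_OB by blast

lemma continuous_Inr: "continuous_map (topo BN) OB Inr"
  unfolding continuous_map_def using topspace_OB openin_OB by blast

lemma OB_cases: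
  assumes "s \<in> topspace OB"
  obtains (torus) x t where "x \<in> points V" "s = tinc (cls (x, t))"
    | (binding) b z where "b \<in> boundary V" "norm z \<le> 1" "s = Inr (b, z)"
proof -
  consider P where "P \<in> points T" "P \<notin> torus_boundary V \<phi>" "s = Inl P" | p where "p \<in> points BN" "s = Inr p"
    using assms unfolding topspace_OB by blast
  then show thesis
  proof cases
    case 1
    then obtain x t where x: "x \<in> points V" "P = cls (x, t)" unfolding points_T by auto
    then have "s = tinc (cls (x, t))" using 1 by (simp add: torus_inclusion_def glue_left_def)
    then show thesis using x(1) torus by blast
  next
    case 2
    then show thesis using binding unfolding points_BN by auto
  qed
qed

lemma continuous_from_OB:
  assumes g: "continuous_map (topo T) Z (\<lambda>x. g (tinc x))" "continuous_map (topo BN) Z (\<lambda>x. g (Inr x))"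
  shows "continuous_map OB Z g"
  unfolding continuous_map_def
proof (intro conjI allI impI)
  show "g \<in> topspace OB \<rightarrow> topspace Z"
  proof
    fix s assume "s \<in> topspace OB"
    then show "g s \<in> topspace Z"
    proof (cases rule: OB_cases)
      case (torus x t)
      then have "cls (x, t) \<in> points T" by (simp add: points_T)
      then show ?thesis using g(1) torus(2) by (auto simp: continuous_map_def)
    next
      case (binding b z)
      then have "(b, z) \<in> points BN" by (simp add: points_BN)
      then show ?thesis using g(2) binding(3) by (auto simp: continuous_map_def)
    qed
  qed
  fix U assume U: "openin Z U"
  have "{x \<in> points T. tinc x \<in> {s \<in> topspace OB. g s \<in> U}} = {x \<in> points T. g (tinc x) \<in> U}"
    using tinc_OB by auto
  moreover have "{y \<in> points BN. Inr y \<in> {s \<in> topspace OB. g s \<in> U}} = {y \<in> points BN. g (Inr y) \<in> U}"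
    by (auto simp: topspace_OB)
  ultimately show "openin OB {s \<in> topspace OB. g s \<in> U}"
    using g U unfolding openin_OB by (auto simp: continuous_map_def)
qed

lemma compact_BN: "compact_space (topo BN)"
  using closedin_compact_space[OF compact_V closedin_boundary[OF V]] compactin_subspace
  by (auto simp: topo_BN compact_space_prod_topology compact_space_subtopology)

end

section \<open>An arbitrary open book of the sphere\<close>

locale sphere_book = page V \<phi> for V :: "('a, 'e::euclidean_space) charted" and \<phi> +
  fixes N :: "(('a \<times> real) set + 'a \<times> complex, 'e \<times> real) charted"
    and f :: "'f::euclidean_space \<Rightarrow> ('a \<times> real) set + 'a \<times> complex"
  assumes book: "is_open_book V \<phi> N"
    and sphere: "closed_manifold (submanifold (sphere 0 1) :: ('f, 'e \<times> real) charted)"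
    and f: "diffeomorphism (submanifold (sphere 0 1) :: ('f, 'e \<times> real) charted) N f"
begin

abbreviation M :: "('f, 'e \<times> real) charted" where "M \<equiv> submanifold (sphere 0 1)"
abbreviation C where "C \<equiv> tinc ` points T"

definition q where "q = inv_into (sphere 0 1) f"
definition e' :: "'a \<times> real \<Rightarrow> 'f" where "e' p = q (tinc (cls p))"
definition E' :: "'a \<times> complex \<Rightarrow> 'f" where "E' p = q (Inr p)"

lemma M: "manifold_with_boundary M" and N: "manifold_with_boundary N"
  using sphere book by (auto simp: is_open_book_def closed_manifold_def)

lemma f_bij: "bij_betw f (sphere 0 1) (points N)" and f_smooth: "smooth_map M N f" and q_smooth: "smooth_map N M q"
  using f by (auto simp: diffeomorphism_def q_def)

lemma f_q: "y \<in> points N \<Longrightarrow> f (q y) = y" and q_sphere: "y \<in> points N \<Longrightarrow> q y \<in> sphere 0 1"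
  using f_bij inv_into_into[of y f "sphere 0 1"] f_inv_into_f[of y f "sphere 0 1"]
  by (simp_all add: q_def bij_betw_def)

lemma q_inj: "inj_on q (points N)" by (rule inj_on_inverseI[of _ f]) (rule f_q)

lemma tinc_diffeo: "diffeomorphism T (restrict_to N C) tinc"
  and Inr_diffeo: "diffeomorphism BN (restrict_to N (Inr ` points BN)) Inr"
  using book by (auto simp: is_open_book_def)

lemma smooth_map_from_restrict: "smooth_map X Y g \<Longrightarrow> chart_inverses_continuous X \<Longrightarrow> smooth_map (restrict_to X S) Y g"
  using smooth_map_restrict[of X Y g S UNIV] by (simp add: restrict_to_UNIV)

lemma ci_N: "chart_inverses_continuous N" and ci_M: "chart_inverses_continuous M"
  by (rule manifold_chart_inverses_continuous[OF N], rule manifold_chart_inverses_continuous[OF M])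

lemma oa_N: "open_atlas (restrict_to N S)" and oa_M: "open_atlas M"
  by (rule open_atlas_restrict[OF manifold_open_atlas[OF N]], rule manifold_open_atlas[OF M])

lemma C_points: "C \<subseteq> points N"
proof -
  have "continuous_map (topo T) (topo (restrict_to N C)) tinc"
    using tinc_diffeo by (simp add: diffeomorphism_def smooth_map_def)
  then show ?thesis by (auto simp: restrict_to_def continuous_map_def)
qed

lemma BN_points: "Inr ` points BN \<subseteq> points N"
proof -
  have "continuous_map (topo BN) (topo (restrict_to N (Inr ` points BN))) Inr"
    using Inr_diffeo by (simp add: diffeomorphism_def smooth_map_def)
  then show ?thesis by (auto simp: restrict_to_def continuous_map_def)
qed

text \<open>The structure of \<open>N\<close> is prescribed on the two pieces separately, so the
  composition passes through \<open>N\<close> restricted to the image of the torus.\<close>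

lemma qT: "smooth_map T M (q \<circ> tinc)"
  by (rule smooth_map_compose[where Y="restrict_to N C", OF _ smooth_map_from_restrict[OF q_smooth ci_N] chart_inverses_continuous_T oa_N])
    (use tinc_diffeo in \<open>simp add: diffeomorphism_def\<close>)

lemma qB: "smooth_map BN M (q \<circ> Inr)"
  by (rule smooth_map_compose[where Y="restrict_to N (Inr ` points BN)", OF _ smooth_map_from_restrict[OF q_smooth ci_N] ci_BN oa_N])
    (use Inr_diffeo in \<open>simp add: diffeomorphism_def\<close>)

text \<open>The inverse of one piece as a smooth map on the part of the sphere that it occupies.
  Followed by charts, it yields the smooth left inverses demanded by
  \<open>book_maps\<close>.\<close>

lemma inverse_smooth:
  assumes d: "diffeomorphism X (restrict_to N S) h"
  shows "smooth_map (restrict_to M {p \<in> sphere 0 1. f p \<in> S}) X (inv_into (points X) h \<circ> f)"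
proof (rule smooth_map_compose)
  show "smooth_map (restrict_to M {p \<in> sphere 0 1. f p \<in> S}) (restrict_to N S) f"
    by (rule smooth_map_restrict[OF f_smooth ci_M]) auto
  show "smooth_map (restrict_to N S) X (inv_into (points X) h)"
    using d by (simp add: diffeomorphism_def)
qed (rule chart_inverses_continuous_restrict[OF ci_M], rule oa_N)

lemma book_maps: "book_maps V \<phi> e' E'"
proof
  show "page_with_monodromy V \<phi>" by (rule page)
  have clsT: "cls (x, t) \<in> points T" if "x \<in> points V" for x t using that by (auto simp: points_T)
  have tN: "tinc (cls (x, t)) \<in> points N" if "x \<in> points V" for x t
    using clsT[OF that] C_points by blast
  have iN: "Inr (x, z) \<in> points N" if "x \<in> boundary V" "norm z \<le> 1" for x and z :: complex
    using BN_points points_BN that by auto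
  have tinc_inj: "inj_on tinc (points T)" using tinc_diffeo by (simp add: diffeomorphism_def bij_betw_def)
  show "continuous_map (topo V) euclidean (\<lambda>x. e' (x, t))" for t
  proof -
    have "continuous_map (topo T) (top_of_set (sphere 0 1)) (q \<circ> tinc)" using qT by (simp add: smooth_map_def)
    moreover have "continuous_map (topo V) (topo T) (cls \<circ> (\<lambda>x. (x, t)))"
      by (rule continuous_map_compose[OF _ continuous_cls]) (auto simp: continuous_map_pairedI)
    ultimately have "continuous_map (topo V) (top_of_set (sphere 0 1)) ((q \<circ> tinc) \<circ> (cls \<circ> (\<lambda>x. (x, t))))"
      by (rule continuous_map_compose[rotated])
    then show ?thesis by (simp add: e'_def[abs_def] o_def continuous_map_in_subtopology)
  qed
  show "inj_on (\<lambda>x. e' (x, t)) (points V)" for t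
  proof (rule inj_onI)
    fix x y assume xy: "x \<in> points V" "y \<in> points V" "e' (x, t) = e' (y, t)"
    then have "tinc (cls (x, t)) = tinc (cls (y, t))"
      unfolding e'_def by (rule_tac inj_onD[OF q_inj _ tN tN])
    then have "cls (x, t) = cls (y, t)" by (rule inj_onD[OF tinc_inj _ clsT[OF xy(1)] clsT[OF xy(2)]])
    then show "x = y" using cls_inj(1)[OF xy(1,2), of t t] by simp
  qed
  show "norm (e' (x, t)) = 1" if "x \<in> points V" for x t
    using q_sphere[OF tN[OF that]] by (simp add: e'_def)
  show "e' (x, 1) = e' (\<phi> x, 0)" if "x \<in> points V" for x
    using cls_1[OF that] by (simp add: e'_def)
  show "continuous_map (prod_topology (subtopology (topo V) (boundary V)) (top_of_set (cball 0 1))) euclidean E'"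
    using qB by (simp add: smooth_map_def topo_BN E'_def[abs_def] o_def continuous_map_in_subtopology)
  show "inj_on E' (boundary V \<times> cball 0 1)"
    using inj_onD[OF q_inj] iN by (fastforce intro!: inj_onI simp: E'_def)
  show "norm (E' (x, z)) = 1" if "x \<in> boundary V" "norm z \<le> 1" for x z
    using q_sphere[OF iN[OF that]] by (simp add: E'_def)
  show "e' (x, t) = E' (x, cis (2 * pi * t))" if "x \<in> boundary V" for x t
    using tinc_boundary[OF that] by (simp add: e'_def E'_def)
next
  fix U c assume U: "(U, c) \<in> charts V"
  note Uc = manifold_chart[OF V U]
  show "smooth_on (c ` U \<times> UNIV) (\<lambda>(y, t). e' (inv_into U c y, t))"
  proof (rule smooth_on_local)
    fix z assume z: "z \<in> c ` U \<times> (UNIV :: real set)"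
    \<comment> \<open>Torus charts cover angles in an interval of length \<open>1\<close>; this one
      is centred at the angle of \<open>z\<close>.\<close>
    define s where "s = snd z - 1 / 2"
    have "smooth_on (torus_chart U c s ` cls ` (U \<times> {s<..<s+1})) (q \<circ> tinc \<circ> inv_into (cls ` (U \<times> {s<..<s+1})) (torus_chart U c s))"
      by (rule smooth_map_submanifoldD[OF qT chart_inverses_continuous_T oa_M]) (use U charts_T in blast)
    then have "smooth_on (c ` U \<times> {s<..<s+1}) (\<lambda>(y, t). e' (inv_into U c y, t))"
      unfolding torus_chart_image[OF Uc(6)]
      by (rule smooth_on_cong) (use inv_torus_chart[OF U, of _ s] in \<open>auto simp: e'_def\<close>)
    moreover have "c ` U \<times> UNIV \<inter> UNIV \<times> {s<..<s+1} = c ` U \<times> {s<..<s+1}" by auto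
    moreover have "open ((UNIV :: 'e set) \<times> {s<..<s+1})" by (intro open_Times) auto
    moreover have "z \<in> UNIV \<times> {s<..<s+1}" by (simp add: s_def mem_Times_iff)
    ultimately show "\<exists>S. open S \<and> z \<in> S \<and> smooth_on (c ` U \<times> UNIV \<inter> S) (\<lambda>(y, t). e' (inv_into U c y, t))"
      by metis
  qed
next
  fix U c and t :: real assume U: "(U, c) \<in> charts V"
  note Uc = manifold_chart[OF V U]
  define s where "s = t - 1 / 2"
  let ?D = "{p \<in> sphere 0 1. f p \<in> C}" and ?q = "inv_into (points T) tinc \<circ> f"
    and ?Q = "cls ` (U \<times> {s<..<s+1})"
  have "smooth_on {x \<in> ?D. ?q x \<in> ?Q} (torus_chart U c s \<circ> ?q)"
    by (rule smooth_map_from_restrict_submanifoldD[OF inverse_smooth[OF tinc_diffeo] oa_M]) (use U charts_T in blast)+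
  then have 1: "smooth_on {x \<in> ?D. ?q x \<in> ?Q} (\<lambda>p. fst ((torus_chart U c s \<circ> ?q) p))" by (rule smooth_on_fst)
  have 2: "e' (x, t) \<in> ?D \<and> ?q (e' (x, t)) = cls (x, t)" if "x \<in> U" for x
  proof -
    have clsT: "cls (x, t) \<in> points T" using that Uc(6) by (auto simp: points_T)
    then have tN: "tinc (cls (x, t)) \<in> points N" using C_points by blast
    have "inj_on tinc (points T)" using tinc_diffeo by (simp add: diffeomorphism_def bij_betw_def)
    then show ?thesis using f_q[OF tN] q_sphere[OF tN] clsT by (simp add: e'_def)
  qed
  show "\<exists>h. smooth_on ((\<lambda>x. e' (x, t)) ` U) h \<and> (\<forall>x\<in>U. h (e' (x, t)) = c x)"
  proof (intro exI conjI ballI)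
    show "smooth_on ((\<lambda>x. e' (x, t)) ` U) (\<lambda>p. fst ((torus_chart U c s \<circ> ?q) p))"
      by (rule smooth_on_subset[OF 1]) (use 2 in \<open>auto simp: s_def\<close>)
    show "fst ((torus_chart U c s \<circ> ?q) (e' (x, t))) = c x" if "x \<in> U" for x
      using 2[OF that] torus_chart_cls[OF Uc(6) that, of s t c] by (simp add: s_def)
  qed
next
  fix U c assume U: "(U, c) \<in> charts V"
  note Uc = manifold_chart[OF V U]
  let ?Z = "submanifold (cball 0 1) :: (complex, complex) charted"
  have UB: "(U \<inter> boundary V, c) \<in> charts (restrict_to V (boundary V))" using U by (force simp: restrict_to_def)
  have injB: "inj_on c (U \<inter> boundary V)" using Uc(3) by (rule inj_on_subset) auto
  show "smooth_on (c ` (U \<inter> boundary V) \<times> cball 0 1) (\<lambda>(y, z). E' (inv_into U c y, z))" (is "smooth_on ?A ?f")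
  proof (rule smooth_on_local)
    fix w assume w: "w \<in> ?A"
    then have "snd w \<in> points ?Z" by auto
    then obtain W d where W: "(W, d) \<in> charts ?Z" "snd w \<in> W"
      using manifold_chart_at[OF manifold_cball] by blast
    have Wd: "inj_on d W" "smooth_on W d" "openin (top_of_set (cball 0 1)) W" using W(1) by (auto simp: charts_submanifold)
    obtain S where S: "open S" "W = cball 0 1 \<inter> S" using Wd(3) by (auto simp: openin_open)
    let ?Q = "(U \<inter> boundary V) \<times> W"
    have "(?Q, map_prod c d) \<in> charts BN" using UB W(1) by (auto simp: binding_nbhd_def charts_product)
    then have 1: "smooth_on (map_prod c d ` ?Q) (q \<circ> Inr \<circ> inv_into ?Q (map_prod c d))"
      by (rule smooth_map_submanifoldD[OF qB ci_BN oa_M])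
    have im: "map_prod c d ` ?Q = c ` (U \<inter> boundary V) \<times> d ` W" by (auto simp: map_prod_def)
    have "smooth_on (?A \<inter> UNIV \<times> S) (\<lambda>w. (fst w, d (snd w)))"
      by (intro smooth_on_Pair smooth_on_fst smooth_on_id smooth_on_compose[OF smooth_on_snd[OF smooth_on_id] Wd(2)])
        (use S in auto)
    then have "smooth_on (?A \<inter> UNIV \<times> S) (\<lambda>w. (q \<circ> Inr \<circ> inv_into ?Q (map_prod c d)) (fst w, d (snd w)))"
      by (rule smooth_on_compose[OF _ 1]) (use S im in auto)
    then have "smooth_on (?A \<inter> UNIV \<times> S) ?f"
    proof (rule smooth_on_cong)
      fix v assume v: "v \<in> ?A \<inter> UNIV \<times> S"
      then obtain x z where x: "x \<in> U" "x \<in> boundary V" "z \<in> W" "v = (c x, z)" using S(2) by auto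
      have "inv_into ?Q (map_prod c d) (c x, d z) = (x, z)"
        using inv_into_product_chart[OF injB Wd(1), of "(c x, d z)"] x injB Wd(1) by simp
      then show "(q \<circ> Inr \<circ> inv_into ?Q (map_prod c d)) (fst v, d (snd v)) = ?f v"
        using x Uc(3) by (simp add: E'_def)
    qed
    moreover have "open ((UNIV :: 'e set) \<times> S)" using S(1) by (intro open_Times) auto
    moreover have "w \<in> UNIV \<times> S" using W(2) S(2) by (auto simp: mem_Times_iff)
    ultimately show "\<exists>S. open S \<and> w \<in> S \<and> smooth_on (?A \<inter> S) ?f" by blast
  qed
  let ?D = "{p \<in> sphere 0 1. f p \<in> Inr ` points BN}" and ?q = "inv_into (points BN) Inr \<circ> f"
  let ?B = "E' ` ((U \<inter> boundary V) \<times> cball 0 1)"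
  have sm: "smooth_map (restrict_to M ?D) BN ?q" by (rule inverse_smooth[OF Inr_diffeo])
  have 2: "E' (x, z) \<in> ?D \<and> ?q (E' (x, z)) = (x, z)" if "x \<in> boundary V" "z \<in> cball 0 1" for x z
  proof -
    have BN: "(x, z) \<in> points BN" using that points_BN by auto
    then have "Inr (x, z) \<in> points N" using BN_points by blast
    then show ?thesis using f_q q_sphere BN inv_into_f_f[of Inr "points BN" "(x, z)"] by (auto simp: E'_def)
  qed
  have "smooth_on ?B (\<lambda>p. c (fst (?q p)))"
  proof (rule smooth_on_local)
    fix p assume "p \<in> ?B"
    then obtain x z where x: "x \<in> U" "x \<in> boundary V" "z \<in> cball 0 1" "p = E' (x, z)" by auto
    have "z \<in> points ?Z" using x(3) by simp
    then obtain W d where W: "(W, d) \<in> charts ?Z" "z \<in> W"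
      using manifold_chart_at[OF manifold_cball] by blast
    have Wo: "openin (top_of_set (cball 0 1)) W" using W(1) by (auto simp: charts_submanifold)
    let ?Q = "(U \<inter> boundary V) \<times> W"
    have Q: "(?Q, map_prod c d) \<in> charts BN" using UB W(1) by (auto simp: binding_nbhd_def charts_product)
    have 3: "smooth_on {x \<in> ?D. ?q x \<in> ?Q} (map_prod c d \<circ> ?q)"
      by (rule smooth_map_from_restrict_submanifoldD[OF sm oa_M _ Q]) auto
    \<comment> \<open>Only the second coordinate has to be localised: on \<open>?B\<close> the first
      one already lies in the chart domain \<open>U\<close>.\<close>
    have "openin (topo BN) ((points V \<inter> boundary V) \<times> W)"
      using Wo bd_points unfolding topo_BN openin_prod_Times_iff
      by (metis inf.commute openin_subtopology_Int2 openin_topspace topspace_subtopology)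
    moreover have "continuous_map (topo (restrict_to M ?D)) (topo BN) ?q" using sm by (simp add: smooth_map_def)
    ultimately have "openin (topo (restrict_to M ?D)) {p \<in> points (restrict_to M ?D). ?q p \<in> (points V \<inter> boundary V) \<times> W}"
      by (rule openin_continuous_map_preimage[rotated])
    moreover have "topo (restrict_to M ?D) = top_of_set ?D"
      by (auto simp: restrict_to_def subtopology_subtopology intro!: arg_cong[of _ _ top_of_set])
    ultimately have "openin (top_of_set ?D) {p \<in> ?D. ?q p \<in> (points V \<inter> boundary V) \<times> W}" by simp
    then obtain S where S: "open S" "{p \<in> ?D. ?q p \<in> (points V \<inter> boundary V) \<times> W} = ?D \<inter> S" by (auto simp: openin_open)
    have inQ: "p' \<in> {x \<in> ?D. ?q x \<in> ?Q}" if p': "p' \<in> ?B \<inter> S" for p'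
    proof -
      obtain y v where y: "y \<in> U" "y \<in> boundary V" "v \<in> cball 0 1" "p' = E' (y, v)" using p' by auto
      then have "p' \<in> ?D \<inter> S" using p' 2 by blast
      then have "?q p' \<in> (points V \<inter> boundary V) \<times> W" unfolding S(2)[symmetric] by blast
      then show ?thesis using y 2[OF y(2,3)] by auto
    qed
    have "smooth_on (?B \<inter> S) (\<lambda>p. fst ((map_prod c d \<circ> ?q) p))"
      by (rule smooth_on_fst[OF smooth_on_subset[OF 3]]) (use inQ in blast)
    then have "smooth_on (?B \<inter> S) (\<lambda>p. c (fst (?q p)))" by (simp add: fst_map_prod)
    moreover have "p \<in> S"
    proof -
      have "p \<in> {p \<in> ?D. ?q p \<in> (points V \<inter> boundary V) \<times> W}" using 2[OF x(2,3)] x W(2) bd_points by auto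
      then show ?thesis unfolding S(2) by blast
    qed
    ultimately show "\<exists>S. open S \<and> p \<in> S \<and> smooth_on (?B \<inter> S) (\<lambda>p. c (fst (?q p)))"
      using S(1) by blast
  qed
  moreover have "\<forall>x\<in>U \<inter> boundary V. \<forall>z\<in>cball 0 1. c (fst (?q (E' (x, z)))) = c x"
    using 2 by simp
  ultimately show "\<exists>h. smooth_on ?B h \<and> (\<forall>x\<in>U \<inter> boundary V. \<forall>z\<in>cball 0 1. h (E' (x, z)) = c x)"
    by blast
qed

end

section \<open>Smooth structures pulled back along a homeomorphism\<close>

text \<open>Turns \<open>\<Psi>\<close> into a diffeomorphism by decree. The smooth structure on the
  standard open book is obtained in this way from the sphere, so that nothing has to be
  glued.\<close>

definition pullback :: "'p topology \<Rightarrow> ('p \<Rightarrow> 'm) \<Rightarrow> ('m, 'e) charted \<Rightarrow> ('p, 'e) charted" where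
  "pullback X \<Psi> M = \<lparr>topo = X, charts = (\<lambda>(U, c). ({x \<in> topspace X. \<Psi> x \<in> U}, c \<circ> \<Psi>)) ` charts M\<rparr>"

lemma topo_pullback [simp]: "topo (pullback X \<Psi> M) = X" by (simp add: pullback_def)

lemma charts_pullback:
  "(P, k) \<in> charts (pullback X \<Psi> M) \<longleftrightarrow>
    (\<exists>U c. (U, c) \<in> charts M \<and> P = {x \<in> topspace X. \<Psi> x \<in> U} \<and> k = c \<circ> \<Psi>)"
  by (auto simp: pullback_def)

locale pulled_back =
  fixes X :: "'p topology" and \<Psi> :: "'p \<Rightarrow> 'm" and M :: "('m, 'e::euclidean_space) charted"
  assumes homeo: "homeomorphic_map X (topo M) \<Psi>" and M: "closed_manifold M"
begin

abbreviation N where "N \<equiv> pullback X \<Psi> M"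

lemma manifold_M: "manifold_with_boundary M" using M by (simp add: closed_manifold_def)

lemma inj_\<Psi>: "inj_on \<Psi> (topspace X)" and im_\<Psi>: "\<Psi> ` topspace X = points M"
  and cont_\<Psi>: "continuous_map X (topo M) \<Psi>"
  using homeomorphic_imp_injective_map[OF homeo] homeomorphic_imp_surjective_map[OF homeo]
    homeomorphic_imp_continuous_map[OF homeo] by auto

lemma chart_image:
  assumes "U \<subseteq> points M" shows "(c \<circ> \<Psi>) ` {x \<in> topspace X. \<Psi> x \<in> U} = c ` U"
proof -
  have "\<Psi> ` {x \<in> topspace X. \<Psi> x \<in> U} = U" using im_\<Psi> assms by auto
  then show ?thesis by (metis image_comp)
qed

lemma chart_inverse:
  assumes U: "(U, c) \<in> charts M" and x: "x \<in> topspace X" "\<Psi> x \<in> U"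
  shows "inv_into {x \<in> topspace X. \<Psi> x \<in> U} (c \<circ> \<Psi>) (c (\<Psi> x)) = x"
proof -
  have "inj_on (c \<circ> \<Psi>) {x \<in> topspace X. \<Psi> x \<in> U}"
    using manifold_chart(3)[OF manifold_M U] inj_\<Psi> by (auto simp: inj_on_def)
  then have "inv_into {x \<in> topspace X. \<Psi> x \<in> U} (c \<circ> \<Psi>) ((c \<circ> \<Psi>) x) = x"
    by (rule inv_into_f_f) (use x in auto)
  then show ?thesis by simp
qed

lemma manifold_pullback: "manifold_with_boundary N"
  unfolding manifold_with_boundary_def
proof (intro conjI ballI, safe)
  have hs: "X homeomorphic_space topo M" using homeo homeomorphic_map_imp_homeomorphic_space by blast
  show "Hausdorff_space (topo N)" "second_countable (topo N)"
    using homeomorphic_Hausdorff_space[OF hs] homeomorphic_space_second_countability[OF hs] manifold_M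
    by (auto simp: manifold_with_boundary_def)
next
  fix x assume "x \<in> points N"
  then have x: "x \<in> topspace X" by simp
  then have "\<Psi> x \<in> points M" using im_\<Psi> by auto
  then obtain U c where "(U, c) \<in> charts M" "\<Psi> x \<in> U" using manifold_chart_at[OF manifold_M] by blast
  then have "({x \<in> topspace X. \<Psi> x \<in> U}, c \<circ> \<Psi>) \<in> charts N" "x \<in> {x \<in> topspace X. \<Psi> x \<in> U}"
    using x by (auto simp: charts_pullback)
  then show "x \<in> \<Union> (fst ` charts N)" by force
next
  fix x P k assume "(P, k) \<in> charts N" "x \<in> fst (P, k)"
  then show "x \<in> points N" by (auto simp: charts_pullback)
next
  fix P k assume "(P, k) \<in> charts N"
  then obtain U c where U: "(U, c) \<in> charts M" and P: "P = {x \<in> topspace X. \<Psi> x \<in> U}" "k = c \<circ> \<Psi>"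
    by (auto simp: charts_pullback)
  note Uc = manifold_chart[OF manifold_M U]
  have hc: "homeomorphic_map (subtopology (topo M) U) (top_of_set (c ` U)) c"
    using manifold_M U unfolding manifold_with_boundary_def by blast
  have kP: "k ` P = c ` U" unfolding P by (rule chart_image[OF Uc(6)])
  show "openin (topo N) P" using openin_continuous_map_preimage[OF cont_\<Psi> Uc(1)] P by simp
  show "model_open (k ` P)" using Uc(2) kP by simp
  have "homeomorphic_map (subtopology X P) (subtopology (topo M) U) \<Psi>"
    by (rule homeomorphic_map_subtopologies_alt[OF homeo]) (use P in auto)
  then have "homeomorphic_map (subtopology X P) (top_of_set (c ` U)) (c \<circ> \<Psi>)"
    using hc by (rule homeomorphic_map_compose)
  then show "homeomorphic_map (subtopology (topo N) P) (top_of_set (k ` P)) k"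
    unfolding kP unfolding P by simp
next
  fix P k P' k' assume "(P, k) \<in> charts N" "(P', k') \<in> charts N"
  then obtain U c W d where U: "(U, c) \<in> charts M" and P: "P = {x \<in> topspace X. \<Psi> x \<in> U}" "k = c \<circ> \<Psi>"
    and W: "(W, d) \<in> charts M" and P': "P' = {x \<in> topspace X. \<Psi> x \<in> W}" "k' = d \<circ> \<Psi>"
    by (auto simp: charts_pullback)
  note Uc = manifold_chart[OF manifold_M U]
  have "P \<inter> P' = {x \<in> topspace X. \<Psi> x \<in> U \<inter> W}" using P P' by auto
  then have im: "k ` (P \<inter> P') = c ` (U \<inter> W)" unfolding P(2) using chart_image[of "U \<inter> W" c] Uc(6) by auto
  show "smooth_on (k ` (P \<inter> P')) (k' \<circ> inv_into P k)"
  proof (rule smooth_on_cong)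
    show "smooth_on (k ` (P \<inter> P')) (d \<circ> inv_into U c)"
      unfolding im by (rule manifold_chart_transition[OF manifold_M U W])
    fix z assume "z \<in> k ` (P \<inter> P')"
    then obtain x where x: "x \<in> topspace X" "\<Psi> x \<in> U" "z = c (\<Psi> x)" using P by auto
    then show "(d \<circ> inv_into U c) z = (k' \<circ> inv_into P k) z"
      using chart_inverse[OF U x(1,2)] Uc(3) P P' by simp
  qed
qed

lemma boundary_pullback: "boundary N = {}"
proof -
  have "p \<notin> boundary N" for p
  proof
    assume "p \<in> boundary N"
    then obtain P k b where "boundary_chart N p P k b" by (auto simp: boundary_def)
    then obtain U c where U: "(U, c) \<in> charts M" and P: "P = {x \<in> topspace X. \<Psi> x \<in> U}" "k = c \<circ> \<Psi>" "p \<in> P" "b \<noteq> 0"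
        "openin (top_of_set (half_space b)) (k ` P)" "k p \<bullet> b = 0"
      by (auto simp: boundary_chart_def charts_pullback)
    have "k ` P = c ` U" unfolding P(1,2) by (rule chart_image[OF manifold_chart(6)[OF manifold_M U]])
    then have "boundary_chart M (\<Psi> p) U c b" using U P by (simp add: boundary_chart_def)
    then have "\<Psi> p \<in> boundary M" by (auto simp: boundary_def)
    then show False using M by (simp add: closed_manifold_def)
  qed
  then show ?thesis by blast
qed

lemma closed_pullback: "closed_manifold N"
  using manifold_pullback boundary_pullback M homeomorphic_compact_space[of X "topo M"]
    homeomorphic_map_imp_homeomorphic_space[OF homeo]
  by (auto simp: closed_manifold_def)

lemma smooth_\<Psi>: "smooth_map N M \<Psi>"
  unfolding smooth_map_def
proof (intro conjI ballI, safe)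
  show "continuous_map (topo N) (topo M) \<Psi>" using cont_\<Psi> by simp
  fix P k W d assume "(P, k) \<in> charts N" and W: "(W, d) \<in> charts M"
  then obtain U c where U: "(U, c) \<in> charts M" and P: "P = {x \<in> topspace X. \<Psi> x \<in> U}" "k = c \<circ> \<Psi>"
    by (auto simp: charts_pullback)
  note Uc = manifold_chart[OF manifold_M U]
  have im: "k ` {x \<in> P. \<Psi> x \<in> W} \<subseteq> c ` (U \<inter> W)" unfolding P by auto
  show "smooth_on (k ` {x \<in> P. \<Psi> x \<in> W}) (d \<circ> \<Psi> \<circ> inv_into P k)"
  proof (rule smooth_on_cong)
    show "smooth_on (k ` {x \<in> P. \<Psi> x \<in> W}) (d \<circ> inv_into U c)"
      by (rule smooth_on_subset[OF manifold_chart_transition[OF manifold_M U W] im])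
    fix z assume "z \<in> k ` {x \<in> P. \<Psi> x \<in> W}"
    then obtain x where x: "x \<in> topspace X" "\<Psi> x \<in> U" "z = c (\<Psi> x)" using P by auto
    then show "(d \<circ> inv_into U c) z = (d \<circ> \<Psi> \<circ> inv_into P k) z"
      using chart_inverse[OF U x(1,2)] Uc(3) P by simp
  qed
qed

lemma smooth_map_into_pullback:
  assumes h: "continuous_map (topo Y) X h" and s: "smooth_map Y M (\<Psi> \<circ> h)" and Y: "chart_inverses_continuous Y"
  shows "smooth_map Y N h"
  unfolding smooth_map_def
proof (intro conjI ballI, safe)
  show "continuous_map (topo Y) (topo N) h" using h by simp
  fix U c P k assume U: "(U, c) \<in> charts Y" and "(P, k) \<in> charts N"
  then obtain W d where W: "(W, d) \<in> charts M" and P: "P = {x \<in> topspace X. \<Psi> x \<in> W}" "k = d \<circ> \<Psi>"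
    by (auto simp: charts_pullback)
  have "U \<subseteq> points Y" using Y U by (auto simp: chart_inverses_continuous_def)
  then have "{x \<in> U. h x \<in> P} = {x \<in> U. (\<Psi> \<circ> h) x \<in> W}" using h P by (auto simp: continuous_map_def)
  then show "smooth_on (c ` {x \<in> U. h x \<in> P}) (k \<circ> h \<circ> inv_into U c)"
    using smooth_mapD[OF s U W] unfolding P by (simp add: o_assoc)
qed

lemma diffeomorphism_inverse: "diffeomorphism M N (inv_into (topspace X) \<Psi>)" (is "diffeomorphism M N ?g")
proof -
  have bij: "bij_betw \<Psi> (topspace X) (points M)" using inj_\<Psi> im_\<Psi> by (simp add: bij_betw_def)
  have gb: "bij_betw ?g (points M) (topspace X)" using bij by (rule bij_betw_inv_into)
  have \<Psi>g: "\<Psi> (?g y) = y" if "y \<in> points M" for y using that im_\<Psi> by (auto intro: f_inv_into_f)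
  have ci: "chart_inverses_continuous M" by (rule manifold_chart_inverses_continuous[OF manifold_M])
  have cg: "continuous_map (topo M) X ?g"
  proof -
    obtain g where g: "homeomorphic_maps X (topo M) \<Psi> g" using homeo homeomorphic_map_maps by blast
    have "?g y = g y" if "y \<in> points M" for y
      using inj_\<Psi> \<Psi>g[OF that] g that gb
      by (metis (no_types, lifting) bij_betwE homeomorphic_maps_def)
    then show ?thesis using g unfolding homeomorphic_maps_def by (metis continuous_map_eq)
  qed
  have idM: "smooth_map M M (\<lambda>x. x)"
    unfolding smooth_map_def
  proof (intro conjI ballI, safe)
    fix U c W d assume "(U, c) \<in> charts M" "(W, d) \<in> charts M"
    from manifold_chart_transition[OF manifold_M this]
    show "smooth_on (c ` {x \<in> U. x \<in> W}) (d \<circ> (\<lambda>x. x) \<circ> inv_into U c)"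
      by (simp add: o_def Int_def)
  qed auto
  have "smooth_map M N ?g"
    by (rule smooth_map_into_pullback[OF cg smooth_map_cong[OF idM ci] ci]) (use \<Psi>g in auto)
  moreover have "smooth_map N M (inv_into (points M) ?g)"
  proof (rule smooth_map_cong[OF smooth_\<Psi> manifold_chart_inverses_continuous[OF manifold_pullback]])
    fix x assume "x \<in> points N"
    then have x: "x \<in> topspace X" by simp
    then have "?g (\<Psi> x) = x" "\<Psi> x \<in> points M" using inj_\<Psi> im_\<Psi> by auto
    then show "\<Psi> x = inv_into (points M) ?g x" using gb by (metis bij_betw_imp_inj_on inv_into_f_f)
  qed
  ultimately show ?thesis using gb by (simp add: diffeomorphism_def)
qed

end

lemma smooth_map_from_restrict_submanifoldI:
  fixes A B :: "'f::euclidean_space set"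
  assumes "continuous_map (top_of_set B) (topo Y) q" "B \<subseteq> A"
    "\<And>W d. (W, d) \<in> charts Y \<Longrightarrow> smooth_on {x \<in> B. q x \<in> W} (d \<circ> q)"
  shows "smooth_map (restrict_to (submanifold A :: ('f, 'e::euclidean_space) charted) B) Y q"
  unfolding smooth_map_def
proof (intro conjI ballI, safe)
  show "continuous_map (topo (restrict_to (submanifold A :: ('f, 'e) charted) B)) (topo Y) q"
    using assms(1,2) by (simp add: restrict_to_def subtopology_subtopology Int_absorb1)
  fix Q c W d assume "(Q, c) \<in> charts (restrict_to (submanifold A :: ('f, 'e) charted) B)" and W: "(W, d) \<in> charts Y"
  then obtain U where U: "Q = U \<inter> B" "(U, c) \<in> charts (submanifold A :: ('f, 'e) charted)"
    by (auto simp: restrict_to_def)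
  have U': "inj_on c U" "smooth_on (c ` U) (inv_into U c)"
    using U(2) by (auto simp: charts_submanifold)
  have 1: "smooth_on (c ` {x \<in> Q. q x \<in> W}) (inv_into U c)"
    by (rule smooth_on_subset[OF U'(2)]) (use U(1) in auto)
  have "smooth_on (c ` {x \<in> Q. q x \<in> W}) (\<lambda>z. (d \<circ> q) (inv_into U c z))"
    by (rule smooth_on_compose[OF 1 assms(3)[OF W]]) (use U U' in auto)
  then show "smooth_on (c ` {x \<in> Q. q x \<in> W}) (d \<circ> q \<circ> inv_into Q c)"
    by (rule smooth_on_cong) (use U U'(1) inv_into_Int[OF U'(1)] in auto)
qed

text \<open>Smoothness in the pulled back structure is smoothness of \<open>\<Psi> \<circ> h\<close>
  into the Euclidean space, and an explicit inverse \<open>g\<close>, smooth on the image there,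
  gives the other direction. Its continuity comes from compactness of the piece.\<close>

lemma pullback_piece:
  fixes A :: "'h::euclidean_space set" and Y :: "('y, 'd::euclidean_space) charted"
  assumes P: "pulled_back X \<Psi> (submanifold A :: ('h, 'e::euclidean_space) charted)"
    and Y: "chart_inverses_continuous Y" "compact_space (topo Y)"
    and h: "continuous_map (topo Y) X h"
    and smooth: "\<And>U c. (U, c) \<in> charts Y \<Longrightarrow> smooth_on (c ` U) (\<Psi> \<circ> h \<circ> inv_into U c)"
    and g: "\<And>y. y \<in> points Y \<Longrightarrow> g (\<Psi> (h y)) = y"
    and smooth_g: "\<And>W d. (W, d) \<in> charts Y \<Longrightarrow> smooth_on {p \<in> (\<Psi> \<circ> h) ` points Y. g p \<in> W} (d \<circ> g)"
  shows "diffeomorphism Y (restrict_to (pullback X \<Psi> (submanifold A :: ('h, 'e) charted)) (h ` points Y)) h"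
proof -
  interpret pulled_back X \<Psi> "submanifold A :: ('h, 'e) charted" by (rule P)
  let ?M = "submanifold A :: ('h, 'e) charted" and ?C = "h ` points Y" and ?B = "(\<Psi> \<circ> h) ` points Y"
  have hX: "h y \<in> topspace X" if "y \<in> points Y" for y using h that by (auto simp: continuous_map_def)
  have inj: "inj_on h (points Y)" using g by (metis inj_onI)
  have bij: "bij_betw h (points Y) (points (restrict_to N ?C))"
    using inj hX by (auto simp: bij_betw_def restrict_to_def)
  have c\<Psi>h: "continuous_map (topo Y) (top_of_set A) (\<Psi> \<circ> h)"
    using continuous_map_compose[OF h cont_\<Psi>] by simp
  have "smooth_map Y N h"
    by (rule smooth_map_into_pullback[OF h smooth_map_submanifoldI[OF c\<Psi>h Y(1) smooth] Y(1)])
  then have 1: "smooth_map Y (restrict_to N ?C) h"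
    using smooth_map_restrict[of Y N h UNIV ?C] Y(1) by (simp add: restrict_to_UNIV)
  have BA: "?B \<subseteq> A" using c\<Psi>h by (auto simp: continuous_map_def)
  have "continuous_map (subtopology (top_of_set A) ?B) (topo Y) g"
    by (rule continuous_inverse_map[OF Y(2) _ c\<Psi>h])
      (use g in \<open>auto simp: Hausdorff_space_subtopology Hausdorff_space_euclidean\<close>)
  then have cg: "continuous_map (top_of_set ?B) (topo Y) g"
    using BA by (simp add: subtopology_subtopology Int_absorb1)
  have 2: "smooth_map (restrict_to ?M ?B) Y g"
    by (rule smooth_map_from_restrict_submanifoldI[OF cg BA smooth_g])
  have ciN: "chart_inverses_continuous N" by (rule manifold_chart_inverses_continuous[OF manifold_pullback])
  have ciC: "chart_inverses_continuous (restrict_to N ?C)" by (rule chart_inverses_continuous_restrict[OF ciN])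
  have 3: "smooth_map (restrict_to N ?C) (restrict_to ?M ?B) \<Psi>"
    by (rule smooth_map_restrict[OF smooth_\<Psi> ciN]) auto
  have "smooth_map (restrict_to N ?C) Y (g \<circ> \<Psi>)"
    by (rule smooth_map_compose[OF 3 2 ciC open_atlas_restrict[OF manifold_open_atlas[OF manifold_M]]])
  then have "smooth_map (restrict_to N ?C) Y (inv_into (points Y) h)"
    by (rule smooth_map_cong[OF _ ciC]) (use g inj in \<open>auto simp: restrict_to_def\<close>)
  then show ?thesis using bij 1 by (simp add: diffeomorphism_def)
qed

section \<open>The open book of a sphere with a ball as page and trivial monodromy\<close>

lemma page_ball: "page_with_monodromy (submanifold (cball 0 1) :: ('f::euclidean_space, 'f) charted) id"
proof -
  let ?D = "submanifold (cball 0 1) :: ('f, 'f) charted"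
  obtain b :: 'f where "b \<in> Basis" using nonempty_Basis by blast
  then have "b \<in> sphere 0 1" by simp
  then have ne: "boundary ?D \<noteq> {}" unfolding boundary_cball by blast
  have id: "smooth_map ?D ?D id"
    by (rule smooth_map_from_submanifoldI) (auto simp: charts_submanifold intro: smooth_on_subset)
  have "smooth_map ?D ?D (inv_into (points ?D) id)"
    by (rule smooth_map_cong[OF id chart_inverses_continuous_submanifold])
      (metis id_apply inv_into_f_f inj_on_id)
  then have "diffeomorphism ?D ?D id" using id by (simp add: diffeomorphism_def bij_betw_def)
  then show ?thesis
    using manifold_cball ne boundary_cball[where 'f='f]
    by (auto simp: page_with_monodromy_def compact_space_subtopology intro!: exI[of _ "cball 0 1"])
qed

text \<open>The quotient is the tangent of half the angle, which lies in the principal branch. This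
  expresses the angle by a formula that is smooth on the plane cut along the negative real
  axis.\<close>

lemma arctan_half_angle:
  assumes "- pi < \<theta>" "\<theta> < pi" shows "2 * arctan (sin \<theta> / (1 + cos \<theta>)) = \<theta>"
proof -
  have "tan (\<theta> / 2) = sin \<theta> / (1 + cos \<theta>)" using tan_half[of "\<theta> / 2"] by (simp add: add.commute)
  moreover have "arctan (tan (\<theta> / 2)) = \<theta> / 2" using assms by (intro arctan_tan) auto
  ultimately show ?thesis by simp
qed

text \<open>The sphere in \<open>'f \<times> complex\<close>, up to the linear isometry \<open>\<alpha>\<close>, is divided by \<open>norm y = norm w\<close>,
  for points \<open>(y, w)\<close>, into the mapping torus and the neighbourhood of the binding.\<close>

locale ball_book =
  fixes \<alpha> :: "'f::euclidean_space \<times> complex \<Rightarrow> 'h::euclidean_space" and \<beta>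
  assumes lin: "linear \<alpha>" "linear \<beta>" and norm_\<alpha>: "norm (\<alpha> v) = norm v" and norm_\<beta>: "norm (\<beta> p) = norm p"
    and \<beta>_\<alpha>: "\<beta> (\<alpha> v) = v" and \<alpha>_\<beta>: "\<alpha> (\<beta> p) = p"
begin

abbreviation D where "D \<equiv> submanifold (cball 0 1) :: ('f, 'f) charted"

sublocale page D id by (unfold_locales) (rule page_ball)

text \<open>Scaling by \<open>1 / sqrt 2\<close> makes the unit ball fill the part where the first
  component is at most as long as the second; the length of the second is forced by the unit norm,
  and its argument is the angle of the page. In \<open>bm\<close> the roles are exchanged. Both
  lengths equal \<open>1 / sqrt 2\<close> on the seam.\<close>

definition tm :: "'f \<times> real \<Rightarrow> 'h" where
  "tm p = \<alpha> (inverse (sqrt 2) *\<^sub>R fst p, sqrt (1 - (fst p \<bullet> fst p) * (1 / 2)) *\<^sub>R cis (2 * pi * snd p))"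

definition bm :: "'f \<times> complex \<Rightarrow> 'h" where
  "bm p = \<alpha> (sqrt (1 - (snd p \<bullet> snd p) * (1 / 2)) *\<^sub>R fst p, inverse (sqrt 2) *\<^sub>R snd p)"

text \<open>The choice of a representative is harmless: \<open>tm\<close> depends on the angle
  through \<open>cis\<close> only, and for trivial monodromy a class consists of the integer shifts
  of one point.\<close>

definition \<Psi> :: "('f \<times> real) set + 'f \<times> complex \<Rightarrow> 'h" where
  "\<Psi> s = (case s of Inl P \<Rightarrow> tm (SOME p. p \<in> P) | Inr p \<Rightarrow> bm p)"

lemma cls_iff:
  assumes "norm x \<le> 1" shows "p \<in> cls (x, t) \<longleftrightarrow> fst p = x \<and> (\<exists>k :: int. t = snd p + k)"
proof -
  have "p \<in> cls (x, t) \<longleftrightarrow> fst p = x \<and> (\<exists>k::nat. t = snd p + real k \<or> snd p = t + real k)"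
    using assms by (cases p) (auto simp: torus_class_def torus_rel_iff)
  also have "(\<exists>k::nat. t = snd p + real k \<or> snd p = t + real k) \<longleftrightarrow> (\<exists>k :: int. t = snd p + k)"
  proof (intro iffI; elim exE disjE)
    fix k :: nat assume "t = snd p + real k"
    then show "\<exists>k :: int. t = snd p + k" by (intro exI[of _ "int k"]) simp
  next
    fix k :: nat assume "snd p = t + real k"
    then show "\<exists>k :: int. t = snd p + k" by (intro exI[of _ "- int k"]) simp
  next
    fix k :: int assume "t = snd p + k"
    then show "\<exists>k::nat. t = snd p + real k \<or> snd p = t + real k"
      by (cases k) (auto intro!: exI[of _ "nat \<bar>k\<bar>"])
  qed
  finally show ?thesis .
qed

lemma cis_add_int: "cis (2 * pi * (t + real_of_int k)) = cis (2 * pi * t)"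
  using cis_multiple_2pi[of "real_of_int k"] by (simp add: distrib_left flip: cis_mult)

lemma cis_eq_imp:
  assumes "cis (2 * pi * t) = cis (2 * pi * s)" shows "\<exists>k :: int. t = s + k"
proof -
  have "sin (2 * pi * t) = sin (2 * pi * s) \<and> cos (2 * pi * t) = cos (2 * pi * s)"
    using assms by (simp add: complex_eq_iff)
  then obtain k :: int where "2 * pi * t = 2 * pi * s + 2 * pi * k" unfolding sin_cos_eq_iff by blast
  then have "2 * pi * t = 2 * pi * (s + k)" by (simp add: distrib_left)
  then show ?thesis by auto
qed

lemma cls_eq: "norm x \<le> 1 \<Longrightarrow> cis (2 * pi * t) = cis (2 * pi * s) \<Longrightarrow> cls (x, t) = cls (x, s)"
proof -
  assume x: "norm x \<le> 1" and "cis (2 * pi * t) = cis (2 * pi * s)"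
  then obtain k :: int where k: "t = s + k" using cis_eq_imp by blast
  have "(x, s) \<in> cls (x, t)" using x k cls_iff by auto
  then have "((x, t), (x, s)) \<in> torus_rel D id" by (simp add: torus_class_def)
  then show ?thesis using cls_eq_iff[of x x t s] x by simp
qed

lemma \<Psi>_Inl: "norm x \<le> 1 \<Longrightarrow> \<Psi> (Inl (cls (x, t))) = tm (x, t)"
proof -
  assume x: "norm x \<le> 1"
  have "(x, t) \<in> cls (x, t)" using cls_self[of x t] x by simp
  then have "(SOME p. p \<in> cls (x, t)) \<in> cls (x, t)" by (rule someI[of "\<lambda>p. p \<in> cls (x, t)"])
  then obtain k :: int where "fst (SOME p. p \<in> cls (x, t)) = x" "t = snd (SOME p. p \<in> cls (x, t)) + k"
    using cls_iff[OF x] by blast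
  then show ?thesis using cis_add_int[of "snd (SOME p. p \<in> cls (x, t))" k] by (simp add: \<Psi>_def tm_def)
qed

lemma \<Psi>_Inr: "\<Psi> (Inr p) = bm p" by (simp add: \<Psi>_def)

lemma inverse_sqrt_2_twice: "inverse (sqrt 2) * (inverse (sqrt 2) * x) = x / 2"
  by (simp add: field_simps)

lemma sqrt_half: "sqrt (1 / 2) = inverse (sqrt 2)" by (simp add: real_sqrt_divide inverse_eq_divide)

lemma \<Psi>_tinc: assumes x: "norm x \<le> 1" shows "\<Psi> (tinc (cls (x, t))) = tm (x, t)"
proof (cases "norm x = 1")
  case True
  then have "x \<in> boundary D" by (simp add: boundary_cball)
  then show ?thesis
    using True by (simp add: tinc_boundary \<Psi>_Inr tm_def bm_def dot_square_norm sqrt_half)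
next
  case False
  then have "x \<notin> boundary D" by (simp add: boundary_cball)
  then show ?thesis using x by (simp add: tinc_interior \<Psi>_Inl)
qed

lemma norm_Pair_1: "norm (v :: 'f \<times> complex) = 1 \<longleftrightarrow> fst v \<bullet> fst v + snd v \<bullet> snd v = 1"
  unfolding norm_eq_sqrt_inner inner_prod_def by simp

lemma sq_le: "norm (x :: 'a::real_inner) \<le> 1 \<Longrightarrow> x \<bullet> x \<le> 1"
  by (simp add: dot_square_norm abs_square_le_1)

lemma \<beta>_tm: "\<beta> (tm (x, t)) = (inverse (sqrt 2) *\<^sub>R x, sqrt (1 - (x \<bullet> x) * (1 / 2)) *\<^sub>R cis (2 * pi * t))"
  and \<beta>_bm: "\<beta> (bm (b, z)) = (sqrt (1 - (z \<bullet> z) * (1 / 2)) *\<^sub>R b, inverse (sqrt 2) *\<^sub>R z)"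
  by (simp_all add: tm_def bm_def \<beta>_\<alpha>)

lemma tm_sphere: "norm x \<le> 1 \<Longrightarrow> norm (tm (x, t)) = 1"
  unfolding tm_def norm_\<alpha> norm_Pair_1
  using sq_le[of x] by (simp add: dot_square_norm[of "cis _"] inverse_sqrt_2_twice flip: power2_eq_square)

lemma bm_sphere: "norm b = 1 \<Longrightarrow> norm z \<le> 1 \<Longrightarrow> norm (bm (b, z)) = 1"
  unfolding bm_def norm_\<alpha> norm_Pair_1
  using sq_le[of z] by (simp add: dot_square_norm[of b] inverse_sqrt_2_twice flip: power2_eq_square)

lemma Cinf_\<alpha>: "Cinf S k \<Longrightarrow> Cinf S (\<lambda>x. \<alpha> (k x))" and Cinf_\<beta>: "Cinf S' k' \<Longrightarrow> Cinf S' (\<lambda>x. \<beta> (k' x))"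
  by (rule Cinf_linear[OF lin(1)], assumption) (rule Cinf_linear[OF lin(2)], assumption)

lemma smooth_tm: "smooth_on (cball 0 1 \<times> UNIV) tm"
proof (rule smooth_on_Cinf)
  let ?W = "{p :: 'f \<times> real. 1 - (fst p \<bullet> fst p) * (1 / 2) > 0}"
  have o: "open ?W" by (intro open_Collect_less continuous_intros)
  show "Cinf ?W tm" unfolding tm_def[abs_def]
    by (intro Cinf_\<alpha> Cinf_Pair Cinf_scaleR Cinf_sqrt Cinf_diff Cinf_mult Cinf_inner Cinf_cis Cinf_fst Cinf_snd Cinf_const Cinf_ident o) auto
  show "cball 0 1 \<times> UNIV \<subseteq> ?W" by (force dest: sq_le)
qed

lemma smooth_bm: "smooth_on (UNIV \<times> cball 0 1) bm"
proof (rule smooth_on_Cinf)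
  let ?W = "{p :: 'f \<times> complex. 1 - (snd p \<bullet> snd p) * (1 / 2) > 0}"
  have o: "open ?W" by (intro open_Collect_less continuous_intros)
  show "Cinf ?W bm" unfolding bm_def[abs_def]
    by (intro Cinf_\<alpha> Cinf_Pair Cinf_scaleR Cinf_sqrt Cinf_diff Cinf_mult Cinf_inner Cinf_fst Cinf_snd Cinf_const Cinf_ident o) auto
  show "UNIV \<times> cball 0 1 \<subseteq> ?W" by (force dest: sq_le)
qed

text \<open>Inverse of \<open>tm\<close> up to the choice of the angle; the jump of
  \<open>Arg\<close> is invisible in the class.\<close>

definition g0 :: "'h \<Rightarrow> ('f \<times> real) set" where
  "g0 p = cls (sqrt 2 *\<^sub>R fst (\<beta> p), Arg (snd (\<beta> p)) / (2 * pi))"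

definition g1 :: "'h \<Rightarrow> 'f \<times> complex" where
  "g1 p = (sgn (fst (\<beta> p)), sqrt 2 *\<^sub>R snd (\<beta> p))"

lemma g0_tm: assumes x: "norm x \<le> 1" shows "g0 (tm (x, t)) = cls (x, t)"
proof -
  define r where "r = sqrt (1 - (x \<bullet> x) * (1 / 2))"
  have r: "r > 0" using sq_le[OF x] by (simp add: r_def)
  have "cis (Arg (r *\<^sub>R cis (2 * pi * t))) = cis (2 * pi * t)"
    using r by (subst cis_Arg) (auto simp: sgn_scaleR sgn_div_norm)
  then have "cls (x, Arg (r *\<^sub>R cis (2 * pi * t)) / (2 * pi)) = cls (x, t)"
    by (intro cls_eq x) simp
  then show ?thesis by (simp add: g0_def \<beta>_tm r_def)
qed

lemma g1_bm: assumes "norm b = 1" "norm z \<le> 1" shows "g1 (bm (b, z)) = (b, z)"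
proof -
  have "sqrt (1 - (z \<bullet> z) * (1 / 2)) > 0" using sq_le[OF assms(2)] by simp
  then show ?thesis using assms(1) by (simp add: g1_def \<beta>_bm sgn_scaleR sgn_div_norm)
qed

text \<open>Comparing the norms of the first components gives
  \<open>x \<bullet> x + z \<bullet> z = 2\<close>. As both summands are at most \<open>1\<close>,
  both equal \<open>1\<close>, so the two pieces overlap in the seam only, where they are
  glued.\<close>

lemma tm_eq_bm:
  assumes "norm x \<le> 1" "norm b = 1" "norm z \<le> 1" "tm (x, t) = bm (b, z)"
  shows "tinc (cls (x, t)) = Inr (b, z)"
proof -
  have eq: "inverse (sqrt 2) *\<^sub>R x = sqrt (1 - (z \<bullet> z) * (1 / 2)) *\<^sub>R b"
    "sqrt (1 - (x \<bullet> x) * (1 / 2)) *\<^sub>R cis (2 * pi * t) = inverse (sqrt 2) *\<^sub>R z"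
    using arg_cong[OF assms(4), of \<beta>] by (simp_all add: \<beta>_tm \<beta>_bm)
  have zz: "z \<bullet> z \<le> 1" and xx: "x \<bullet> x \<le> 1" using assms sq_le by auto
  have "(inverse (sqrt 2) *\<^sub>R x) \<bullet> (inverse (sqrt 2) *\<^sub>R x) = (1 - (z \<bullet> z) * (1 / 2)) * (b \<bullet> b)"
    unfolding eq(1) using zz by (simp flip: power2_eq_square mult.assoc)
  then have "x \<bullet> x = 2 - z \<bullet> z"
    using assms(2) by (simp add: dot_square_norm[of b] field_simps flip: mult.assoc)
  then have x1: "x \<bullet> x = 1" and z1: "z \<bullet> z = 1" using xx zz by auto
  have "x = b" using eq(1) by (simp add: z1 sqrt_half)
  moreover have "cis (2 * pi * t) = z" using eq(2) by (simp add: x1 sqrt_half)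
  moreover have "norm x = 1" using x1 by (simp add: norm_eq_sqrt_inner)
  then have "x \<in> boundary D" by (simp add: boundary_cball)
  ultimately show ?thesis using tinc_boundary[of x t] by simp
qed

lemma points_T_cases:
  assumes "P \<in> points T" obtains x t where "norm x \<le> 1" "P = cls (x, t)"
  using assms by (auto simp: points_T)

lemma g0_\<Psi>: "P \<in> points T \<Longrightarrow> g0 (\<Psi> (tinc P)) = P"
  by (erule points_T_cases) (simp add: \<Psi>_tinc g0_tm)

lemma points_BN_iff: "(b, z) \<in> points BN \<longleftrightarrow> norm b = 1 \<and> norm z \<le> 1"
  by (simp add: points_BN boundary_cball)

lemma g1_\<Psi>: "p \<in> points BN \<Longrightarrow> g1 (\<Psi> (Inr p)) = p"
  by (cases p) (simp add: points_BN_iff \<Psi>_Inr g1_bm)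

lemma OB_cases':
  assumes "s \<in> topspace OB"
  obtains (torus) x t where "norm x \<le> 1" "s = tinc (cls (x, t))"
    | (binding) b z where "norm b = 1" "norm z \<le> 1" "s = Inr (b, z)"
  using assms by (cases rule: OB_cases) (auto simp: boundary_cball)

lemma inj_\<Psi>: "inj_on \<Psi> (topspace OB)"
proof (rule inj_onI)
  fix s s' assume s: "s \<in> topspace OB" "s' \<in> topspace OB" "\<Psi> s = \<Psi> s'"
  show "s = s'"
    using s(1)
  proof (cases rule: OB_cases')
    case (torus x t)
    note 1 = torus
    show ?thesis using s(2)
    proof (cases rule: OB_cases')
      case (torus y w)
      then show ?thesis using 1 s(3) g0_tm[of x t] g0_tm[of y w] by (simp add: \<Psi>_tinc)
    next
      case (binding b z)
      then show ?thesis using 1 s(3) tm_eq_bm[of x b z t] by (simp add: \<Psi>_tinc \<Psi>_Inr)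
    qed
  next
    case (binding b z)
    note 1 = binding
    show ?thesis using s(2)
    proof (cases rule: OB_cases')
      case (torus y w)
      then show ?thesis using 1 s(3) tm_eq_bm[of y b z w] by (simp add: \<Psi>_tinc \<Psi>_Inr)
    next
      case (binding b' z')
      have "bm (b, z) = bm (b', z')" using s(3) 1(3) binding(3) by (simp add: \<Psi>_Inr)
      then have "(b, z) = (b', z')" using g1_bm[OF 1(1,2)] g1_bm[OF binding(1,2)] by metis
      then show ?thesis using 1(3) binding(3) by simp
    qed
  qed
qed

lemma im_\<Psi>: "\<Psi> ` topspace OB = sphere 0 1"
proof (intro equalityI subsetI)
  fix p assume "p \<in> \<Psi> ` topspace OB"
  then obtain s where s: "s \<in> topspace OB" "p = \<Psi> s" by blast
  then show "p \<in> sphere 0 1"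
    by (cases rule: OB_cases') (auto simp: \<Psi>_tinc \<Psi>_Inr tm_sphere bm_sphere)
next
  fix p :: 'h assume p: "p \<in> sphere 0 1"
  obtain y w where yw: "\<beta> p = (y, w)" by (cases "\<beta> p")
  have n: "y \<bullet> y + w \<bullet> w = 1" using norm_\<beta>[of p] p norm_Pair_1[of "\<beta> p"] yw by simp
  show "p \<in> \<Psi> ` topspace OB"
  \<comment> \<open>The value \<open>1 / 2\<close> of \<open>y \<bullet> y\<close> marks the seam:
    points below it come from the torus, points above it from the neighbourhood of the
    binding.\<close>
  proof (cases "y \<bullet> y \<le> 1 / 2")
    case True
    define x where "x = sqrt 2 *\<^sub>R y"
    have xx: "x \<bullet> x = 2 * (y \<bullet> y)" by (simp add: x_def flip: mult.assoc)
    then have x: "norm x \<le> 1" using True by (simp add: norm_eq_sqrt_inner)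
    have ww: "w \<bullet> w = 1 - (x \<bullet> x) * (1 / 2)" using n xx by simp
    have "sqrt (1 - (x \<bullet> x) * (1 / 2)) = norm w" unfolding ww[symmetric] by (simp add: norm_eq_sqrt_inner)
    moreover have "norm w *\<^sub>R cis (2 * pi * (Arg w / (2 * pi))) = w"
      using rcis_cmod_Arg[of w] by (simp add: rcis_def scaleR_conv_of_real)
    ultimately have "\<beta> (tm (x, Arg w / (2 * pi))) = (y, w)" unfolding \<beta>_tm by (simp add: x_def)
    then have "tm (x, Arg w / (2 * pi)) = p" using yw \<alpha>_\<beta> by metis
    moreover have "tinc (cls (x, Arg w / (2 * pi))) \<in> topspace OB"
      by (rule tinc_OB) (use x in \<open>auto simp: points_T\<close>)
    ultimately show ?thesis using \<Psi>_tinc[OF x] by (metis imageI)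
  next
    case False
    define z where "z = sqrt 2 *\<^sub>R w"
    have zz: "z \<bullet> z = 2 * (w \<bullet> w)" by (simp add: z_def flip: mult.assoc)
    then have z: "norm z \<le> 1" using False n by (simp add: norm_eq_sqrt_inner)
    have y0: "y \<noteq> 0" using False by auto
    have yy: "y \<bullet> y = 1 - (z \<bullet> z) * (1 / 2)" using n zz by simp
    have "sqrt (1 - (z \<bullet> z) * (1 / 2)) = norm y" unfolding yy[symmetric] by (simp add: norm_eq_sqrt_inner)
    then have "\<beta> (bm (sgn y, z)) = (y, w)" unfolding \<beta>_bm using y0 by (simp add: z_def sgn_div_norm)
    then have "bm (sgn y, z) = p" using yw \<alpha>_\<beta> by metis
    moreover have "(sgn y, z) \<in> points BN" using y0 z by (simp add: points_BN_iff norm_sgn)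
    ultimately show ?thesis using \<Psi>_Inr topspace_OB by (metis UnI2 imageI)
  qed
qed

lemma compact_T: "compact_space (topo T)"
proof -
  \<comment> \<open>Angles of one period suffice, which exhibits the torus as the image of a compact
    product.\<close>
  have "points T = cls ` (cball 0 1 \<times> {0..1})"
  proof (intro equalityI subsetI)
    fix P assume "P \<in> points T"
    then obtain x t where x: "norm x \<le> 1" "P = cls (x, t)" by (rule points_T_cases)
    have "cis (2 * pi * t) = cis (2 * pi * frac t)"
      using cis_add_int[of "frac t" "\<lfloor>t\<rfloor>"] by (simp add: frac_def)
    then have "P = cls (x, frac t)" using cls_eq[OF x(1)] x(2) by blast
    then show "P \<in> cls ` (cball 0 1 \<times> {0..1})" using x(1) frac_lt_1[of t] by (auto simp: less_imp_le)
  qed (auto simp: points_T)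
  moreover have "compactin (prod_topology (topo D) euclideanreal) (cball 0 1 \<times> {0..1})"
    by (simp add: compactin_Times compactin_subtopology)
  ultimately show ?thesis
    using image_compactin[OF _ continuous_cls] by (simp add: compact_space_def)
qed

lemma continuous_tm: "continuous_map (prod_topology (topo D) euclideanreal) (top_of_set (sphere 0 1)) tm"
proof -
  have "prod_topology (topo D) euclideanreal = top_of_set (cball 0 1 \<times> UNIV)"
    using subtopology_Times[of euclidean euclideanreal "cball (0::'f) 1" UNIV] by simp
  then show ?thesis using smooth_on_continuous_on[OF smooth_tm] tm_sphere by auto
qed

lemma continuous_\<Psi>: "continuous_map OB (top_of_set (sphere 0 1)) \<Psi>"
proof (rule continuous_from_OB)
  show "continuous_map (topo T) (top_of_set (sphere 0 1)) (\<lambda>x. \<Psi> (tinc x))"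
    unfolding topo_T
    by (rule continuous_map_from_quotient, rule continuous_map_eq[OF continuous_tm]) (auto simp: \<Psi>_tinc)
  have "topo BN = top_of_set (sphere 0 1 \<times> cball 0 1)"
    unfolding topo_BN boundary_cball
    using subtopology_Times[of euclidean euclidean "sphere (0::'f) 1" "cball (0::complex) 1"]
    by (simp add: subtopology_subtopology Int_absorb1)
  moreover have "continuous_on (sphere 0 1 \<times> cball 0 1) bm"
    by (rule continuous_on_subset[OF smooth_on_continuous_on[OF smooth_bm]]) auto
  ultimately show "continuous_map (topo BN) (top_of_set (sphere 0 1)) (\<lambda>x. \<Psi> (Inr x))"
    using bm_sphere by (auto simp: \<Psi>_Inr[abs_def])
qed

lemma compact_OB: "compact_space OB"
proof -
  have "compactin OB (tinc ` points T)" "compactin OB (Inr ` points BN)"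
    using image_compactin[OF _ continuous_tinc] image_compactin[OF _ continuous_Inr] compact_T compact_BN
    by (auto simp: compact_space_def)
  then have "compactin OB (tinc ` points T \<union> Inr ` points BN)" by (rule compactin_Un)
  moreover have "topspace OB = tinc ` points T \<union> Inr ` points BN"
  proof
    show "topspace OB \<subseteq> tinc ` points T \<union> Inr ` points BN"
    proof
      fix s assume "s \<in> topspace OB"
      then show "s \<in> tinc ` points T \<union> Inr ` points BN"
        by (cases rule: OB_cases) (auto simp: points_T points_BN)
    qed
    show "tinc ` points T \<union> Inr ` points BN \<subseteq> topspace OB" using tinc_OB topspace_OB by auto
  qed
  ultimately show ?thesis by (simp add: compact_space_def)
qed

text \<open>A continuous bijection from a compact to a Hausdorff space. The separation and
  countability properties of the open book space are then inherited from the sphere.\<close>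

lemma homeomorphic_\<Psi>: "homeomorphic_map OB (top_of_set (sphere 0 1)) \<Psi>"
  by (rule continuous_imp_homeomorphic_map[OF continuous_\<Psi> compact_OB _ _ inj_\<Psi>])
    (auto simp: im_\<Psi> Hausdorff_space_subtopology Hausdorff_space_euclidean)

text \<open>Multiplication by the constant \<open>cis\<close> turns the middle of the strip to angle
  \<open>0\<close>. The strip then fills the angles strictly between \<open>- pi\<close> and
  \<open>pi\<close>, away from zero and the negative real axis, which the two inequalities exclude,
  and the half-angle formula gives a smooth coordinate.\<close>

lemma smooth_torus_coordinate:
  fixes s :: real
  defines "w \<equiv> \<lambda>p. snd (\<beta> p) * cis (- (2 * pi * (s + 1 / 2)))"
  defines "tt \<equiv> \<lambda>p. s + 1 / 2 + 2 * arctan (Im (w p) / (norm (w p) + Re (w p))) * (1 / (2 * pi))"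
  shows "smooth_on {p. w p \<noteq> 0 \<and> norm (w p) + Re (w p) \<noteq> 0} tt"
    and "norm x \<le> 1 \<Longrightarrow> t \<in> {s<..<s+1} \<Longrightarrow>
      tt (tm (x, t)) = t \<and> tm (x, t) \<in> {p. w p \<noteq> 0 \<and> norm (w p) + Re (w p) \<noteq> 0}"
proof -
  let ?W = "{p. w p \<noteq> 0 \<and> norm (w p) + Re (w p) \<noteq> 0}"
  have Cw: "Cinf UNIV w" unfolding w_def
    by (intro Cinf_mult Cinf_snd Cinf_\<beta> Cinf_ident Cinf_const open_UNIV)
  have cw: "continuous_on UNIV w" by (rule Cinf_continuous_on[OF Cw])
  have o: "open ?W" by (intro open_Collect_conj open_Collect_neq continuous_intros cw)
  have CwW: "Cinf ?W w" by (rule Cinf_subset[OF Cw o]) simp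
  have "Cinf ?W tt" unfolding tt_def
    by (intro Cinf_add Cinf_mult Cinf_arctan Cinf_divide Cinf_const o Cinf_norm CwW
        Cinf_bounded_linear[OF bounded_linear_Re] Cinf_bounded_linear[OF bounded_linear_Im]) auto
  then show "smooth_on ?W tt" by (rule smooth_on_Cinf) simp
  assume x: "norm x \<le> 1" and t: "t \<in> {s<..<s+1}"
  define r where "r = sqrt (1 - (x \<bullet> x) * (1 / 2))"
  have r: "r > 0" using sq_le[OF x] by (simp add: r_def)
  define \<theta> where "\<theta> = 2 * pi * (t - (s + 1 / 2))"
  have "\<bar>t - (s + 1 / 2)\<bar> < 1 / 2" using t by (auto simp: abs_if)
  then have "\<bar>\<theta>\<bar> < pi" by (simp add: \<theta>_def abs_mult)
  then have \<theta>: "- pi < \<theta>" "\<theta> < pi" by auto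
  have wt: "w (tm (x, t)) = r *\<^sub>R cis \<theta>"
  proof -
    have "cis (2 * pi * t) * cis (- (2 * pi * (s + 1 / 2))) = cis \<theta>"
      by (simp add: cis_mult \<theta>_def algebra_simps)
    then show ?thesis by (simp add: w_def \<beta>_tm r_def)
  qed
  have "cos pi < cos \<bar>\<theta>\<bar>" using \<theta> by (intro cos_monotone_0_pi) auto
  then have c: "1 + cos \<theta> > 0" by simp
  have "norm (w (tm (x, t))) + Re (w (tm (x, t))) = r * (1 + cos \<theta>)"
    using r by (simp add: wt algebra_simps)
  moreover have "Im (w (tm (x, t))) = r * sin \<theta>" by (simp add: wt)
  ultimately have "tt (tm (x, t)) = s + 1 / 2 + 2 * arctan (sin \<theta> / (1 + cos \<theta>)) * (1 / (2 * pi))"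
    and "norm (w (tm (x, t))) + Re (w (tm (x, t))) \<noteq> 0"
    using r c by (simp_all add: tt_def)
  moreover have "w (tm (x, t)) \<noteq> 0" using r by (simp add: wt)
  ultimately show "tt (tm (x, t)) = t \<and> tm (x, t) \<in> ?W"
    unfolding arctan_half_angle[OF \<theta>] by (simp add: \<theta>_def)
qed

text \<open>The structure comes from the sphere, so each piece only has to be compared with it:
  \<open>tm\<close> and \<open>bm\<close> are smooth, and so are their inverses on the images, once
  the angle is computed by the formula adapted to each strip.\<close>

lemma is_open_book_ball:
  assumes dim: "DIM('h) = DIM('f \<times> real) + 1"
  shows "is_open_book D id (pullback OB \<Psi> (submanifold (sphere 0 1) :: ('h, 'f \<times> real) charted))"
    and "diffeomorphism (submanifold (sphere 0 1) :: ('h, 'f \<times> real) charted)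
      (pullback OB \<Psi> (submanifold (sphere 0 1) :: ('h, 'f \<times> real) charted)) (inv_into (topspace OB) \<Psi>)"
proof -
  let ?M = "submanifold (sphere 0 1) :: ('h, 'f \<times> real) charted"
  have pb: "pulled_back OB \<Psi> ?M"
    by unfold_locales (use homeomorphic_\<Psi> closed_manifold_sphere[OF dim] in auto)
  interpret pulled_back OB \<Psi> ?M by (rule pb)
  show "diffeomorphism ?M (pullback OB \<Psi> ?M) (inv_into (topspace OB) \<Psi>)" by (rule diffeomorphism_inverse)
  have "diffeomorphism T (restrict_to (pullback OB \<Psi> ?M) (tinc ` points T)) tinc"
  proof (rule pullback_piece[OF pb chart_inverses_continuous_T compact_T continuous_tinc, where g=g0])
    show "g0 (\<Psi> (tinc P)) = P" if "P \<in> points T" for P by (rule g0_\<Psi>[OF that])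
  next
    fix Q k assume "(Q, k) \<in> charts T"
    then obtain U c s where Q: "Q = cls ` (U \<times> {s<..<s+1})" "k = torus_chart U c s" and U: "(U, c) \<in> charts D"
      by (auto simp: charts_T)
    note Uc = manifold_chart[OF V U]
    have kQ: "k ` Q = c ` U \<times> {s<..<s+1}" unfolding Q by (rule torus_chart_image[OF Uc(6)])
    have si: "smooth_on (c ` U) (inv_into U c)" using U by (simp add: charts_submanifold)
    have sc: "smooth_on U c" using U by (simp add: charts_submanifold)
    have 1: "smooth_on (k ` Q) (\<lambda>z. (inv_into U c (fst z), snd z))"
      by (intro smooth_on_Pair smooth_on_snd smooth_on_id smooth_on_compose[OF smooth_on_fst[OF smooth_on_id] si])
        (auto simp: kQ)
    have U1: "norm x \<le> 1" if "x \<in> U" for x using that Uc(6) by auto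
    have "smooth_on (k ` Q) (\<lambda>z. tm (inv_into U c (fst z), snd z))"
      by (rule smooth_on_compose[OF 1 smooth_tm]) (use U1 Uc(3) in \<open>auto simp: kQ\<close>)
    then show "smooth_on (k ` Q) (\<Psi> \<circ> tinc \<circ> inv_into Q k)"
    proof (rule smooth_on_cong)
      fix z assume z: "z \<in> k ` Q"
      then have "norm (inv_into U c (fst z)) \<le> 1" using U1 Uc(3) by (auto simp: kQ)
      then show "tm (inv_into U c (fst z), snd z) = (\<Psi> \<circ> tinc \<circ> inv_into Q k) z"
        using inv_torus_chart[OF U, of z s] z kQ Q by (simp add: \<Psi>_tinc)
    qed
    let ?S = "{p \<in> (\<Psi> \<circ> tinc) ` points T. g0 p \<in> Q}"
    have S: "\<exists>x t. x \<in> U \<and> t \<in> {s<..<s+1} \<and> p = tm (x, t)" if p: "p \<in> ?S" for p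
    proof -
      obtain P where P: "P \<in> points T" "p = \<Psi> (tinc P)" "P \<in> Q" using p g0_\<Psi> by auto
      then obtain x t where "x \<in> U" "t \<in> {s<..<s+1}" "P = cls (x, t)" using Q(1) by auto
      then show ?thesis using P(2) \<Psi>_tinc U1 by metis
    qed
    define w where "w p = snd (\<beta> p) * cis (- (2 * pi * (s + 1 / 2)))" for p
    define tt where "tt p = s + 1 / 2 + 2 * arctan (Im (w p) / (norm (w p) + Re (w p))) * (1 / (2 * pi))" for p
    have tt: "smooth_on {p. w p \<noteq> 0 \<and> norm (w p) + Re (w p) \<noteq> 0} tt"
      "\<And>x t. norm x \<le> 1 \<Longrightarrow> t \<in> {s<..<s+1} \<Longrightarrow>
        tt (tm (x, t)) = t \<and> tm (x, t) \<in> {p. w p \<noteq> 0 \<and> norm (w p) + Re (w p) \<noteq> 0}"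
      unfolding tt_def[abs_def] w_def by (rule smooth_torus_coordinate(1), rule smooth_torus_coordinate(2))
    have "p \<in> {p. w p \<noteq> 0 \<and> norm (w p) + Re (w p) \<noteq> 0}" if p: "p \<in> ?S" for p
    proof -
      obtain x t where x: "x \<in> U" "t \<in> {s<..<s+1}" "p = tm (x, t)" using S[OF p] by blast
      show ?thesis using tt(2)[OF U1[OF x(1)] x(2)] unfolding x(3) by (rule conjunct2)
    qed
    then have 2: "smooth_on ?S tt" by (intro smooth_on_subset[OF tt(1)] subsetI)
    have "Cinf UNIV (\<lambda>p. sqrt 2 *\<^sub>R fst (\<beta> p))"
      by (intro Cinf_scaleR Cinf_fst Cinf_\<beta> Cinf_const Cinf_ident open_UNIV)
    then have 3: "smooth_on ?S (\<lambda>p. sqrt 2 *\<^sub>R fst (\<beta> p))" by (rule smooth_on_Cinf) simp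
    have "smooth_on ?S (\<lambda>p. c (sqrt 2 *\<^sub>R fst (\<beta> p)))"
      by (rule smooth_on_compose[OF 3 sc]) (use S in \<open>force simp: \<beta>_tm\<close>)
    then have "smooth_on ?S (\<lambda>p. (c (sqrt 2 *\<^sub>R fst (\<beta> p)), tt p))" using 2 by (rule smooth_on_Pair)
    then show "smooth_on ?S (k \<circ> g0)"
    proof (rule smooth_on_cong)
      fix p assume "p \<in> ?S"
      then obtain x t where x: "x \<in> U" "t \<in> {s<..<s+1}" "p = tm (x, t)" using S by blast
      have "k (g0 p) = (c x, t)"
        using torus_chart_cls[OF Uc(6) x(1), of s t c] x(2,3) g0_tm[OF U1[OF x(1)]] Q(2) by simp
      then show "(c (sqrt 2 *\<^sub>R fst (\<beta> p)), tt p) = (k \<circ> g0) p"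
        using tt(2)[OF U1[OF x(1)] x(2)] x(3) by (simp add: \<beta>_tm)
    qed
  qed
  moreover have "diffeomorphism BN (restrict_to (pullback OB \<Psi> ?M) (Inr ` points BN)) Inr"
  proof (rule pullback_piece[OF pb ci_BN compact_BN continuous_Inr, where g=g1])
    show "g1 (\<Psi> (Inr p)) = p" if "p \<in> points BN" for p by (rule g1_\<Psi>[OF that])
  next
    fix Q k assume "(Q, k) \<in> charts BN"
    then obtain U c W d where U: "(U, c) \<in> charts D" and W: "(W, d) \<in> charts (submanifold (cball 0 1) :: (complex, complex) charted)"
      and Q: "Q = (U \<inter> boundary D) \<times> W" "k = map_prod c d"
      by (auto simp: binding_nbhd_def charts_product restrict_to_def)
    note Uc = manifold_chart[OF V U] and Wd = manifold_chart[OF manifold_cball W]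
    have si: "smooth_on (c ` U) (inv_into U c)" "smooth_on (d ` W) (inv_into W d)" "smooth_on U c" "smooth_on W d"
      using U W by (auto simp: charts_submanifold)
    have kQ: "k ` Q = c ` (U \<inter> boundary D) \<times> d ` W" unfolding Q by (auto simp: map_prod_def)
    have injB: "inj_on c (U \<inter> boundary D)" using Uc(3) by (rule inj_on_subset) auto
    have 1: "smooth_on (k ` Q) (\<lambda>z. inv_into U c (fst z))"
      by (rule smooth_on_compose[OF smooth_on_fst[OF smooth_on_id] si(1)]) (auto simp: kQ)
    have 2: "smooth_on (k ` Q) (\<lambda>z. inv_into W d (snd z))"
      by (rule smooth_on_compose[OF smooth_on_snd[OF smooth_on_id] si(2)]) (auto simp: kQ)
    have W1: "norm z \<le> 1" if "z \<in> W" for z using that Wd(6) by auto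
    have "smooth_on (k ` Q) (\<lambda>z. bm (inv_into U c (fst z), inv_into W d (snd z)))"
      by (rule smooth_on_compose[OF smooth_on_Pair[OF 1 2] smooth_bm]) (use W1 Wd(3) in \<open>auto simp: kQ\<close>)
    then show "smooth_on (k ` Q) (\<Psi> \<circ> Inr \<circ> inv_into Q k)"
    proof (rule smooth_on_cong)
      fix z assume z: "z \<in> k ` Q"
      have "inv_into Q k z = (inv_into (U \<inter> boundary D) c (fst z), inv_into W d (snd z))"
        unfolding Q by (rule inv_into_product_chart[OF injB Wd(3)]) (use z kQ in simp)
      moreover have "inv_into (U \<inter> boundary D) c (fst z) = inv_into U c (fst z)"
        using z kQ Uc(3) inv_into_Int[OF Uc(3)] by auto
      ultimately show "bm (inv_into U c (fst z), inv_into W d (snd z)) = (\<Psi> \<circ> Inr \<circ> inv_into Q k) z"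
        by (simp add: \<Psi>_Inr)
    qed
    let ?S = "{p \<in> (\<Psi> \<circ> Inr) ` points BN. g1 p \<in> Q}"
    have S: "g1 p \<in> (U \<inter> boundary D) \<times> W" "fst (\<beta> p) \<noteq> 0" if "p \<in> ?S" for p
    proof -
      show "g1 p \<in> (U \<inter> boundary D) \<times> W" using that Q by auto
      then have "norm (sgn (fst (\<beta> p))) = 1" by (auto simp: g1_def boundary_cball)
      then show "fst (\<beta> p) \<noteq> 0" by auto
    qed
    have C\<beta>: "Cinf UNIV (\<lambda>p. fst (\<beta> p))" by (intro Cinf_fst Cinf_\<beta> Cinf_ident open_UNIV)
    have o: "open {p. fst (\<beta> p) \<noteq> 0}"
      by (intro open_Collect_neq Cinf_continuous_on[OF C\<beta>] continuous_on_const)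
    have "Cinf {p. fst (\<beta> p) \<noteq> 0} (\<lambda>p. sgn (fst (\<beta> p)))"
      by (rule Cinf_sgn[OF Cinf_subset[OF C\<beta> o]]) auto
    then have 3: "smooth_on ?S (\<lambda>p. sgn (fst (\<beta> p)))" by (rule smooth_on_Cinf) (use S(2) in blast)
    have "Cinf UNIV (\<lambda>p. sqrt 2 *\<^sub>R snd (\<beta> p))"
      by (intro Cinf_scaleR Cinf_snd Cinf_\<beta> Cinf_const Cinf_ident open_UNIV)
    then have 4: "smooth_on ?S (\<lambda>p. sqrt 2 *\<^sub>R snd (\<beta> p))" by (rule smooth_on_Cinf) simp
    have "smooth_on ?S (\<lambda>p. c (sgn (fst (\<beta> p))))"
      by (rule smooth_on_compose[OF 3 si(3)]) (use S(1) in \<open>auto simp: g1_def\<close>)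
    moreover have "smooth_on ?S (\<lambda>p. d (sqrt 2 *\<^sub>R snd (\<beta> p)))"
      by (rule smooth_on_compose[OF 4 si(4)]) (use S(1) in \<open>auto simp: g1_def\<close>)
    ultimately have "smooth_on ?S (\<lambda>p. (c (sgn (fst (\<beta> p))), d (sqrt 2 *\<^sub>R snd (\<beta> p))))"
      by (rule smooth_on_Pair)
    then show "smooth_on ?S (k \<circ> g1)" by (rule smooth_on_cong) (simp add: g1_def Q)
  qed
  ultimately show "is_open_book D id (pullback OB \<Psi> ?M)"
    using closed_pullback by (simp add: is_open_book_def)
qed

end

theorem corollary1p2:
  fixes n :: nat
  assumes "n \<ge> 4"
    and "DIM('e::euclidean_space) = n - 3"
    and "DIM('f::euclidean_space) = n - 1"
    and "DIM('h::euclidean_space) = n + 1"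
  shows "open_book_decomposition (submanifold (sphere 0 1) :: ('h, 'f \<times> real) charted)
           (submanifold (cball 0 1) :: ('f, 'f) charted) id \<and>
         (\<forall>(V :: ('a, 'e) charted) \<phi>.
            open_book_decomposition (submanifold (sphere 0 1) :: ('f, 'e \<times> real) charted) V \<phi> \<longrightarrow>
            spun_embeds V \<phi> (submanifold (cball 0 1) :: ('f, 'f) charted) id)"
proof (intro conjI allI impI)
  have dim: "DIM('h) = DIM('f \<times> real) + 1" using assms by simp
  \<comment> \<open>Both spaces have dimension \<open>n + 1\<close>. A linear isometry between them
    splits off the complex plane in which the pages of the standard open book rotate.\<close>
  have "DIM('f \<times> complex) = DIM('h)" using assms by simp
  then obtain \<alpha> :: "'f \<times> complex \<Rightarrow> 'h" and \<beta> where "linear \<alpha>" "linear \<beta>" "\<And>x. norm (\<alpha> x) = norm x"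
    "\<And>y. norm (\<beta> y) = norm y" "\<And>x. \<beta> (\<alpha> x) = x" "\<And>y. \<alpha> (\<beta> y) = y"
    using isomorphisms_UNIV_UNIV by blast
  then interpret ball_book \<alpha> \<beta> by (rule ball_book.intro)
  show "open_book_decomposition (submanifold (sphere 0 1) :: ('h, 'f \<times> real) charted)
           (submanifold (cball 0 1) :: ('f, 'f) charted) id"
    unfolding open_book_decomposition_def
    using closed_manifold_sphere[OF dim] page_ball is_open_book_ball[OF dim] by blast
next
  fix V :: "('a, 'e) charted" and \<phi>
  assume "open_book_decomposition (submanifold (sphere 0 1) :: ('f, 'e \<times> real) charted) V \<phi>"
  then obtain N f where "closed_manifold (submanifold (sphere 0 1) :: ('f, 'e \<times> real) charted)"
    "page_with_monodromy V \<phi>" "is_open_book V \<phi> N"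
    "diffeomorphism (submanifold (sphere 0 1) :: ('f, 'e \<times> real) charted) N f"
    unfolding open_book_decomposition_def by blast
  then have "sphere_book V \<phi> N f" by unfold_locales
  then show "spun_embeds V \<phi> (submanifold (cball 0 1) :: ('f, 'f) charted) id"
    using sphere_book.book_maps book_maps.spun_embeds_ball by blast
qed

end
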